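(* Let $Q\subset\mathbb{R}^4$ be a $4$-dimensional prismatoid with bases $Q^+$ and $Q^-$. Then the width of $Q$ is at most four.
   Context: A prismatoid is a (convex) polytope $Q$ together with two parallel facets $Q^+$ and $Q^-$ of $Q$, called its bases, such that all the vertices of $Q$ lie in $Q^+\cup Q^-$. The width of the prismatoid is the distance between $Q^+$ and $Q^-$ in the dual graph of $Q$, i.e. the minimum number of steps needed to go from $Q^+$ to $Q^-$, where a step consists in moving from a facet of $Q$ to an adjacent facet (two facets of a $d$-polytope being adjacent if they share a common $(d-2)$-dimensional face). *)

theory Defs
  imports "HOL-Analysis.Analysis" "HOL-Library.Extended_Nat"
begin

(* affine_parallel is reflexive, so the two bases have to be required to be distinct. *)
definition prismatoid :: "'a::euclidean_space set \<Rightarrow> 'a set \<Rightarrow> 'a set \<Rightarrow> bool" where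
  "prismatoid Q Qp Qm \<longleftrightarrow>
     polytope Q \<and> Qp facet_of Q \<and> Qm facet_of Q \<and> Qp \<noteq> Qm \<and>
     affine_parallel (affine hull Qp) (affine hull Qm) \<and>
     {v. v extreme_point_of Q} \<subseteq> Qp \<union> Qm"

definition adjacent_facets :: "'a::euclidean_space set \<Rightarrow> 'a set \<Rightarrow> 'a set \<Rightarrow> bool" where
  "adjacent_facets Q F G \<longleftrightarrow>
     F facet_of Q \<and> G facet_of Q \<and> F \<noteq> G \<and>
     (\<exists>R. R face_of F \<and> R face_of G \<and> aff_dim R = aff_dim Q - 2)"

definition dual_graph :: "'a::euclidean_space set \<Rightarrow> 'a set rel" where
  "dual_graph Q = {(F, G). adjacent_facets Q F G}"

(* The least number of steps of a walk from Qp to Qm in the dual graph.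
   The infimum is taken in enat, so it is infinite if there is no such walk. *)
definition width :: "'a::euclidean_space set \<Rightarrow> 'a set \<Rightarrow> 'a set \<Rightarrow> enat" where
  "width Q Qp Qm = (INF n \<in> {n. (Qp, Qm) \<in> dual_graph Q ^^ n}. enat n)"

end

theory Submission
  imports Defs
begin

text \<open>
The two bases are projected along their common normal to \<open>\<real>\<^sup>3\<close>; let \<open>P\<close> and \<open>R\<close> be the sets of
projected vertices. A linear functional \<open>u\<close> on \<open>\<real>\<^sup>3\<close>, corrected by the right multiple of the normal
direction, is maximal on a face of \<open>Q\<close> that contains precisely the vertices of one base that maximize
\<open>u\<close> over \<open>P\<close> and the vertices of the other base that maximize \<open>u\<close> over \<open>R\<close>. So the facets of \<open>Q\<close> between
the bases are the vertices of the overlay of two maps on the sphere of directions, the red normal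
fan of \<open>P\<close> and the blue normal fan of \<open>R\<close>. A red vertex is a facet adjacent to the first base, a blue
vertex is a facet adjacent to the second one, and consecutive overlay vertices on an arc are adjacent
facets. Hence the width is at most four as soon as there are a red vertex \<open>z\<close>, a crossing \<open>x\<close> of a red
and a blue arc, and a blue vertex \<open>w\<close> such that \<open>z\<close> and \<open>x\<close> are consecutive on the red arc and \<open>x\<close> and
\<open>w\<close> are consecutive on the blue arc. This is the predicate \<open>short_path\<close>, phrased with maximizers only.

A small shear of \<open>R\<close> makes the two maps transversal (\<open>eventually_general_position\<close>), and the closed
conditions in \<open>short_path\<close> pass to the limit when the shear tends to the identity
(\<open>short_path_exists\<close>). It remains to treat transversal maps (\<open>short_path_in_general_position\<close>), where a
counting argument works. Let \<open>N\<close> be the number of regions of the overlay, \<open>X\<close> the number of crossings,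
and for a region let \<open>i\<close> and \<open>j\<close> be the numbers of its blue and red sides and \<open>m\<close> the number of its
corners that are crossings.

\<^item> Going round a region, a block of at least two red sides followed by a block of at least two blue
  sides is a short path. If there is none, then \<open>2 * ((2 - i) + (2 - j)) + m \<ge> 4\<close> with truncated
  subtraction (\<open>crossings_at_lower_bound\<close>).
\<^item> A crossing is a corner of four regions, so the numbers \<open>m\<close> add up to at most \<open>4 * X\<close>
  (\<open>sum_crossings_at\<close>).
\<^item> Inside a blue cell, the regions with at least two blue sides are convex and disjoint. This limits how
  often they can alternate along the boundary of the cell (\<open>sum_neighbours_bound\<close>), and summation over
  the cells shows that the deficiencies \<open>2 - i\<close> add up to at most \<open>2 * N - 2 * X - 2 * card R\<close>
  (\<open>deficiency_bound\<close>); symmetrically for \<open>2 - j\<close> and \<open>P\<close>.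
\<^item> Together these give \<open>N \<ge> X + card P + card R\<close>, which contradicts the inequality
  \<open>N + 2 \<le> X + card P + card R\<close> (\<open>euler_bound\<close>) that Euler's formula for the three maps implies.

The last inequality is proved by a sweep around a generic axis: every region that avoids the axis has
an easternmost corner. A crossing is the easternmost corner of at most one region, and a region whose
easternmost corner is a red or blue vertex is determined by the red or blue cell that contains it.
\<close>

section \<open>Maximizers of a linear functional\<close>

definition maximizers :: "'a::real_inner set \<Rightarrow> 'a \<Rightarrow> 'a set" where
  "maximizers S u = {s \<in> S. \<forall>t\<in>S. u \<bullet> t \<le> u \<bullet> s}"

lemma maximizers_subset: "maximizers S u \<subseteq> S"
  by (auto simp: maximizers_def)

lemma maximizers_nonempty:
  assumes "finite S" "S \<noteq> {}"
  shows "maximizers S u \<noteq> {}"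
proof -
  obtain s where "s \<in> S" "\<forall>t\<in>S. u \<bullet> t \<le> u \<bullet> s"
    using Max_in[of "(\<bullet>) u ` S"] Max_ge[of "(\<bullet>) u ` S"] assms by (fastforce simp del: Max_in)
  then show ?thesis by (auto simp: maximizers_def)
qed

lemma maximizers_unique_less:
  assumes "maximizers S u = {s}" "t \<in> S" "t \<noteq> s" "finite S"
  shows "u \<bullet> t < u \<bullet> s"
proof (rule ccontr)
  assume "\<not> ?thesis"
  moreover have "\<forall>x\<in>S. u \<bullet> x \<le> u \<bullet> s" using assms(1) by (auto simp: maximizers_def)
  ultimately have "t \<in> maximizers S u" using assms(2) by (fastforce simp: maximizers_def)
  then show False using assms by auto
qed

text \<open>
The finitely many strict inequalities survive a small change of the functional.
\<close>

lemma eventually_strict_perturb: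
  fixes u v :: "'a::real_inner"
  assumes "finite S"
  shows "\<forall>\<^sub>F e in at_right (0::real). \<forall>x\<in>S. u \<bullet> x < 0 \<longrightarrow> (u + e *\<^sub>R v) \<bullet> x < 0"
proof (intro eventually_ball_finite[OF assms] ballI)
  fix x assume "x \<in> S"
  show "\<forall>\<^sub>F e in at_right (0::real). u \<bullet> x < 0 \<longrightarrow> (u + e *\<^sub>R v) \<bullet> x < 0"
  proof (cases "u \<bullet> x < 0")
    case True
    have "((\<lambda>e. (u + e *\<^sub>R v) \<bullet> x) \<longlongrightarrow> (u + 0 *\<^sub>R v) \<bullet> x) (at_right (0::real))"
      by (intro tendsto_intros)
    then have "\<forall>\<^sub>F e in at_right (0::real). (u + e *\<^sub>R v) \<bullet> x < 0"
      using True by (auto dest: order_tendstoD)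
    then show ?thesis by (rule eventually_mono) auto
  qed auto
qed

text \<open>
A small perturbation \<open>v\<close> of a functional \<open>u\<close> only breaks the ties of \<open>u\<close>. In terms of normal fans, this is
the step from a cone to the cone that is entered from it in direction \<open>v\<close>.
\<close>

lemma maximizers_perturb:
  fixes u v :: "'a::real_inner"
  assumes "finite S"
  shows "\<forall>\<^sub>F e in at_right (0::real). maximizers S (u + e *\<^sub>R v) = maximizers (maximizers S u) v"
proof -
  have "\<forall>\<^sub>F e in at_right (0::real). \<forall>x\<in>(\<lambda>(s,t). t - s) ` (S \<times> S). u \<bullet> x < 0 \<longrightarrow> (u + e *\<^sub>R v) \<bullet> x < 0"
    using assms by (intro eventually_strict_perturb) auto
  moreover have "\<forall>\<^sub>F e in at_right (0::real). 0 < e"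
    by (rule eventually_at_right_less)
  ultimately show ?thesis
  proof eventually_elim
    case (elim e)
    have strict: "(u + e *\<^sub>R v) \<bullet> t < (u + e *\<^sub>R v) \<bullet> s" if "s \<in> S" "t \<in> S" "u \<bullet> t < u \<bullet> s" for s t
      using elim(1) that by (force simp: inner_diff_right)
    show ?case
    proof (intro equalityI subsetI)
      fix s assume s: "s \<in> maximizers S (u + e *\<^sub>R v)"
      have 1: "s \<in> maximizers S u"
        using s strict by (auto simp: maximizers_def) (meson leD not_le)
      have "v \<bullet> t \<le> v \<bullet> s" if "t \<in> maximizers S u" for t
      proof -
        have "u \<bullet> t = u \<bullet> s" using that 1 by (auto simp: maximizers_def intro: antisym)
        moreover have "(u + e *\<^sub>R v) \<bullet> t \<le> (u + e *\<^sub>R v) \<bullet> s"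
          using s that by (auto simp: maximizers_def)
        ultimately show ?thesis using elim(2) by (simp add: inner_add_left)
      qed
      then show "s \<in> maximizers (maximizers S u) v" using 1 by (auto simp: maximizers_def)
    next
      fix s assume s: "s \<in> maximizers (maximizers S u) v"
      then have sS: "s \<in> S" and max: "\<forall>t\<in>S. u \<bullet> t \<le> u \<bullet> s"
        by (auto simp: maximizers_def)
      have "(u + e *\<^sub>R v) \<bullet> t \<le> (u + e *\<^sub>R v) \<bullet> s" if t: "t \<in> S" for t
      proof (cases "u \<bullet> t < u \<bullet> s")
        case True then show ?thesis using strict sS t by (simp add: less_imp_le)
      next
        case False
        then have eq: "u \<bullet> t = u \<bullet> s" using max t by (simp add: antisym)
        then have "t \<in> maximizers S u" using t max by (auto simp: maximizers_def)
        then have "v \<bullet> t \<le> v \<bullet> s" using s by (auto simp: maximizers_def)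
        then show ?thesis using eq elim(2) by (simp add: inner_add_left)
      qed
      then show "s \<in> maximizers S (u + e *\<^sub>R v)" using sS by (auto simp: maximizers_def)
    qed
  qed
qed

lemma maximizers_perturb_both:
  fixes u v :: "'a::real_inner"
  assumes "finite P" "finite R"
  obtains u' where "maximizers P u' = maximizers (maximizers P u) v"
    "maximizers R u' = maximizers (maximizers R u) v"
proof -
  have "\<forall>\<^sub>F e in at_right (0::real). maximizers P (u + e *\<^sub>R v) = maximizers (maximizers P u) v \<and>
      maximizers R (u + e *\<^sub>R v) = maximizers (maximizers R u) v"
    using maximizers_perturb[OF assms(1)] maximizers_perturb[OF assms(2)] by (rule eventually_conj)
  then show thesis
    using eventually_happens' that trivial_limit_at_right_real by fastforce
qed

lemma maximizers_pair:
  assumes "v \<bullet> t < v \<bullet> s"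
  shows "maximizers {s, t} v = {s}"
  using assms by (auto simp: maximizers_def)

lemma maximizers_singleton [simp]: "maximizers {s} v = {s}"
  by (auto simp: maximizers_def)

lemma maximizers_pair_eqI:
  assumes "s \<in> S" "t \<in> S" "v \<bullet> t = v \<bullet> s" "\<And>q. q \<in> S \<Longrightarrow> q \<noteq> s \<Longrightarrow> q \<noteq> t \<Longrightarrow> v \<bullet> q < v \<bullet> s"
  shows "maximizers S v = {s, t}"
proof -
  have le: "v \<bullet> q \<le> v \<bullet> s" if "q \<in> S" for q
    using assms(3) assms(4)[OF that] by (cases "q = s \<or> q = t") (auto simp: less_imp_le)
  show ?thesis
  proof (intro equalityI subsetI)
    fix q assume q: "q \<in> maximizers S v"
    then have "\<not> v \<bullet> q < v \<bullet> s" "q \<in> S" using assms(1) by (auto simp: maximizers_def not_less)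
    then show "q \<in> {s, t}" using assms(4) by blast
  next
    fix q assume "q \<in> {s, t}"
    then show "q \<in> maximizers S v" using le assms(1-3) by (auto simp: maximizers_def)
  qed
qed

lemma maximizers_singleton_eqI:
  assumes "s \<in> S" "\<And>q. q \<in> S \<Longrightarrow> q \<noteq> s \<Longrightarrow> v \<bullet> q < v \<bullet> s"
  shows "maximizers S v = {s}"
  using maximizers_pair_eqI[OF assms(1,1) refl] assms(2) by auto

lemma maximizers_value_eq:
  assumes "s \<in> maximizers S v" "t \<in> maximizers S v"
  shows "v \<bullet> s = v \<bullet> t"
  using assms by (auto simp: maximizers_def intro: antisym)

lemma maximizers_scaleR: "0 < k \<Longrightarrow> maximizers S (k *\<^sub>R u) = maximizers S u"
  by (simp add: maximizers_def)

text \<open>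
The vector is built one condition at a time: adding a small multiple of \<open>z\<close> to a vector keeps the
earlier conditions and makes the product with \<open>z\<close> nonzero. All genericity in the proof comes from here.
\<close>

lemma generic_vector_exists:
  fixes Z :: "'a::real_inner set"
  assumes "finite Z" "0 \<notin> Z"
  shows "\<exists>v. \<forall>z\<in>Z. v \<bullet> z \<noteq> 0"
  using assms
proof (induction Z rule: finite_induct)
  case (insert z Z)
  then obtain v where v: "\<forall>x\<in>Z. v \<bullet> x \<noteq> 0" by auto
  have *: "finite (Z \<union> uminus ` Z)" using insert by auto
  have ev: "\<forall>\<^sub>F e in at_right (0::real). \<forall>x\<in>Z \<union> uminus ` Z. v \<bullet> x < 0 \<longrightarrow> (v + e *\<^sub>R w) \<bullet> x < 0" for w
    by (rule eventually_strict_perturb[OF *])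
  define w where "w = (if v \<bullet> z < 0 then - z else z)"
  obtain e :: real where e: "0 < e" "\<forall>x\<in>Z \<union> uminus ` Z. v \<bullet> x < 0 \<longrightarrow> (v + e *\<^sub>R w) \<bullet> x < 0"
    using eventually_happens'[OF _ eventually_conj[OF eventually_at_right_less ev[of w]]] by auto
  have "(v + e *\<^sub>R w) \<bullet> x \<noteq> 0" if "x \<in> Z" for x
  proof (cases "v \<bullet> x < 0")
    case True then show ?thesis using e that by force
  next
    case False
    then have "v \<bullet> (- x) < 0" using v that by force
    then have "(v + e *\<^sub>R w) \<bullet> (- x) < 0" using e that by blast
    then show ?thesis by auto
  qed
  moreover have "(v + e *\<^sub>R w) \<bullet> z \<noteq> 0"
  proof -
    have "z \<bullet> z > 0" using insert by auto
    then have "e * (z \<bullet> z) > 0" using e by simp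
    then show ?thesis by (auto simp: w_def inner_add_left split: if_splits)
  qed
  ultimately show ?case by (intro exI[of _ "v + e *\<^sub>R w"]) auto
qed auto

section \<open>The rays of a pointed cone in cyclic order\<close>

lemma inner_diff_flip: "(a - b) \<bullet> v = v \<bullet> a - v \<bullet> b"
  by (simp add: inner_diff_left inner_diff_right inner_commute)

lemma cross3_dot_cyclic: "cross3 x y \<bullet> z = x \<bullet> cross3 y z" "cross3 x y \<bullet> z = cross3 y z \<bullet> x"
  by (simp_all add: cross3_simps)

lemma cross3_dot_swap: "cross3 x y \<bullet> z = - (cross3 y x \<bullet> z)" "cross3 x y \<bullet> z = - (cross3 x z \<bullet> y)"
  by (simp_all add: cross3_simps)

lemma orthogonal_to_both:
  assumes "a \<bullet> y = 0" "b \<bullet> y = 0"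
  shows "(cross3 a b \<bullet> cross3 a b) *\<^sub>R y = (cross3 a b \<bullet> y) *\<^sub>R cross3 a b"
proof -
  have "cross3 (cross3 a b) y = 0"
    using assms by (simp add: cross_skew[of "cross3 a b"] Lagrange inner_commute)
  then have "cross3 (cross3 a b) (cross3 (cross3 a b) y) = 0" by simp
  then show ?thesis by (simp add: Lagrange)
qed

lemma orthogonal_to_both_parallel:
  assumes "a \<bullet> x = 0" "b \<bullet> x = 0" "a \<bullet> y = 0" "b \<bullet> y = 0" "cross3 a b \<noteq> 0"
  shows "cross3 x y = 0"
proof -
  let ?w = "cross3 a b"
  have "(?w \<bullet> ?w) *\<^sub>R ((?w \<bullet> ?w) *\<^sub>R cross3 x y) = cross3 ((?w \<bullet> ?w) *\<^sub>R x) ((?w \<bullet> ?w) *\<^sub>R y)"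
    by (simp add: cross_mult_left cross_mult_right)
  also have "\<dots> = 0"
    using assms by (simp add: orthogonal_to_both cross_mult_left cross_mult_right)
  finally show ?thesis using assms(5) by simp
qed

text \<open>
Cramer's rule for a vector in the plane spanned by two others.
\<close>

lemma in_plane_of_two:
  assumes "cross3 a b \<bullet> c = 0"
  shows "(cross3 a b \<bullet> cross3 a b) *\<^sub>R c = (cross3 c b \<bullet> cross3 a b) *\<^sub>R a + (cross3 a c \<bullet> cross3 a b) *\<^sub>R b"
proof -
  have "(cross3 a b \<bullet> cross3 a b) *\<^sub>R c - (cross3 c b \<bullet> cross3 a b) *\<^sub>R a - (cross3 a c \<bullet> cross3 a b) *\<^sub>R b
     = (cross3 a b \<bullet> c) *\<^sub>R cross3 a b"
    by (simp add: cross3_simps forall_3)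
  then show ?thesis using assms by (simp add: algebra_simps)
qed

text \<open>
The cone generated by \<open>D\<close> is pointed because \<open>h\<close> is negative on \<open>D\<close>, and it has nonempty interior. A
section of it is a convex polygon. For a region of the overlay, given by a vertex \<open>p\<close> of \<open>P\<close> and a
vertex \<open>r\<close> of \<open>R\<close>, the set \<open>D\<close> consists of the directions from \<open>p\<close> and \<open>r\<close> to the other points. The
region is the dual cone, so its sides are the extreme rays of \<open>D\<close> and its corners are the sides of the
polygon.
\<close>

locale pointed_cone =
  fixes D :: "(real^3) set" and h :: "real^3"
  assumes finite_D: "finite D"
    and h_neg: "x \<in> D \<Longrightarrow> h \<bullet> x < 0"
    and spanning: "(\<And>x. x \<in> D \<Longrightarrow> v \<bullet> x = 0) \<Longrightarrow> v = 0"
    and not_parallel: "x \<in> D \<Longrightarrow> y \<in> D \<Longrightarrow> x \<noteq> y \<Longrightarrow> cross3 x y \<noteq> 0"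
begin

definition rays :: "(real^3) set" where
  "rays = {x \<in> D. \<exists>u. u \<bullet> x = 0 \<and> (\<forall>y\<in>D - {x}. u \<bullet> y < 0)}"

text \<open>
The ray \<open>y\<close> comes next after \<open>x\<close> when one walks round the cone: the plane through both is a supporting
plane, and the sign of the cross product fixes the sense of rotation.
\<close>

definition follows :: "real^3 \<Rightarrow> real^3 \<Rightarrow> bool" where
  "follows x y \<longleftrightarrow> x \<in> rays \<and> y \<in> rays \<and> x \<noteq> y \<and> (\<forall>w\<in>D. cross3 x y \<bullet> w \<le> 0)"

lemma finite_rays: "finite rays"
  using finite_D by (auto simp: rays_def)

lemma not_coplanar:
  assumes "v \<noteq> 0"
  shows "\<exists>x\<in>D. v \<bullet> x \<noteq> 0"
  using assms spanning by blast

text \<open>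
A supporting plane that touches the cone only in the ray \<open>x\<close> is rotated about \<open>x\<close> until it hits another
element of \<open>D\<close>. If it hits several at once, they lie in one plane with \<open>x\<close>, and the one farthest from \<open>x\<close> in
angle is an extreme ray.
\<close>

lemma follower_exists:
  assumes "x \<in> rays"
  shows "\<exists>y. follows x y"
proof -
  from assms obtain u where x: "x \<in> D" and ux: "u \<bullet> x = 0" and u: "\<And>y. y \<in> D \<Longrightarrow> y \<noteq> x \<Longrightarrow> u \<bullet> y < 0"
    by (auto simp: rays_def)
  have x0: "x \<noteq> 0" using h_neg[OF x] by auto
  define D' where "D' = D - {x}"
  have fD': "finite D'" using finite_D by (simp add: D'_def)
  have D'ne: "D' \<noteq> {}"
  proof
    assume "D' = {}"
    obtain v where "v \<noteq> 0" "orthogonal v x"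
      using orthogonal_to_vector_exists[of x] by (auto simp: orthogonal_commute)
    then show False using not_coplanar[of v] \<open>D' = {}\<close> by (auto simp: D'_def orthogonal_def)
  qed
  have u': "u \<bullet> y < 0" if "y \<in> D'" for y using that u by (auto simp: D'_def)
  \<comment> \<open>The planes through \<open>x\<close> have normals \<open>e + t *\<^sub>R u\<close>. The rotation stops at the largest ratio \<open>M\<close>.\<close>
  define e where "e = cross3 u x"
  have ex: "e \<bullet> x = 0" by (simp add: e_def dot_cross_self)
  define f where "f = (\<lambda>y. (e \<bullet> y) / (- (u \<bullet> y)))"
  define M where "M = Max (f ` D')"
  define z where "z = e + M *\<^sub>R u"
  have zx: "z \<bullet> x = 0" using ex ux by (simp add: z_def inner_add_left)
  have zf: "z \<bullet> y = (- (u \<bullet> y)) * (f y - M)" if "y \<in> D'" for y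
    using u'[OF that] by (simp add: z_def f_def inner_add_left field_simps)
  have fM: "f y \<le> M" if "y \<in> D'" for y using that fD' by (simp add: M_def)
  have zle: "z \<bullet> y \<le> 0" if "y \<in> D'" for y
    using zf[OF that] fM[OF that] u'[OF that] by (simp add: mult_nonpos_nonpos)
  define E where "E = {y \<in> D'. z \<bullet> y = 0}"
  have fE: "finite E" using fD' by (simp add: E_def)
  have Ene: "E \<noteq> {}"
  proof -
    have "M \<in> f ` D'" unfolding M_def using fD' D'ne by (intro Max_in) auto
    then obtain y where "y \<in> D'" "f y = M" by auto
    then show ?thesis using zf[of y] by (auto simp: E_def)
  qed
  \<comment> \<open>Within the touched plane, \<open>g\<close> measures the angle from \<open>x\<close>: smaller values are farther away.\<close>
  define g where "g = (\<lambda>y. (x \<bullet> y) / (- (u \<bullet> y)))"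
  define m where "m = Min (g ` E)"
  have "m \<in> g ` E" unfolding m_def using fE Ene by (intro Min_in) auto
  then obtain y where y: "y \<in> E" "g y = m" by auto
  have gm: "m \<le> g w" if "w \<in> E" for w using that fE by (simp add: m_def)
  have yD': "y \<in> D'" and yD: "y \<in> D" and zy: "z \<bullet> y = 0" and yx: "y \<noteq> x"
    using y by (auto simp: E_def D'_def)
  define k where "k = - (x + m *\<^sub>R u)"
  have kg: "k \<bullet> w = - (- (u \<bullet> w)) * (g w - m)" if "w \<in> D'" for w
    using u'[OF that] by (simp add: k_def inner_add_left inner_diff_left right_diff_distrib') (simp add: g_def)
  have kx: "k \<bullet> x < 0" using x0 ux by (simp add: k_def inner_add_left inner_diff_left)
  have ky: "k \<bullet> y = 0" using kg[OF yD'] y by simp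
  have zk: "cross3 z k \<noteq> 0"
  proof
    assume "cross3 z k = 0"
    then have "cross3 (cross3 z k) x = 0" by simp
    then have "(k \<bullet> x) *\<^sub>R z = 0"
      using zx by (simp add: cross_skew[of "cross3 z k"] Lagrange inner_commute)
    then have "z = 0" using kx by simp
    then have "(e + M *\<^sub>R u) \<bullet> e = 0" by (simp add: z_def)
    moreover have "u \<bullet> e = 0" by (simp add: e_def dot_cross_self)
    ultimately have "e = 0" by (simp add: inner_add_left)
    then have "cross3 x e = 0" by simp
    then have "(x \<bullet> x) *\<^sub>R u = 0" using ux by (simp add: e_def Lagrange inner_commute)
    then show False using x0 u'[of y] yD' by simp
  qed
  have kneg: "k \<bullet> w < 0" if "w \<in> E" "w \<noteq> y" for w
  proof -
    have w: "w \<in> D'" "z \<bullet> w = 0" using that by (auto simp: E_def)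
    have "k \<bullet> w \<le> 0" using kg[OF w(1)] gm[OF that(1)] u'[OF w(1)] by (simp add: mult_nonpos_nonneg)
    moreover have "k \<bullet> w \<noteq> 0"
    proof
      assume "k \<bullet> w = 0"
      then have "cross3 w y = 0"
        using orthogonal_to_both_parallel[OF w(2) _ zy ky zk] by simp
      then show False using not_parallel[of w y] w yD that by (auto simp: D'_def)
    qed
    ultimately show ?thesis by simp
  qed
  \<comment> \<open>Tilting \<open>z\<close> slightly by \<open>k\<close> gives a supporting plane that touches \<open>D\<close> in \<open>y\<close> only.\<close>
  obtain \<epsilon> :: real where eps: "0 < \<epsilon>" "\<forall>w\<in>D. z \<bullet> w < 0 \<longrightarrow> (z + \<epsilon> *\<^sub>R k) \<bullet> w < 0"
    using eventually_happens'[OF trivial_limit_at_right_real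
        eventually_conj[OF eventually_at_right_less eventually_strict_perturb[OF finite_D]]]
    by blast
  have "(z + \<epsilon> *\<^sub>R k) \<bullet> w < 0" if w: "w \<in> D - {y}" for w
  proof (cases "z \<bullet> w < 0")
    case True then show ?thesis using eps w by auto
  next
    case False
    then have "w = x \<or> w \<in> E" using w zle[of w] by (auto simp: E_def D'_def)
    then have "k \<bullet> w < 0" "z \<bullet> w = 0" using kx kneg w zx by (auto simp: E_def)
    then show ?thesis using eps(1) by (simp add: inner_add_left mult_pos_neg)
  qed
  moreover have "(z + \<epsilon> *\<^sub>R k) \<bullet> y = 0" using zy ky by (simp add: inner_add_left)
  ultimately have yr: "y \<in> rays" using yD by (auto simp: rays_def)
  let ?w = "cross3 x y"
  have wne: "?w \<noteq> 0" using not_parallel[OF x yD] yx by auto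
  have par: "(?w \<bullet> ?w) *\<^sub>R z = (?w \<bullet> z) *\<^sub>R ?w"
    using orthogonal_to_both[of x z y] zx zy by (simp add: inner_commute)
  have "?w \<bullet> e = - ((x \<bullet> x) * (u \<bullet> y))"
  proof -
    have "?w \<bullet> e = (x \<bullet> u) * (y \<bullet> x) - (x \<bullet> x) * (y \<bullet> u)"
      by (simp add: e_def cross3_simps)
    then show ?thesis using ux by (simp add: inner_commute)
  qed
  moreover have "?w \<bullet> u = e \<bullet> y" by (simp add: e_def cross3_simps)
  moreover have "M = f y" using zf[OF yD'] zy u'[OF yD'] by simp
  ultimately have "?w \<bullet> z = - ((x \<bullet> x) * (u \<bullet> y)) + (e \<bullet> y)\<^sup>2 / (- (u \<bullet> y))"
    by (simp add: z_def inner_add_right inner_diff_right f_def power2_eq_square)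
  moreover have "- ((x \<bullet> x) * (u \<bullet> y)) > 0" using x0 u'[OF yD'] by (simp add: mult_pos_neg)
  moreover have "(e \<bullet> y)\<^sup>2 / (- (u \<bullet> y)) \<ge> 0" using u'[OF yD'] by (intro divide_nonneg_nonneg) auto
  ultimately have wz: "?w \<bullet> z > 0" by linarith
  have "?w \<bullet> v \<le> 0" if "v \<in> D" for v
  proof -
    have "z \<bullet> v \<le> 0" using zle[of v] zx that by (cases "v = x") (auto simp: D'_def)
    moreover have "(?w \<bullet> ?w) * (z \<bullet> v) = (?w \<bullet> z) * (?w \<bullet> v)"
      using arg_cong[OF par, of "\<lambda>a. a \<bullet> v"] by simp
    moreover have "?w \<bullet> ?w > 0" using wne by simp
    ultimately have "(?w \<bullet> z) * (?w \<bullet> v) \<le> 0" by (metis mult_nonneg_nonpos less_imp_le)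
    then show ?thesis using wz by (simp add: mult_le_0_iff)
  qed
  then show ?thesis using yr assms yx by (auto simp: follows_def)
qed

text \<open>
A generic functional, divided by \<open>h\<close>, has a unique maximum on \<open>D\<close>, and the maximum is attained at an
extreme ray.
\<close>

lemma rays_nonempty: "rays \<noteq> {}"
proof -
  let ?Z = "(\<lambda>(x, y). (h \<bullet> y) *\<^sub>R x - (h \<bullet> x) *\<^sub>R y) ` {(x, y) \<in> D \<times> D. x \<noteq> y}"
  have "finite ?Z"
    by (rule finite_imageI, rule finite_subset[of _ "D \<times> D"]) (use finite_D in auto)
  moreover have "0 \<notin> ?Z"
  proof
    assume "0 \<in> ?Z"
    then obtain x y where xy: "x \<in> D" "y \<in> D" "x \<noteq> y" "(h \<bullet> y) *\<^sub>R x = (h \<bullet> x) *\<^sub>R y" by auto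
    then have "(h \<bullet> y) *\<^sub>R cross3 x y = 0"
      by (metis cross_mult_left cross_refl scaleR_zero_right)
    then show False using not_parallel[OF xy(1-3)] h_neg[OF xy(2)] by simp
  qed
  ultimately have "\<exists>v. \<forall>z\<in>?Z. v \<bullet> z \<noteq> 0" by (rule generic_vector_exists)
  then obtain v where v: "\<forall>z\<in>?Z. v \<bullet> z \<noteq> 0" ..
  define f where "f = (\<lambda>y. (v \<bullet> y) / (- (h \<bullet> y)))"
  have Dne: "D \<noteq> {}"
  proof
    assume "D = {}"
    then have "axis 1 1 = (0 :: real^3)" by (intro spanning) auto
    then show False by (simp add: axis_eq_0_iff)
  qed
  have "Max (f ` D) \<in> f ` D" using finite_D Dne by (intro Max_in) auto
  then obtain x where x: "x \<in> D" "f x = Max (f ` D)" by auto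
  have le: "f y \<le> f x" if "y \<in> D" for y using that x finite_D by simp
  have less: "f y < f x" if "y \<in> D" "y \<noteq> x" for y
  proof -
    have "f y \<noteq> f x"
    proof
      assume eq: "f y = f x"
      have "v \<bullet> y = f y * (- (h \<bullet> y))" "v \<bullet> x = f x * (- (h \<bullet> x))"
        using h_neg[OF that(1)] h_neg[OF x(1)] by (simp_all add: f_def)
      then have "v \<bullet> ((h \<bullet> y) *\<^sub>R x - (h \<bullet> x) *\<^sub>R y) = 0"
        using eq by (simp add: inner_diff_right)
      moreover have "(h \<bullet> y) *\<^sub>R x - (h \<bullet> x) *\<^sub>R y \<in> ?Z" using x that by (auto intro!: image_eqI[of _ _ "(x, y)"])
      ultimately show False using v[rule_format] by (simp del: inner_diff_right)
    qed
    then show ?thesis using le[OF that(1)] by simp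
  qed
  define u where "u = v + f x *\<^sub>R h"
  have uy: "u \<bullet> y = (- (h \<bullet> y)) * (f y - f x)" if "y \<in> D" for y
    using h_neg[OF that] by (simp add: u_def inner_add_left right_diff_distrib') (simp add: f_def)
  have "u \<bullet> x = 0" using uy[OF x(1)] by simp
  moreover have "u \<bullet> y < 0" if "y \<in> D - {x}" for y
    using uy[of y] less[of y] that h_neg[of y] by (simp add: mult_neg_neg)
  ultimately show ?thesis using x by (auto simp: rays_def)
qed

text \<open>
Among three coplanar rays in a halfspace, one is a nonnegative combination of the other two, so it is
not extreme.
\<close>

lemma rays_not_coplanar:
  assumes "a \<in> rays" "b \<in> rays" "c \<in> rays" "a \<noteq> b" "b \<noteq> c" "a \<noteq> c"
  shows "cross3 a b \<bullet> c \<noteq> 0"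
proof
  assume "cross3 a b \<bullet> c = 0"
  then have dep: "(cross3 a b \<bullet> cross3 a b) *\<^sub>R c = (cross3 c b \<bullet> cross3 a b) *\<^sub>R a + (cross3 a c \<bullet> cross3 a b) *\<^sub>R b"
    by (rule in_plane_of_two)
  define q s t where "q = cross3 a b \<bullet> cross3 a b" and "s = cross3 c b \<bullet> cross3 a b" and "t = cross3 a c \<bullet> cross3 a b"
  have D: "a \<in> D" "b \<in> D" "c \<in> D" using assms by (auto simp: rays_def)
  have q: "q > 0" using not_parallel[OF D(1,2)] assms by (simp add: q_def)
  have dot: "q * (v \<bullet> c) = s * (v \<bullet> a) + t * (v \<bullet> b)" for v
    using arg_cong[OF dep, of "\<lambda>x. v \<bullet> x"] by (simp add: q_def s_def t_def inner_add_right)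
  obtain ua where ua: "ua \<bullet> a = 0" "ua \<bullet> b < 0" "ua \<bullet> c < 0"
    using assms D by (auto simp: rays_def)
  obtain ub where ub: "ub \<bullet> b = 0" "ub \<bullet> a < 0" "ub \<bullet> c < 0"
    using assms D by (auto simp: rays_def)
  obtain uc where uc: "uc \<bullet> c = 0" "uc \<bullet> a < 0" "uc \<bullet> b < 0"
    using assms D by (auto simp: rays_def)
  have hn: "h \<bullet> a < 0" "h \<bullet> b < 0" "h \<bullet> c < 0" using D h_neg by auto
  have "t > 0" using dot[of ua] ua q mult_pos_neg[OF q ua(3)] by (auto simp: zero_less_mult_iff mult_less_0_iff)
  moreover have "s > 0" using dot[of ub] ub q mult_pos_neg[OF q ub(3)] by (auto simp: zero_less_mult_iff mult_less_0_iff)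
  ultimately have "s * (uc \<bullet> a) + t * (uc \<bullet> b) < 0" using uc by (simp add: add_neg_neg mult_pos_neg)
  then show False using dot[of uc] uc by simp
qed

lemma not_follows_both_ways:
  assumes "follows x y" shows "\<not> follows y x"
proof
  assume "follows y x"
  have "cross3 x y \<bullet> w = 0" if "w \<in> D" for w
  proof -
    have "cross3 x y \<bullet> w \<le> 0" "cross3 y x \<bullet> w \<le> 0"
      using assms \<open>follows y x\<close> that by (auto simp: follows_def)
    then show ?thesis using cross3_dot_swap(1)[of x y w] by simp
  qed
  then have "cross3 x y = 0" using spanning by blast
  then show False using assms not_parallel by (auto simp: follows_def rays_def)
qed

lemma predecessor_unique:
  assumes "follows a y" "follows b y"
  shows "a = b"
proof (rule ccontr)
  assume ne: "a \<noteq> b"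
  have r: "a \<in> rays" "b \<in> rays" "y \<in> rays" "a \<noteq> y" "b \<noteq> y" using assms by (auto simp: follows_def)
  then have "a \<in> D" "b \<in> D" by (auto simp: rays_def)
  then have "cross3 a y \<bullet> b \<le> 0" "cross3 b y \<bullet> a \<le> 0" using assms by (auto simp: follows_def)
  moreover have "cross3 b y \<bullet> a = - (cross3 a y \<bullet> b)" by (simp add: cross3_simps)
  ultimately have "cross3 a y \<bullet> b = 0" by simp
  then show False using rays_not_coplanar[of a y b] r ne by auto
qed

text \<open>
This says that the successor map has a single cycle. The reason is the simplex method: if a
functional that is maximal at a ray \<open>s\<close> is maximized over the set \<open>Y\<close>, which contains the successors and,
being finite, also the predecessors of its elements, then the maximizer is a local, hence a global
maximum, so it is \<open>s\<close>.
\<close>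

lemma follows_connected:
  assumes Y: "Y \<subseteq> rays" "Y \<noteq> {}"
    and succ: "\<And>y. y \<in> Y \<Longrightarrow> follows y (\<sigma> y) \<and> \<sigma> y \<in> Y"
  shows "Y = rays"
proof (rule ccontr)
  assume "Y \<noteq> rays"
  then obtain s where s: "s \<in> rays" "s \<notin> Y" using Y by auto
  then obtain u where sD: "s \<in> D" and us: "u \<bullet> s = 0" and u: "\<And>y. y \<in> D \<Longrightarrow> y \<noteq> s \<Longrightarrow> u \<bullet> y < 0"
    by (auto simp: rays_def)
  have YD: "y \<in> D" if "y \<in> Y" for y using that Y by (auto simp: rays_def)
  have fY: "finite Y" using Y finite_rays finite_subset by blast
  have "inj_on \<sigma> Y" using succ predecessor_unique by (metis inj_onI)
  moreover have "\<sigma> ` Y \<subseteq> Y" using succ by auto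
  ultimately have surj: "\<sigma> ` Y = Y" using fY by (simp add: endo_inj_surj)
  define f where "f = (\<lambda>y. (u \<bullet> y) / (- (h \<bullet> y)))"
  have "Max (f ` Y) \<in> f ` Y" using fY Y by (intro Max_in) auto
  then obtain y where y: "y \<in> Y" "f y = Max (f ` Y)" by auto
  have fmax: "f w \<le> f y" if "w \<in> Y" for w using that fY y by simp
  obtain x where x: "x \<in> Y" "\<sigma> x = y" using surj y(1) by (metis imageE)
  define n where "n = \<sigma> y"
  have n: "n \<in> Y" "follows y n" using succ[OF y(1)] by (auto simp: n_def)
  have xy: "follows x y" using succ[OF x(1)] x by simp
  define k where "k = u + f y *\<^sub>R h"
  have kf: "k \<bullet> w = (- (h \<bullet> w)) * (f w - f y)" if "w \<in> D" for w
    using h_neg[OF that] by (simp add: k_def inner_add_left right_diff_distrib') (simp add: f_def)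
  have kle: "k \<bullet> w \<le> 0" if "w \<in> Y" for w
    using kf[OF YD[OF that]] fmax[OF that] h_neg[OF YD[OF that]] by (simp add: mult_nonpos_nonpos)
  have ky: "k \<bullet> y = 0" using kf[OF YD[OF y(1)]] by simp
  have fs: "f s = 0" using us by (simp add: f_def)
  have fy: "f y < 0" using u[OF YD[OF y(1)]] h_neg[OF YD[OF y(1)]] y(1) s by (auto simp: f_def intro: divide_neg_neg)
  have ks: "k \<bullet> s > 0" using kf[OF sD] fs fy h_neg[OF sD] by (simp add: mult_neg_neg)
  define \<Delta> where "\<Delta> = cross3 x y \<bullet> n"
  have "x \<noteq> n" using n xy not_follows_both_ways by auto
  then have "\<Delta> \<noteq> 0" unfolding \<Delta>_def
    using rays_not_coplanar[of x y n] xy n by (auto simp: follows_def)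
  moreover have "\<Delta> \<le> 0" using xy YD[OF n(1)] by (auto simp: \<Delta>_def follows_def)
  ultimately have D: "\<Delta> < 0" by simp
  have 1: "cross3 y n \<bullet> s \<le> 0" "cross3 x y \<bullet> s \<le> 0" using xy n sD by (auto simp: follows_def)
  \<comment> \<open>Cramer's rule: \<open>s\<close> lies in the tangent cone at \<open>y\<close>, where \<open>k\<close> is nonpositive.\<close>
  have "\<Delta> *\<^sub>R s = (cross3 y n \<bullet> s) *\<^sub>R x + (cross3 n x \<bullet> s) *\<^sub>R y + (cross3 x y \<bullet> s) *\<^sub>R n"
    unfolding \<Delta>_def by (simp add: cross3_simps forall_3)
  from arg_cong[OF this, of "\<lambda>v. k \<bullet> v"]
  have "\<Delta> * (k \<bullet> s) = (cross3 y n \<bullet> s) * (k \<bullet> x) + (cross3 x y \<bullet> s) * (k \<bullet> n)"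
    using ky by (simp add: inner_add_right)
  moreover have "(cross3 y n \<bullet> s) * (k \<bullet> x) \<ge> 0" "(cross3 x y \<bullet> s) * (k \<bullet> n) \<ge> 0"
    using 1 kle[OF x(1)] kle[OF n(1)] by (simp_all add: mult_nonpos_nonpos)
  moreover have "\<Delta> * (k \<bullet> s) < 0" using D ks by (simp add: mult_neg_pos)
  ultimately show False by linarith
qed

end

section \<open>Two point sets in general position\<close>

text \<open>
Here \<open>z\<close> is a red vertex, since three vertices of \<open>P\<close> are maximal in its direction, \<open>w\<close> is a blue vertex,
and \<open>x\<close> is a crossing of the red arc normal to the edge \<open>p p'\<close> with the blue arc normal to \<open>r r'\<close>. The
memberships of \<open>r\<close> at \<open>z\<close> and of \<open>p\<close> at \<open>w\<close> say that no blue arc separates \<open>z\<close> from \<open>x\<close> and no red arc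
separates \<open>x\<close> from \<open>w\<close>. All conditions are closed, which makes the predicate stable under limits.
\<close>

definition short_path :: "(real^3) set \<Rightarrow> (real^3) set \<Rightarrow> bool" where
  "short_path P R \<longleftrightarrow> (\<exists>z x w p p' p'' r r' r''. z \<noteq> 0 \<and> x \<noteq> 0 \<and> w \<noteq> 0 \<and>
     distinct [p, p', p''] \<and> distinct [r, r', r''] \<and>
     {p, p', p''} \<subseteq> maximizers P z \<and> r \<in> maximizers R z \<and>
     {p, p'} \<subseteq> maximizers P x \<and> {r, r'} \<subseteq> maximizers R x \<and>
     p \<in> maximizers P w \<and> {r, r', r''} \<subseteq> maximizers R w)"

lemma short_pathI:
  assumes "z \<noteq> 0" "x \<noteq> 0" "w \<noteq> 0" "distinct [p, p', p'']" "distinct [r, r', r'']"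
    "{p, p', p''} \<subseteq> maximizers P z" "r \<in> maximizers R z"
    "{p, p'} \<subseteq> maximizers P x" "{r, r'} \<subseteq> maximizers R x"
    "p \<in> maximizers P w" "{r, r', r''} \<subseteq> maximizers R w"
  shows "short_path P R"
  unfolding short_path_def
  by (rule exI[of _ z], rule exI[of _ x], rule exI[of _ w], rule exI[of _ p], rule exI[of _ p'], rule exI[of _ p''],
      rule exI[of _ r], rule exI[of _ r'], rule exI[of _ r''], intro conjI; fact)

text \<open>
The regions of the overlay: the red cell of \<open>p\<close> and the blue cell of \<open>r\<close> overlap in an open set.
\<close>

definition vertex_pairs :: "'a::real_inner set \<Rightarrow> 'a set \<Rightarrow> ('a \<times> 'a) set" where
  "vertex_pairs P R = {(p, r). \<exists>u. maximizers P u = {p} \<and> maximizers R u = {r}}"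

lemma vertex_pairs_swap: "vertex_pairs R P = prod.swap ` vertex_pairs P R"
  by (auto simp: vertex_pairs_def image_iff; blast)

text \<open>
The points where a red arc crosses a blue arc, named by the two edges whose normal cones meet there.
\<close>

definition crossings :: "'a::real_inner set \<Rightarrow> 'a set \<Rightarrow> ('a set \<times> 'a set) set" where
  "crossings P R = {(a, b). card a = 2 \<and> card b = 2 \<and> (\<exists>u. maximizers P u = a \<and> maximizers R u = b)}"

definition crossings_at :: "'a::real_inner set \<Rightarrow> 'a set \<Rightarrow> 'a \<Rightarrow> 'a \<Rightarrow> ('a set \<times> 'a set) set" where
  "crossings_at P R p r = {(a, b) \<in> crossings P R. p \<in> a \<and> r \<in> b}"

text \<open>
The blue sides of the region of \<open>p\<close> and \<open>r\<close>, named by the other end of the corresponding edge of \<open>R\<close>.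
With the roles of \<open>P\<close> and \<open>R\<close> exchanged one obtains the red sides.
\<close>

definition neighbours :: "'a::real_inner set \<Rightarrow> 'a set \<Rightarrow> 'a \<Rightarrow> 'a \<Rightarrow> 'a set" where
  "neighbours P R p r = {r'. r' \<noteq> r \<and> (\<exists>u. maximizers P u = {p} \<and> maximizers R u = {r, r'})}"

lemma neighboursD: "r' \<in> neighbours P R p r \<Longrightarrow> r' \<in> R \<and> r' \<noteq> r"
  using maximizers_subset[of R] by (auto simp: neighbours_def)

text \<open>
The middle one of three collinear points is never the only maximizer of a functional.
\<close>

lemma no_three_collinear:
  fixes P :: "(real^3) set"
  assumes fin: "finite P" and ext: "\<And>p. p \<in> P \<Longrightarrow> \<exists>u. maximizers P u = {p}"
    and abc: "a \<in> P" "b \<in> P" "c \<in> P" "distinct [a, b, c]"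
  shows "cross3 (b - a) (c - a) \<noteq> 0"
proof
  assume "cross3 (b - a) (c - a) = 0"
  then have "cross3 (b - a) (cross3 (b - a) (c - a)) = 0" by simp
  then have eq: "((b - a) \<bullet> (b - a)) *\<^sub>R (c - a) = ((b - a) \<bullet> (c - a)) *\<^sub>R (b - a)"
    by (simp add: Lagrange)
  define q k where "q = (b - a) \<bullet> (b - a)" and "k = (b - a) \<bullet> (c - a)"
  have q: "q > 0" using abc(4) by (auto simp: q_def)
  have dot: "q * (v \<bullet> (c - a)) = k * (v \<bullet> (b - a))" for v
    using arg_cong[OF eq, of "\<lambda>x. v \<bullet> x"] by (simp add: q_def k_def)
  obtain ua ub uc where u: "maximizers P ua = {a}" "maximizers P ub = {b}" "maximizers P uc = {c}"
    using ext abc by meson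
  have ua: "ua \<bullet> (b - a) < 0" "ua \<bullet> (c - a) < 0"
    using maximizers_unique_less[OF u(1) _ _ fin, of b] maximizers_unique_less[OF u(1) _ _ fin, of c] abc
    by (auto simp: inner_diff_right)
  have ub: "ub \<bullet> (b - a) > 0" "ub \<bullet> (c - a) < ub \<bullet> (b - a)"
    using maximizers_unique_less[OF u(2) _ _ fin, of a] maximizers_unique_less[OF u(2) _ _ fin, of c] abc
    by (auto simp: inner_diff_right)
  have uc: "uc \<bullet> (c - a) > 0" "uc \<bullet> (b - a) < uc \<bullet> (c - a)"
    using maximizers_unique_less[OF u(3) _ _ fin, of a] maximizers_unique_less[OF u(3) _ _ fin, of b] abc
    by (auto simp: inner_diff_right)
  have k: "k > 0"
    using dot[of ua] mult_pos_neg[OF q ua(2)] ua(1) by (auto simp: mult_less_0_iff)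
  have "k * (ub \<bullet> (b - a)) < q * (ub \<bullet> (b - a))"
    using dot[of ub] mult_strict_left_mono[OF ub(2) q] by simp
  then have "k < q" using ub(1) by simp
  have "uc \<bullet> (b - a) > 0" using dot[of uc] mult_pos_pos[OF q uc(1)] k by (simp add: zero_less_mult_iff)
  then have "k * (uc \<bullet> (b - a)) < q * (uc \<bullet> (b - a))" using \<open>k < q\<close> by simp
  also have "\<dots> < q * (uc \<bullet> (c - a))" using uc(2) q by simp
  finally show False using dot[of uc] by simp
qed

text \<open>
The last three assumptions make the red and the blue map transversal: no vertex of one map lies on an arc
of the other, and arcs of different colours are not parts of the same great circle.
\<close>

locale general_position =
  fixes P R :: "(real^3) set"
  assumes finite_P: "finite P" and finite_R: "finite R"
    and extreme_P: "p \<in> P \<Longrightarrow> \<exists>u. maximizers P u = {p}"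
    and extreme_R: "r \<in> R \<Longrightarrow> \<exists>u. maximizers R u = {r}"
    and full_P: "(\<And>p q. p \<in> P \<Longrightarrow> q \<in> P \<Longrightarrow> v \<bullet> p = v \<bullet> q) \<Longrightarrow> v = 0"
    and full_R: "(\<And>p q. p \<in> R \<Longrightarrow> q \<in> R \<Longrightarrow> v \<bullet> p = v \<bullet> q) \<Longrightarrow> v = 0"
    and transversal_P: "u \<noteq> 0 \<Longrightarrow> {p, p', p''} \<subseteq> maximizers P u \<Longrightarrow> distinct [p, p', p''] \<Longrightarrow>
          r \<in> maximizers R u \<Longrightarrow> r' \<in> maximizers R u \<Longrightarrow> r = r'"
    and transversal_R: "u \<noteq> 0 \<Longrightarrow> {r, r', r''} \<subseteq> maximizers R u \<Longrightarrow> distinct [r, r', r''] \<Longrightarrow>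
          p \<in> maximizers P u \<Longrightarrow> p' \<in> maximizers P u \<Longrightarrow> p = p'"
    and edges_not_parallel: "p \<in> P \<Longrightarrow> p' \<in> P \<Longrightarrow> p \<noteq> p' \<Longrightarrow> r \<in> R \<Longrightarrow> r' \<in> R \<Longrightarrow> r \<noteq> r' \<Longrightarrow>
          cross3 (p' - p) (r' - r) \<noteq> 0"
begin

lemma swap: "general_position R P"
proof
  fix p p' r r' assume "p \<in> R" "p' \<in> R" "p \<noteq> p'" "r \<in> P" "r' \<in> P" "r \<noteq> r'"
  then show "cross3 (p' - p) (r' - r) \<noteq> 0"
    using edges_not_parallel[of r r' p p'] cross_skew[of "p' - p" "r' - r"] by auto
qed (fact finite_P finite_R extreme_P extreme_R full_P full_R transversal_P transversal_R)+

definition directions :: "real^3 \<Rightarrow> real^3 \<Rightarrow> (real^3) set" where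
  "directions p r = (\<lambda>p'. p' - p) ` (P - {p}) \<union> (\<lambda>r'. r' - r) ` (R - {r})"

lemma vertex_pairsD:
  assumes "(p, r) \<in> vertex_pairs P R"
  shows "p \<in> P" "r \<in> R"
  using assms maximizers_subset by (fastforce simp: vertex_pairs_def)+

lemma pointed_cone_directions:
  assumes u: "maximizers P u = {p}" "maximizers R u = {r}"
  shows "pointed_cone (directions p r) u"
proof
  have pr: "p \<in> P" "r \<in> R" using u maximizers_subset by blast+
  show "finite (directions p r)" using finite_P finite_R by (simp add: directions_def)
  show "u \<bullet> x < 0" if "x \<in> directions p r" for x
  proof -
    from that consider a where "x = a - p" "a \<in> P" "a \<noteq> p" | a where "x = a - r" "a \<in> R" "a \<noteq> r"
      by (auto simp: directions_def)
    then show ?thesis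
      using maximizers_unique_less[OF u(1) _ _ finite_P] maximizers_unique_less[OF u(2) _ _ finite_R]
      by cases (simp_all add: inner_diff_right)
  qed
  show "v = 0" if v: "\<And>x. x \<in> directions p r \<Longrightarrow> v \<bullet> x = 0" for v
  proof (rule full_P)
    have *: "v \<bullet> a = v \<bullet> p" if "a \<in> P" for a
      using v[of "a - p"] that by (cases "a = p") (auto simp: directions_def inner_diff_right)
    show "v \<bullet> a = v \<bullet> b" if "a \<in> P" "b \<in> P" for a b using * that by simp
  qed
  show "cross3 x y \<noteq> 0" if x: "x \<in> directions p r" and y: "y \<in> directions p r" and ne: "x \<noteq> y" for x y
  proof -
    have PP: "cross3 (a - p) (b - p) \<noteq> 0" if "a \<in> P - {p}" "b \<in> P - {p}" "a \<noteq> b" for a b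
      using no_three_collinear[OF finite_P extreme_P, of p a b] that pr by auto
    have RR: "cross3 (a - r) (b - r) \<noteq> 0" if "a \<in> R - {r}" "b \<in> R - {r}" "a \<noteq> b" for a b
      using no_three_collinear[OF finite_R extreme_R, of r a b] that pr by auto
    have PR: "cross3 (a - p) (b - r) \<noteq> 0" "cross3 (b - r) (a - p) \<noteq> 0" if "a \<in> P - {p}" "b \<in> R - {r}" for a b
      using edges_not_parallel[of p a r b] that pr cross_skew[of "a - p" "b - r"] by auto
    from x y ne show ?thesis using PP RR PR unfolding directions_def by blast
  qed
qed

text \<open>
Directions that are nonpositive on the cone at the pair \<open>p\<close>, \<open>r\<close> are the directions in the closed region.
\<close>

lemma maximal_if_nonpositive:
  assumes "p \<in> P" "r \<in> R" and z: "\<And>x. x \<in> directions p r \<Longrightarrow> z \<bullet> x \<le> 0"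
  shows "p \<in> maximizers P z" "r \<in> maximizers R z"
    and "p' \<in> P \<Longrightarrow> z \<bullet> (p' - p) = 0 \<Longrightarrow> p' \<in> maximizers P z"
    and "r' \<in> R \<Longrightarrow> z \<bullet> (r' - r) = 0 \<Longrightarrow> r' \<in> maximizers R z"
proof -
  have P: "z \<bullet> q \<le> z \<bullet> p" if "q \<in> P" for q
    using z[of "q - p"] that by (cases "q = p") (auto simp: directions_def inner_diff_right)
  have R: "z \<bullet> q \<le> z \<bullet> r" if "q \<in> R" for q
    using z[of "q - r"] that by (cases "q = r") (auto simp: directions_def inner_diff_right)
  show "p \<in> maximizers P z" "r \<in> maximizers R z"
    "p' \<in> P \<Longrightarrow> z \<bullet> (p' - p) = 0 \<Longrightarrow> p' \<in> maximizers P z"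
    "r' \<in> R \<Longrightarrow> z \<bullet> (r' - r) = 0 \<Longrightarrow> r' \<in> maximizers R z"
    using P R assms(1,2) by (auto simp: maximizers_def inner_diff_right)
qed

lemma crossing_maximizers:
  assumes "u \<noteq> 0" "{p, p'} \<subseteq> maximizers P u" "{r, r'} \<subseteq> maximizers R u" "p \<noteq> p'" "r \<noteq> r'"
  shows "maximizers P u = {p, p'}" "maximizers R u = {r, r'}"
proof -
  show "maximizers P u = {p, p'}"
  proof (intro equalityI subsetI)
    fix q assume "q \<in> maximizers P u"
    then show "q \<in> {p, p'}"
      using transversal_P[of u p p' q r r'] assms by auto
  qed (use assms in auto)
  show "maximizers R u = {r, r'}"
  proof (intro equalityI subsetI)
    fix q assume "q \<in> maximizers R u"
    then show "q \<in> {r, r'}"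
      using transversal_R[of u r r' q p p'] assms by auto
  qed (use assms in auto)
qed

lemma crossingI:
  assumes "u \<noteq> 0" "{p, p'} \<subseteq> maximizers P u" "{r, r'} \<subseteq> maximizers R u" "p \<noteq> p'" "r \<noteq> r'"
  shows "({p, p'}, {r, r'}) \<in> crossings_at P R p r"
  using crossing_maximizers[OF assms] assms(4,5) by (auto simp: crossings_at_def crossings_def)

lemma finite_crossings: "finite (crossings P R)"
proof (rule finite_subset)
  show "crossings P R \<subseteq> Pow P \<times> Pow R" using maximizers_subset by (fastforce simp: crossings_def)
qed (use finite_P finite_R in auto)

lemma finite_crossings_at: "finite (crossings_at P R p r)"
  by (rule finite_subset[OF _ finite_crossings]) (auto simp: crossings_at_def)

text \<open>
By duality, the sides of a region are the extreme rays of its cone of directions. The colours of the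
two kinds of rays cannot clash, because no edge of \<open>P\<close> is parallel to an edge of \<open>R\<close>.
\<close>

lemma rays_directions:
  assumes u: "maximizers P u = {p}" "maximizers R u = {r}"
  shows "pointed_cone.rays (directions p r) =
    (\<lambda>p'. p' - p) ` neighbours R P r p \<union> (\<lambda>r'. r' - r) ` neighbours P R p r" (is "_ = ?red \<union> ?blue")
proof -
  interpret pointed_cone "directions p r" u by (rule pointed_cone_directions[OF u])
  have pr: "p \<in> P" "r \<in> R" using u maximizers_subset by blast+
  have dP: "a - p \<in> directions p r" if "a \<in> P" "a \<noteq> p" for a using that by (auto simp: directions_def)
  have dR: "a - r \<in> directions p r" if "a \<in> R" "a \<noteq> r" for a using that by (auto simp: directions_def)
  have mixed: "a - p \<noteq> b - r" if "a \<in> P" "a \<noteq> p" "b \<in> R" "b \<noteq> r" for a b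
    using edges_not_parallel[of p a r b] that pr by auto
  show ?thesis
  proof (intro equalityI subsetI)
    fix x assume "x \<in> rays"
    then obtain v where x: "x \<in> directions p r" "v \<bullet> x = 0" and neg: "\<And>y. y \<in> directions p r \<Longrightarrow> y \<noteq> x \<Longrightarrow> v \<bullet> y < 0"
      by (auto simp: rays_def)
    from x(1) consider p' where "p' \<in> P" "p' \<noteq> p" "x = p' - p" | r' where "r' \<in> R" "r' \<noteq> r" "x = r' - r"
      by (auto simp: directions_def)
    then show "x \<in> ?red \<union> ?blue"
    proof cases
      case 1
      have P: "v \<bullet> a < v \<bullet> p" if "a \<in> P" "a \<noteq> p" "a \<noteq> p'" for a
        using neg[OF dP[OF that(1,2)]] 1 that by (simp add: inner_diff_right)
      have R: "v \<bullet> a < v \<bullet> r" if "a \<in> R" "a \<noteq> r" for a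
        using neg[OF dR[OF that]] mixed[OF 1(1,2) that] 1 by (simp add: inner_diff_right)
      have eq: "v \<bullet> p' = v \<bullet> p" using x 1 by (simp add: inner_diff_right)
      have "maximizers P v = {p, p'}"
        using P eq pr 1 by (intro maximizers_pair_eqI) auto
      moreover have "maximizers R v = {r}"
        using R pr by (intro maximizers_singleton_eqI) auto
      ultimately have "p' \<in> neighbours R P r p" using 1 by (auto simp: neighbours_def)
      then show ?thesis using 1 by blast
    next
      case 2
      have R: "v \<bullet> a < v \<bullet> r" if "a \<in> R" "a \<noteq> r" "a \<noteq> r'" for a
        using neg[OF dR[OF that(1,2)]] 2 that by (simp add: inner_diff_right)
      have P: "v \<bullet> a < v \<bullet> p" if "a \<in> P" "a \<noteq> p" for a
        using neg[OF dP[OF that]] mixed[OF that 2(1,2)] 2 by (simp add: inner_diff_right)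
      have eq: "v \<bullet> r' = v \<bullet> r" using x 2 by (simp add: inner_diff_right)
      have "maximizers R v = {r, r'}"
        using R eq pr 2 by (intro maximizers_pair_eqI) auto
      moreover have "maximizers P v = {p}"
        using P pr by (intro maximizers_singleton_eqI) auto
      ultimately have "r' \<in> neighbours P R p r" using 2 by (auto simp: neighbours_def)
      then show ?thesis using 2 by blast
    qed
  next
    fix x assume x: "x \<in> ?red \<union> ?blue"
    have strict: "v \<bullet> b < v \<bullet> a" if "a \<in> maximizers S v" "b \<in> S" "b \<notin> maximizers S v" for S and v a b :: "real^3"
      using that by (force simp: maximizers_def)
    from x show "x \<in> rays"
    proof
      assume "x \<in> ?red"
      then obtain p' v where p': "x = p' - p" "p' \<noteq> p" and v: "maximizers R v = {r}" "maximizers P v = {p, p'}"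
        by (auto simp: neighbours_def)
      have "p' \<in> P" using v maximizers_subset by blast
      have "v \<bullet> p' = v \<bullet> p" using v(2) by (intro maximizers_value_eq[of _ P]) auto
      then have "v \<bullet> x = 0" using p' by (simp add: inner_diff_right)
      moreover have "v \<bullet> y < 0" if y: "y \<in> directions p r - {x}" for y
      proof -
        from y consider a where "y = a - p" "a \<in> P" "a \<notin> {p, p'}" | a where "y = a - r" "a \<in> R" "a \<noteq> r"
          using p' by (auto simp: directions_def)
        then show ?thesis
          using strict[of r R v] strict[of p P v] unfolding v by cases (simp_all add: inner_diff_right)
      qed
      ultimately show ?thesis using dP[OF \<open>p' \<in> P\<close> p'(2)] p'(1) by (auto simp: rays_def)
    next
      assume "x \<in> ?blue"
      then obtain r' v where r': "x = r' - r" "r' \<noteq> r" and v: "maximizers R v = {r, r'}" "maximizers P v = {p}"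
        by (auto simp: neighbours_def)
      have "r' \<in> R" using v maximizers_subset by blast
      have "v \<bullet> r' = v \<bullet> r" using v(1) by (intro maximizers_value_eq[of _ R]) auto
      then have "v \<bullet> x = 0" using r' by (simp add: inner_diff_right)
      moreover have "v \<bullet> y < 0" if y: "y \<in> directions p r - {x}" for y
      proof -
        from y consider a where "y = a - p" "a \<in> P" "a \<noteq> p" | a where "y = a - r" "a \<in> R" "a \<notin> {r, r'}"
          using r' by (auto simp: directions_def)
        then show ?thesis
          using strict[of r R v] strict[of p P v] unfolding v by cases (simp_all add: inner_diff_right)
      qed
      ultimately show ?thesis using dR[OF \<open>r' \<in> R\<close> r'(2)] r'(1) by (auto simp: rays_def)
    qed
  qed
qed

end

section \<open>The sides of a region\<close>

text \<open>
A permutation leaves a set as often as it enters it.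
\<close>

lemma card_transitions:
  assumes fin: "finite S" and bij: "bij_betw \<sigma> S S" and A: "A \<subseteq> S"
  shows "card {x \<in> A. \<sigma> x \<notin> A} = card {x \<in> S - A. \<sigma> x \<in> A}"
proof -
  have fA: "finite A" using A fin finite_subset by blast
  have "card {x \<in> A. \<sigma> x \<notin> A} + card {x \<in> A. \<sigma> x \<in> A} = card A"
    using fA by (subst card_Un_disjoint[symmetric]) (auto intro!: arg_cong[of _ _ card])
  moreover have "card {x \<in> S - A. \<sigma> x \<in> A} + card {x \<in> A. \<sigma> x \<in> A} = card {x \<in> S. \<sigma> x \<in> A}"
    using fin fA A by (subst card_Un_disjoint[symmetric]) (auto intro!: arg_cong[of _ _ card])
  moreover have "card {x \<in> S. \<sigma> x \<in> A} = card A"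
  proof (rule bij_betw_same_card[of \<sigma>])
    show "bij_betw \<sigma> {x \<in> S. \<sigma> x \<in> A} A"
      unfolding bij_betw_def
    proof
      show "inj_on \<sigma> {x \<in> S. \<sigma> x \<in> A}"
        by (rule inj_on_subset[OF bij_betw_imp_inj_on[OF bij]]) auto
      have surj: "\<sigma> ` S = S" using bij by (simp add: bij_betw_def)
      have "y \<in> \<sigma> ` {x \<in> S. \<sigma> x \<in> A}" if "y \<in> A" for y
      proof -
        have "y \<in> \<sigma> ` S" unfolding surj using that A by (rule subsetD[rotated])
        then obtain x where "x \<in> S" "y = \<sigma> x" by (rule imageE)
        then show ?thesis using that by simp
      qed
      then show "\<sigma> ` {x \<in> S. \<sigma> x \<in> A} = A" by auto
    qed
  qed
  ultimately show ?thesis by linarith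
qed

context general_position begin

text \<open>
Consecutive rays of the cone span a supporting plane, whose normal is a corner of the region. Two
consecutive red sides meet in a red vertex, a red and a blue one in a crossing, and two blue ones in
a blue vertex.
\<close>

lemma pattern_gives_short_path:
  assumes u: "maximizers P u = {p}" "maximizers R u = {r}"
    and chain: "pointed_cone.follows (directions p r) (p'' - p) (p' - p)"
      "pointed_cone.follows (directions p r) (p' - p) (r' - r)"
      "pointed_cone.follows (directions p r) (r' - r) (r'' - r)"
    and mem: "p' \<in> P" "p'' \<in> P" "r' \<in> R" "r'' \<in> R" "p' \<noteq> p" "p'' \<noteq> p" "r' \<noteq> r" "r'' \<noteq> r"
  shows "short_path P R"
proof -
  interpret pointed_cone "directions p r" u by (rule pointed_cone_directions[OF u])
  have pr: "p \<in> P" "r \<in> R" using u maximizers_subset by blast+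
  define z x w where "z = cross3 (p'' - p) (p' - p)" and "x = cross3 (p' - p) (r' - r)"
    and "w = cross3 (r' - r) (r'' - r)"
  have D: "p' - p \<in> directions p r" "p'' - p \<in> directions p r" "r' - r \<in> directions p r" "r'' - r \<in> directions p r"
    using mem by (auto simp: directions_def)
  have ne: "p'' - p \<noteq> p' - p" "p' - p \<noteq> r' - r" "r' - r \<noteq> r'' - r" using chain by (auto simp: follows_def)
  have nz: "z \<noteq> 0" "x \<noteq> 0" "w \<noteq> 0"
    using not_parallel D ne by (auto simp: z_def x_def w_def)
  have z: "z \<bullet> d \<le> 0" and x: "x \<bullet> d \<le> 0" and w: "w \<bullet> d \<le> 0" if "d \<in> directions p r" for d
    using chain that by (auto simp: follows_def z_def x_def w_def)
  note Z = maximal_if_nonpositive[OF pr z] and X = maximal_if_nonpositive[OF pr x] and W = maximal_if_nonpositive[OF pr w]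
  have "{p, p', p''} \<subseteq> maximizers P z" "r \<in> maximizers R z"
    using Z mem by (auto simp: z_def dot_cross_self)
  moreover have "{p, p'} \<subseteq> maximizers P x" "{r, r'} \<subseteq> maximizers R x"
    using X mem by (auto simp: x_def dot_cross_self)
  moreover have "p \<in> maximizers P w" "{r, r', r''} \<subseteq> maximizers R w"
    using W mem by (auto simp: w_def dot_cross_self)
  moreover have "distinct [p, p', p'']" "distinct [r, r', r'']" using mem ne by auto
  ultimately show ?thesis using nz by (intro short_pathI)
qed

text \<open>
The crossings among the corners of a region are the colour changes in the cyclic order of its sides, and there
are as many changes from red to blue as from blue to red. If both colours occur, there are at least
two changes. If there are exactly two and both colours occur at least twice, then two red sides are
followed by two blue sides, which is a short path.
\<close>

lemma crossings_at_lower_bound: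
  assumes u: "maximizers P u = {p}" "maximizers R u = {r}" and no: "\<not> short_path P R"
  shows "4 \<le> 2 * ((2 - card (neighbours P R p r)) + (2 - card (neighbours R P r p))) + card (crossings_at P R p r)"
proof -
  interpret pointed_cone "directions p r" u by (rule pointed_cone_directions[OF u])
  have pr: "p \<in> P" "r \<in> R" using u maximizers_subset by blast+
  define red blue where "red = (\<lambda>p'. p' - p) ` neighbours R P r p" and "blue = (\<lambda>r'. r' - r) ` neighbours P R p r"
  have rays: "rays = red \<union> blue" unfolding red_def blue_def by (rule rays_directions[OF u])
  have disj: "red \<inter> blue = {}"
  proof -
    have "p' - p \<noteq> r' - r" if "p' \<in> neighbours R P r p" "r' \<in> neighbours P R p r" for p' r'
    proof -
      have "p' \<in> P" "r' \<in> R" "p' \<noteq> p" "r' \<noteq> r"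
        using that by (auto dest: neighboursD)
      then show ?thesis using edges_not_parallel[of p p' r r'] pr by auto
    qed
    then show ?thesis by (auto simp: red_def blue_def)
  qed
  have card_red: "card red = card (neighbours R P r p)" unfolding red_def by (rule card_image) (auto simp: inj_on_def)
  have card_blue: "card blue = card (neighbours P R p r)" unfolding blue_def by (rule card_image) (auto simp: inj_on_def)
  have fin: "finite red" "finite blue" using finite_rays rays by auto
  obtain \<sigma> where \<sigma>: "\<And>x. x \<in> rays \<Longrightarrow> follows x (\<sigma> x)"
    using follower_exists by metis
  have \<sigma>r: "\<sigma> x \<in> rays" if "x \<in> rays" for x using \<sigma>[OF that] by (auto simp: follows_def)
  have inj: "inj_on \<sigma> rays" using \<sigma> predecessor_unique by (metis inj_onI)
  have bij: "bij_betw \<sigma> rays rays"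
    using inj \<sigma>r finite_rays by (auto simp: bij_betw_def endo_inj_surj image_subset_iff)
  have conn: "Y = rays" if "Y \<subseteq> rays" "Y \<noteq> {}" "\<And>y. y \<in> Y \<Longrightarrow> \<sigma> y \<in> Y" for Y
    using that \<sigma> by (intro follows_connected[of Y \<sigma>]) auto
  define rb br where "rb = {x \<in> red. \<sigma> x \<in> blue}" and "br = {x \<in> blue. \<sigma> x \<in> red}"
  have card_eq: "card rb = card br"
  proof -
    have "rb = {x \<in> red. \<sigma> x \<notin> red}" using \<sigma>r rays disj by (auto simp: rb_def)
    moreover have "br = {x \<in> rays - red. \<sigma> x \<in> red}" using rays disj by (auto simp: br_def)
    ultimately show ?thesis using card_transitions[OF finite_rays bij, of red] rays by simp
  qed
  have frb: "finite rb" "finite br" using fin by (auto simp: rb_def br_def)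
  have rbbr: "rb \<inter> br = {}" using disj by (auto simp: rb_def br_def)
  have redP: "p + a \<in> P" "a \<noteq> 0" if "a \<in> red" for a
    using that by (auto simp: red_def dest: neighboursD)
  have blueR: "r + a \<in> R" "a \<noteq> 0" if "a \<in> blue" for a
    using that by (auto simp: blue_def dest: neighboursD)
  \<comment> \<open>The crossing at which the walk leaves the side \<open>x\<close>.\<close>
  define g where "g = (\<lambda>x. if x \<in> red then ({p, p + x}, {r, r + \<sigma> x}) else ({p, p + \<sigma> x}, {r, r + x}))"
  have cross: "({p, p + a}, {r, r + b}) \<in> crossings_at P R p r"
    if ab: "a \<in> red" "b \<in> blue" "follows a b \<or> follows b a" for a b
  proof -
    obtain x y where xy: "follows x y" "{x, y} = {a, b}" using ab(3) by blast
    have D: "a \<in> directions p r" "b \<in> directions p r"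
      using ab rays by (auto simp: rays_def)
    have "a \<noteq> b" using ab disj by auto
    then have "cross3 x y \<noteq> 0" using not_parallel[OF D] xy(2) cross_skew[of x y] by (auto simp: doubleton_eq_iff)
    moreover have 1: "cross3 x y \<bullet> w \<le> 0" if "w \<in> directions p r" for w using xy(1) that by (auto simp: follows_def)
    note M = maximal_if_nonpositive[OF pr 1]
    have "cross3 x y \<bullet> a = 0" "cross3 x y \<bullet> b = 0" using xy(2) by (auto simp: doubleton_eq_iff dot_cross_self)
    then have "p + a \<in> maximizers P (cross3 x y)" "r + b \<in> maximizers R (cross3 x y)"
      using M(3)[of "p + a"] M(4)[of "r + b"] redP[OF ab(1)] blueR[OF ab(2)] by auto
    ultimately show ?thesis using M(1,2) redP[OF ab(1)] blueR[OF ab(2)] by (intro crossingI[of "cross3 x y"]) auto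
  qed
  have g_in: "g x \<in> crossings_at P R p r" if "x \<in> rb \<union> br" for x
  proof (cases "x \<in> red")
    case True
    then have "\<sigma> x \<in> blue" using that disj by (auto simp: rb_def br_def)
    then show ?thesis using True cross[of x "\<sigma> x"] \<sigma>[of x] rays by (auto simp: g_def)
  next
    case False
    then have "x \<in> blue" "\<sigma> x \<in> red" using that by (auto simp: rb_def br_def)
    then show ?thesis using False cross[of "\<sigma> x" x] \<sigma>[of x] rays by (auto simp: g_def)
  qed
  have "inj_on g (rb \<union> br)"
  proof (rule inj_onI)
    fix x y assume x: "x \<in> rb \<union> br" and y: "y \<in> rb \<union> br" and eq: "g x = g y"
    have ry: "x \<in> rays" "y \<in> rays" using x y rays by (auto simp: rb_def br_def)
    consider "x \<in> red" "y \<in> red" | "x \<notin> red" "y \<notin> red" | "x \<in> red" "y \<notin> red" | "x \<notin> red" "y \<in> red" by blast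
    then show "x = y"
    proof cases
      case 1 then show ?thesis using eq by (auto simp: g_def doubleton_eq_iff)
    next
      case 2 then show ?thesis using eq by (auto simp: g_def doubleton_eq_iff)
    next
      case 3
      then have "x = \<sigma> y \<and> \<sigma> x = y" using eq by (auto simp: g_def doubleton_eq_iff)
      then show ?thesis using \<sigma>[OF ry(1)] \<sigma>[OF ry(2)] not_follows_both_ways by auto
    next
      case 4
      then have "x = \<sigma> y \<and> \<sigma> x = y" using eq by (auto simp: g_def doubleton_eq_iff)
      then show ?thesis using \<sigma>[OF ry(1)] \<sigma>[OF ry(2)] not_follows_both_ways by auto
    qed
  qed
  then have "card (rb \<union> br) \<le> card (crossings_at P R p r)"
    using g_in finite_crossings_at by (intro card_inj_on_le[of g]) auto
  then have m: "2 * card rb \<le> card (crossings_at P R p r)"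
    using card_Un_disjoint[OF frb rbbr] card_eq by simp
  show ?thesis
  proof (cases "red = {} \<or> blue = {}")
    case True
    then have "card red = 0 \<or> card blue = 0" by auto
    then show ?thesis using card_red card_blue by auto
  next
    case False
    have "rb \<noteq> {}"
    proof
      assume "rb = {}"
      then have "red = rays" using conn[of red] \<sigma>r rays False by (auto simp: rb_def)
      then show False using rays disj False by auto
    qed
    then have rb1: "card rb \<ge> 1" using frb by (simp add: Suc_leI card_gt_0_iff)
    have pos: "card red \<ge> 1" "card blue \<ge> 1" using False fin by (simp_all add: Suc_leI card_gt_0_iff)
    show ?thesis
    proof (cases "card red = 1 \<or> card blue = 1 \<or> card rb \<ge> 2")
      case True
      then show ?thesis using m rb1 card_red card_blue by auto
    next
      case big: False
      then have "card rb = 1" "card br = 1" using rb1 card_eq by auto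
      then obtain a b where a: "rb = {a}" and b: "br = {b}" by (auto simp: card_1_singleton_iff)
      have two: "\<exists>y\<in>S. y \<noteq> s" if "finite S" "card S \<ge> 1" "card S \<noteq> 1" for S and s :: "real^3"
      proof (rule ccontr)
        assume "\<not> ?thesis"
        then have "S \<subseteq> {s}" by auto
        then have "card S \<le> 1" using card_mono[of "{s}" S] by auto
        then show False using that by simp
      qed
      have ar: "a \<in> red" "\<sigma> a \<in> blue" using a by (auto simp: rb_def)
      define c where "c = \<sigma> a"
      obtain a' where a': "a' \<in> rays" "\<sigma> a' = a"
        using bij ar rays unfolding bij_betw_def by (metis UnI1 imageE)
      \<comment> \<open>Otherwise \<open>a\<close> is the only point at which the red rays are entered and left, and the other
        red rays form a cycle of their own. The same argument applies to \<open>c\<close> below.\<close>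
      have a'red: "a' \<in> red"
      proof (rule ccontr)
        assume "a' \<notin> red"
        have closed: "\<sigma> y \<in> red - {a}" if "y \<in> red - {a}" for y
        proof -
          have "\<sigma> y \<in> red" using that a \<sigma>r[of y] rays by (auto simp: rb_def)
          moreover have "\<sigma> y \<noteq> a"
            using that \<open>a' \<notin> red\<close> a' inj rays by (metis DiffD1 UnI1 inj_onD)
          ultimately show ?thesis by simp
        qed
        have "red - {a} = rays"
        proof (rule conn)
          show "red - {a} \<noteq> {}" using two[of red a] fin pos big by auto
        qed (use closed rays in auto)
        then show False using ar rays by auto
      qed
      have cblue: "c \<in> blue" using ar by (simp add: c_def)
      have dblue: "\<sigma> c \<in> blue"
      proof (rule ccontr)
        assume "\<sigma> c \<notin> blue"
        then have "c \<in> br" using cblue \<sigma>r[of c] rays by (auto simp: br_def)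
        then have cb: "c = b" using b by simp
        have closed: "\<sigma> y \<in> blue - {c}" if "y \<in> blue - {c}" for y
        proof -
          have "\<sigma> y \<in> blue" using that b cb \<sigma>r[of y] rays by (auto simp: br_def)
          moreover have "\<sigma> y \<noteq> c"
            using that ar disj inj rays unfolding c_def by (metis DiffD1 UnI1 UnI2 inj_onD disjoint_iff)
          ultimately show ?thesis by simp
        qed
        have "blue - {c} = rays"
        proof (rule conn)
          show "blue - {c} \<noteq> {}" using two[of blue c] fin pos big by auto
        qed (use closed rays in auto)
        then show False using cblue rays by auto
      qed
      have "short_path P R"
      proof (rule pattern_gives_short_path[OF u, of "p + a'" "p + a" "r + c" "r + \<sigma> c"])
        show "follows (p + a' - p) (p + a - p)" using \<sigma>[OF a'(1)] a' by simp
        show "follows (p + a - p) (r + c - r)" using \<sigma>[of a] ar rays by (simp add: c_def)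
        show "follows (r + c - r) (r + \<sigma> c - r)" using \<sigma>[of c] cblue rays by simp
      qed (use redP[OF ar(1)] redP[OF a'red] blueR[OF cblue] blueR[OF dblue] in auto)
      then show ?thesis using no by simp
    qed
  qed
qed

end

section \<open>Euler's inequality for the overlay\<close>

text \<open>
The combination of \<open>a\<close> and \<open>b\<close> that is orthogonal to the axis \<open>c\<close>, with positive coefficients if \<open>a\<close> points
upwards and \<open>b\<close> downwards along \<open>c\<close>.
\<close>

definition level :: "real^3 \<Rightarrow> real^3 \<Rightarrow> real^3 \<Rightarrow> real^3" where
  "level c a b = (c \<bullet> a) *\<^sub>R b - (c \<bullet> b) *\<^sub>R a"

lemma level_orthogonal: "c \<bullet> level c a b = 0"
  by (simp add: level_def inner_diff_right)

lemma inner_level: "v \<bullet> level c a b = (c \<bullet> a) * (v \<bullet> b) - (c \<bullet> b) * (v \<bullet> a)"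
  by (simp add: level_def inner_diff_right)

text \<open>
For vectors orthogonal to an axis, the cross product is parallel to the axis.
\<close>

lemma horizontal_cross:
  assumes "c \<bullet> x = 0" "c \<bullet> y = 0"
  shows "(c \<bullet> c) *\<^sub>R cross3 x y = (cross3 c x \<bullet> y) *\<^sub>R c"
proof -
  have "cross3 c (cross3 x y) = 0" using assms by (simp add: Lagrange)
  then have "cross3 c (cross3 c (cross3 x y)) = 0" by (simp only: cross_zero_right)
  then have "(c \<bullet> c) *\<^sub>R cross3 x y = (c \<bullet> cross3 x y) *\<^sub>R c"
    unfolding Lagrange[of c c "cross3 x y"] by simp
  then show ?thesis by (simp add: cross3_dot_cyclic)
qed

text \<open>
A supporting plane of the cone of \<open>D\<close> is sought that contains an upward and a downward generator; its
normal \<open>z\<close> is the easternmost corner of the dual region with respect to the axis \<open>c\<close>. The level vectors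
generate the section of the cone with the plane orthogonal to \<open>c\<close>, and this planar cone has an extreme
ray on each of its two sides. The supporting line at one of them extends to a supporting plane of
the whole cone by Fourier-Motzkin elimination.
\<close>

lemma extreme_level_exists:
  assumes fin: "finite D" and neg: "\<And>x. x \<in> D \<Longrightarrow> h \<bullet> x < 0"
    and gen: "\<And>x. x \<in> D \<Longrightarrow> c \<bullet> x \<noteq> 0"
    and ex: "\<exists>x\<in>D. c \<bullet> x > 0" "\<exists>x\<in>D. c \<bullet> x < 0"
  shows "\<exists>a\<in>D. \<exists>b\<in>D. \<exists>s z. c \<bullet> a > 0 \<and> c \<bullet> b < 0 \<and> z = cross3 c (level c a b) + s *\<^sub>R c \<and>
     z \<bullet> a = 0 \<and> z \<bullet> b = 0 \<and> (\<forall>x\<in>D. z \<bullet> x \<le> 0)"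
proof -
  define H where "H = {(a, b). a \<in> D \<and> b \<in> D \<and> c \<bullet> a > 0 \<and> c \<bullet> b < 0}"
  have "H \<subseteq> D \<times> D" by (auto simp: H_def)
  then have fH: "finite H" using fin finite_subset by blast
  have Hne: "H \<noteq> {}" using ex by (auto simp: H_def)
  define g where "g = cross3 c h"
  \<comment> \<open>The level vectors lie in a half-plane bounded by a line orthogonal to \<open>h\<close>. The ratio \<open>f\<close> is
    monotone in their angle.\<close>
  define f where "f = (\<lambda>(a, b). (g \<bullet> level c a b) / (h \<bullet> level c a b))"
  have hlev: "h \<bullet> level c a b < 0" if "(a, b) \<in> H" for a b
  proof -
    have "(c \<bullet> a) * (h \<bullet> b) < 0" "(c \<bullet> b) * (h \<bullet> a) > 0"
      using that neg by (auto simp: H_def mult_pos_neg mult_neg_neg)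
    then show ?thesis by (simp add: inner_level)
  qed
  have "Max (f ` H) \<in> f ` H" using fH Hne by (intro Max_in) auto
  then obtain a b where ab: "(a, b) \<in> H" "f (a, b) = Max (f ` H)" by auto
  have fmax: "f (a', b') \<le> f (a, b)" if "(a', b') \<in> H" for a' b' using that ab fH by simp
  have D: "a \<in> D" "b \<in> D" "c \<bullet> a > 0" "c \<bullet> b < 0" using ab by (auto simp: H_def)
  then have c0: "c \<bullet> c > 0" by auto
  let ?l = "level c a b"
  have g0: "g \<bullet> g > 0"
  proof -
    have "g \<noteq> 0"
    proof
      assume "g = 0"
      then have "cross3 c g = 0" by simp
      then have "(c \<bullet> h) *\<^sub>R c = (c \<bullet> c) *\<^sub>R h" by (simp add: g_def Lagrange)
      from arg_cong[OF this, of "\<lambda>v. v \<bullet> ?l"] have "h \<bullet> ?l = 0"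
        using c0 by (simp add: level_orthogonal)
      then show False using hlev[OF ab(1)] by simp
    qed
    then show ?thesis by simp
  qed
  have turn: "cross3 c ?l \<bullet> level c a' b' \<le> 0" if H': "(a', b') \<in> H" for a' b'
  proof -
    let ?m = "level c a' b'"
    have "(g \<bullet> ?m) / (h \<bullet> ?m) \<le> (g \<bullet> ?l) / (h \<bullet> ?l)" using fmax[OF H'] by (simp add: f_def)
    then have "(g \<bullet> ?m) * (h \<bullet> ?l) \<le> (g \<bullet> ?l) * (h \<bullet> ?m)"
      using hlev[OF H'] hlev[OF ab(1)] by (simp add: divide_simps mult.commute split: if_splits)
    moreover have "(g \<bullet> ?l) * (h \<bullet> ?m) - (g \<bullet> ?m) * (h \<bullet> ?l) = cross3 g h \<bullet> cross3 ?l ?m"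
      by (simp add: cross3_simps)
    ultimately have "0 \<le> (c \<bullet> c) * (cross3 g h \<bullet> cross3 ?l ?m)" using c0 by simp
    also have "\<dots> = cross3 g h \<bullet> ((c \<bullet> c) *\<^sub>R cross3 ?l ?m)" by simp
    also have "\<dots> = (cross3 c ?l \<bullet> ?m) * (cross3 g h \<bullet> c)"
      by (simp add: horizontal_cross[OF level_orthogonal level_orthogonal])
    also have "cross3 g h \<bullet> c = - (g \<bullet> g)" by (simp add: g_def cross3_simps)
    finally show ?thesis using g0 by (simp add: mult_le_0_iff)
  qed
  \<comment> \<open>The supporting line in the level plane is tilted until it contains \<open>a\<close>, and then also \<open>b\<close>.\<close>
  define s where "s = - (cross3 c ?l \<bullet> a) / (c \<bullet> a)"
  define z where "z = cross3 c ?l + s *\<^sub>R c"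
  have za: "z \<bullet> a = 0" using D by (simp add: z_def s_def inner_add_left inner_diff_left)
  have zl: "z \<bullet> level c a' b' = cross3 c ?l \<bullet> level c a' b'" for a' b'
    by (simp add: z_def inner_add_left level_orthogonal)
  have "z \<bullet> ?l = 0" using zl[of a b] by (simp add: dot_cross_self)
  then have zb: "z \<bullet> b = 0" using za D by (simp add: inner_level)
  have "z \<bullet> x \<le> 0" if x: "x \<in> D" for x
  proof (cases "c \<bullet> x > 0")
    case True
    then have "(x, b) \<in> H" using D x by (simp add: H_def)
    then have "z \<bullet> level c x b \<le> 0" using turn zl by simp
    then have "0 \<le> (c \<bullet> b) * (z \<bullet> x)" using zb by (simp add: inner_level)
    then show ?thesis using D by (simp add: zero_le_mult_iff)
  next
    case False
    then have "(a, x) \<in> H" using D x gen[OF x] by (simp add: H_def)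
    then have "z \<bullet> level c a x \<le> 0" using turn zl by simp
    then have "(c \<bullet> a) * (z \<bullet> x) \<le> 0" using za by (simp add: inner_level)
    then show ?thesis using D by (simp add: mult_le_0_iff)
  qed
  then show ?thesis using D za zb z_def by blast
qed

context general_position begin

lemma directions_swap: "general_position.directions R P r p = directions p r"
  using general_position.directions_def[OF swap] by (auto simp: directions_def)

text \<open>
The normal \<open>z\<close> is the easternmost corner of the region of \<open>p\<close> and \<open>r\<close>, where the sides \<open>a\<close> and \<open>b\<close> meet. It lies
to the east because its component orthogonal to the axis \<open>c\<close> is the quarter turn of the level vector.
\<close>

definition turning :: "real^3 \<Rightarrow> real^3 \<Rightarrow> real^3 \<Rightarrow> real^3 \<Rightarrow> real^3 \<Rightarrow> real^3 \<Rightarrow> bool" where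
  "turning c p r a b z \<longleftrightarrow> c \<bullet> a > 0 \<and> c \<bullet> b < 0 \<and> z \<bullet> a = 0 \<and> z \<bullet> b = 0 \<and>
     (\<forall>x\<in>directions p r. z \<bullet> x \<le> 0) \<and> (\<exists>s. z = cross3 c (level c a b) + s *\<^sub>R c)"

text \<open>
If the easternmost corner of a region is a red vertex, then near this corner the region agrees with
the whole red cell of \<open>p\<close>, so it is also the easternmost corner of that cell. A cell has only one
easternmost corner, and the corner lies in the interior of a single blue cell, which determines \<open>r\<close>.
\<close>

lemma turning_at_facet_inj:
  assumes "(p, r) \<in> vertex_pairs P R" "(p, r') \<in> vertex_pairs P R"
    and t: "turning c p r a b z" "p + a \<in> P" "p + b \<in> P"
    and t': "turning c p r' a' b' z'" "p + a' \<in> P" "p + b' \<in> P"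
  shows "r = r'"
proof -
  have pr: "p \<in> P" "r \<in> R" "r' \<in> R" using assms vertex_pairsD by auto
  obtain s s' where z: "z = cross3 c (level c a b) + s *\<^sub>R c" and z': "z' = cross3 c (level c a' b') + s' *\<^sub>R c"
    using t t' by (auto simp: turning_def)
  let ?l = "level c a b" and ?m = "level c a' b'"
  have ab: "c \<bullet> a > 0" "c \<bullet> b < 0" "c \<bullet> a' > 0" "c \<bullet> b' < 0" using t t' by (auto simp: turning_def)
  have dirs: "a \<in> directions p q" "b \<in> directions p q" "a' \<in> directions p q" "b' \<in> directions p q" for q
    using t t' ab by (auto simp: directions_def image_iff intro: bexI[of _ "p + a"] bexI[of _ "p + b"]
        bexI[of _ "p + a'"] bexI[of _ "p + b'"])
  have c0: "c \<bullet> c > 0" using ab by auto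
  have nonpos: "v \<bullet> level c x y \<le> 0" if "v \<bullet> x \<le> 0" "v \<bullet> y \<le> 0" "c \<bullet> x > 0" "c \<bullet> y < 0" for v x y
  proof -
    have "(c \<bullet> x) * (v \<bullet> y) \<le> 0" "(c \<bullet> y) * (v \<bullet> x) \<ge> 0"
      using that by (simp_all add: mult_nonneg_nonpos mult_nonpos_nonpos)
    then show ?thesis by (simp add: inner_level)
  qed
  \<comment> \<open>Each level vector lies on the nonpositive side of the other normal, so the two are parallel.\<close>
  have "z \<bullet> ?m \<le> 0" using nonpos[of z a' b'] t ab dirs by (auto simp: turning_def)
  then have 1: "cross3 c ?l \<bullet> ?m \<le> 0" by (simp add: z inner_add_left level_orthogonal)
  have "z' \<bullet> ?l \<le> 0" using nonpos[of z' a b] t' ab dirs by (auto simp: turning_def)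
  then have "cross3 c ?m \<bullet> ?l \<le> 0" by (simp add: z' inner_add_left level_orthogonal)
  then have 2: "cross3 c ?l \<bullet> ?m = 0" using 1 cross3_dot_swap(2)[of c ?l ?m] by simp
  have "(c \<bullet> c) *\<^sub>R cross3 ?l ?m = 0"
    using horizontal_cross[OF level_orthogonal level_orthogonal, of c a b a' b'] 2 by simp
  then have "cross3 ?l ?m = 0" using c0 by simp
  then have "cross3 ?l (cross3 ?l ?m) = 0" by simp
  then have lm: "(?l \<bullet> ?l) *\<^sub>R ?m = (?l \<bullet> ?m) *\<^sub>R ?l" by (simp add: Lagrange)
  obtain u where "maximizers P u = {p}" "maximizers R u = {r}" using assms by (auto simp: vertex_pairs_def)
  then interpret pointed_cone "directions p r" u by (rule pointed_cone_directions)
  have neg: "u \<bullet> level c x y < 0" if "x \<in> directions p r" "y \<in> directions p r" "c \<bullet> x > 0" "c \<bullet> y < 0" for x y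
  proof -
    have "(c \<bullet> x) * (u \<bullet> y) < 0" "(c \<bullet> y) * (u \<bullet> x) > 0"
      using that h_neg by (simp_all add: mult_pos_neg mult_neg_neg)
    then show ?thesis by (simp add: inner_level)
  qed
  have ul: "u \<bullet> ?l < 0" "u \<bullet> ?m < 0" using neg dirs ab by auto
  define k1 k2 where "k1 = ?l \<bullet> ?l" and "k2 = ?l \<bullet> ?m"
  have k1: "k1 > 0" using ul by (auto simp: k1_def)
  have "k1 * (u \<bullet> ?m) = k2 * (u \<bullet> ?l)" using arg_cong[OF lm, of "\<lambda>v. u \<bullet> v"] by (simp add: k1_def k2_def)
  then have k2: "k2 > 0" using k1 ul mult_pos_neg[OF k1 ul(2)] by (simp add: mult_less_0_iff)
  have "k1 *\<^sub>R cross3 c ?m = k2 *\<^sub>R cross3 c ?l"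
    using lm by (simp add: k1_def k2_def flip: cross_mult_right)
  then have diff: "k1 *\<^sub>R z' = k2 *\<^sub>R z + (k1 * s' - k2 * s) *\<^sub>R c"
    by (simp add: z z' algebra_simps)
  have "k1 * (z' \<bullet> a) = (k1 * s' - k2 * s) * (c \<bullet> a)" "k1 * (z' \<bullet> b) = (k1 * s' - k2 * s) * (c \<bullet> b)"
    using arg_cong[OF diff, of "\<lambda>v. v \<bullet> a"] arg_cong[OF diff, of "\<lambda>v. v \<bullet> b"] t(1)
    by (simp_all add: inner_add_left turning_def)
  moreover have "z' \<bullet> a \<le> 0" "z' \<bullet> b \<le> 0" using t'(1) dirs by (auto simp: turning_def)
  ultimately have "(k1 * s' - k2 * s) * (c \<bullet> a) \<le> 0" "(k1 * s' - k2 * s) * (c \<bullet> b) \<le> 0"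
    using k1 by (metis mult_nonneg_nonpos less_imp_le)+
  then have "k1 * s' - k2 * s = 0" using ab by (auto simp: mult_le_0_iff)
  then have par: "k1 *\<^sub>R z' = k2 *\<^sub>R z" using diff by simp
  have Z: "\<And>x. x \<in> directions p r \<Longrightarrow> z \<bullet> x \<le> 0" and Z': "\<And>x. x \<in> directions p r' \<Longrightarrow> z' \<bullet> x \<le> 0"
    using t t' by (auto simp: turning_def)
  note M = maximal_if_nonpositive[OF pr(1,2) Z] and M' = maximal_if_nonpositive[OF pr(1,3) Z']
  have "r' \<in> maximizers R (k1 *\<^sub>R z')" using M'(2) k1 by (simp add: maximizers_scaleR)
  then have "r' \<in> maximizers R z" using par k2 by (simp add: maximizers_scaleR)
  moreover have "z \<noteq> 0"
  proof
    assume "z = 0"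
    then have "cross3 c ?l + s *\<^sub>R c = 0" using z by simp
    then have "(cross3 c ?l + s *\<^sub>R c) \<bullet> c = 0" by simp
    then have "s = 0" using c0 by (simp add: inner_add_left dot_cross_self)
    then have "cross3 c ?l = 0" using z \<open>z = 0\<close> by simp
    then have "cross3 c (cross3 c ?l) = 0" by simp
    then have "(c \<bullet> c) *\<^sub>R ?l = 0" by (simp add: Lagrange level_orthogonal)
    then show False using c0 ul by simp
  qed
  moreover have "{p, p + a, p + b} \<subseteq> maximizers P z"
    using M(1) M(3)[of "p + a"] M(3)[of "p + b"] t by (auto simp: turning_def)
  moreover have "distinct [p, p + a, p + b]" using ab by auto
  ultimately show ?thesis using transversal_P[of z p "p + a" "p + b" r r'] M(2) by blast
qed

text \<open>
The two vertices of \<open>P\<close> that are extreme in the direction of the axis are not counted, because their cells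
contain the ends of the axis and have no easternmost corner. They account for the summand two.
\<close>

lemma card_turning_at_facet:
  assumes gen: "\<And>p q. p \<in> P \<Longrightarrow> q \<in> P \<Longrightarrow> p \<noteq> q \<Longrightarrow> c \<bullet> p \<noteq> c \<bullet> q"
  shows "card {(p, r) \<in> vertex_pairs P R. \<exists>a b z. turning c p r a b z \<and> p + a \<in> P \<and> p + b \<in> P} + 2 \<le> card P"
    (is "card ?N + 2 \<le> _")
proof -
  have "P \<noteq> {}" using full_P[of "axis 1 1"] by (auto simp: axis_eq_0_iff)
  then obtain t b where tb: "t \<in> maximizers P c" "b \<in> maximizers P (- c)"
    using maximizers_nonempty[OF finite_P] by blast
  have c0: "c \<noteq> 0"
  proof
    assume "c = 0"
    then have "p = q" if "p \<in> P" "q \<in> P" for p q using gen that by auto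
    then show False using full_P[of "axis 1 1"] by (auto simp: axis_eq_0_iff)
  qed
  have ne: "t \<noteq> b"
  proof
    assume "t = b"
    then have "c \<bullet> p = c \<bullet> t" if "p \<in> P" for p
      using that tb by (intro antisym) (auto simp: maximizers_def)
    then have "c \<bullet> p = c \<bullet> q" if "p \<in> P" "q \<in> P" for p q using that by simp
    then show False using full_P[of c] c0 by blast
  qed
  have mem: "t \<in> P" "b \<in> P" using tb maximizers_subset by blast+
  have "inj_on fst ?N"
    using turning_at_facet_inj by (auto simp: inj_on_def)
  moreover have "fst ` ?N \<subseteq> P - {t, b}"
  proof
    fix p assume "p \<in> fst ` ?N"
    then obtain r a b' z where *: "(p, r) \<in> vertex_pairs P R" "turning c p r a b' z" "p + a \<in> P" "p + b' \<in> P" by auto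
    then have "c \<bullet> (p + a) > c \<bullet> p" "c \<bullet> (p + b') < c \<bullet> p" by (auto simp: turning_def inner_add_right)
    then have "p \<noteq> t" "p \<noteq> b" using tb * by (fastforce simp: maximizers_def)+
    then show "p \<in> P - {t, b}" using vertex_pairsD[OF *(1)] by simp
  qed
  ultimately have "card ?N \<le> card (P - {t, b})"
    using finite_P by (intro card_inj_on_le) auto
  moreover have "card (P - {t, b}) + 2 = card P"
    using mem ne finite_P card_mono[of P "{t, b}"] by (subst card_Diff_subset) auto
  ultimately show ?thesis by linarith
qed

text \<open>
The analogue of \<open>turning\<close> for a corner where a red side \<open>a\<close> meets a blue side \<open>b\<close>. The sign \<open>\<tau>\<close> records which
of the two points upwards.
\<close>

definition turns_at_crossing :: "real^3 \<Rightarrow> real^3 \<Rightarrow> real^3 \<Rightarrow> (real^3) set \<Rightarrow> (real^3) set \<Rightarrow> bool" where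
  "turns_at_crossing c p r A B \<longleftrightarrow> (\<exists>a b z s \<tau>. p + a \<in> P \<and> r + b \<in> R \<and> A = {p, p + a} \<and> B = {r, r + b} \<and>
     \<tau> * (c \<bullet> a) > 0 \<and> \<tau> * (c \<bullet> b) < 0 \<and> z \<bullet> a = 0 \<and> z \<bullet> b = 0 \<and>
     (\<forall>x\<in>directions p r. z \<bullet> x \<le> 0) \<and> z = \<tau> *\<^sub>R cross3 c (level c a b) + s *\<^sub>R c)"

lemma turns_at_crossing_normal:
  assumes "p \<in> P" "r \<in> R" "p + a \<in> P" "r + b \<in> R"
    "\<tau> * (c \<bullet> a) > 0" "\<tau> * (c \<bullet> b) < 0" "z \<bullet> a = 0" "z \<bullet> b = 0"
    and Z: "\<And>x. x \<in> directions p r \<Longrightarrow> z \<bullet> x \<le> 0" and z: "z = \<tau> *\<^sub>R cross3 c (level c a b) + s *\<^sub>R c"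
  shows "maximizers P z = {p, p + a}" "maximizers R z = {r, r + b}" "z \<noteq> 0" "cross3 c (level c a b) \<noteq> 0"
proof -
  have ab: "a \<noteq> 0" "b \<noteq> 0" using assms by auto
  have t0: "\<tau> \<noteq> 0" and c0: "c \<bullet> c > 0" using assms by auto
  have l0: "level c a b \<noteq> 0"
  proof
    assume "level c a b = 0"
    then have "(c \<bullet> a) *\<^sub>R b = (c \<bullet> b) *\<^sub>R a" by (simp add: level_def)
    then have "(c \<bullet> a) *\<^sub>R cross3 a b = 0" by (metis cross_mult_right cross_refl scaleR_zero_right)
    then have "cross3 a b = 0" using assms by auto
    then show False using edges_not_parallel[of p "p + a" r "r + b"] assms ab by auto
  qed
  show cl: "cross3 c (level c a b) \<noteq> 0"
  proof
    assume "cross3 c (level c a b) = 0"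
    then have "cross3 c (cross3 c (level c a b)) = 0" by (simp only: cross_zero_right)
    then have "(c \<bullet> c) *\<^sub>R level c a b = 0" by (simp add: Lagrange level_orthogonal)
    then show False using c0 l0 by simp
  qed
  show z0: "z \<noteq> 0"
  proof
    assume "z = 0"
    then have "z \<bullet> c = 0" by simp
    then have "s = 0" using c0 by (simp add: z inner_add_left dot_cross_self)
    then show False using z \<open>z = 0\<close> cl t0 by simp
  qed
  note M = maximal_if_nonpositive[OF assms(1,2) Z]
  have "p + a \<in> maximizers P z" "r + b \<in> maximizers R z" using M(3,4) assms by auto
  then show "maximizers P z = {p, p + a}" "maximizers R z = {r, r + b}"
    using crossing_maximizers[OF z0, of p "p + a" r "r + b"] M(1,2) ab by auto
qed

text \<open>
Four regions meet at a crossing, and they differ in the signs of the two sides. Two of the four combinations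
have both sides pointing up or both down. The remaining two are opposite to each other,
so the crossing is the easternmost corner of one and the westernmost corner of the other.
\<close>

lemma turns_at_crossing_unique:
  assumes mem: "p \<in> P" "r \<in> R" "q \<in> P" "t \<in> R"
    and 1: "turns_at_crossing c p r A B" and 2: "turns_at_crossing c q t A B"
  shows "p = q \<and> r = t"
proof -
  obtain a b z s \<tau> where K: "p + a \<in> P" "r + b \<in> R" "A = {p, p + a}" "B = {r, r + b}"
     "\<tau> * (c \<bullet> a) > 0" "\<tau> * (c \<bullet> b) < 0" "z \<bullet> a = 0" "z \<bullet> b = 0"
     "\<And>x. x \<in> directions p r \<Longrightarrow> z \<bullet> x \<le> 0" "z = \<tau> *\<^sub>R cross3 c (level c a b) + s *\<^sub>R c"
    using 1 unfolding turns_at_crossing_def by blast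
  obtain a' b' z' s' \<tau>' where K': "q + a' \<in> P" "t + b' \<in> R" "A = {q, q + a'}" "B = {t, t + b'}"
     "\<tau>' * (c \<bullet> a') > 0" "\<tau>' * (c \<bullet> b') < 0" "z' \<bullet> a' = 0" "z' \<bullet> b' = 0"
     "\<And>x. x \<in> directions q t \<Longrightarrow> z' \<bullet> x \<le> 0" "z' = \<tau>' *\<^sub>R cross3 c (level c a' b') + s' *\<^sub>R c"
    using 2 unfolding turns_at_crossing_def by blast
  note N = turns_at_crossing_normal[OF mem(1,2) K(1,2,5-10)]
  note N' = turns_at_crossing_normal[OF mem(3,4) K'(1,2,5-10)]
  have P: "(q = p \<and> a' = a) \<or> (q = p + a \<and> a' = - a)"
    using K(3) K'(3) by (auto simp: doubleton_eq_iff add.assoc minus_unique)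
  have R: "(t = r \<and> b' = b) \<or> (t = r + b \<and> b' = - b)"
    using K(4) K'(4) by (auto simp: doubleton_eq_iff add.assoc minus_unique)
  have "False" if "q = p + a" "a' = - a" "t = r + b" "b' = - b"
  proof -
    let ?g = "cross3 c (level c a b)"
    have g0: "?g \<bullet> ?g > 0" using N(4) by simp
    have "level c a' b' = level c a b" using that by (simp add: level_def)
    then have z': "z' = \<tau>' *\<^sub>R ?g + s' *\<^sub>R c" using K' by simp
    have opp: "\<tau> * \<tau>' < 0"
      using K(5) K'(5) that by (auto simp: zero_less_mult_iff mult_less_0_iff)
    let ?w = "cross3 a b"
    have "a \<noteq> 0" "b \<noteq> 0" using K(5,6) by auto
    then have w0: "?w \<bullet> ?w > 0" using edges_not_parallel[of p "p + a" r "r + b"] mem K by auto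
    have "z' \<bullet> a = 0" "z' \<bullet> b = 0" using K' that by auto
    then have zw: "(?w \<bullet> ?w) *\<^sub>R z = (?w \<bullet> z) *\<^sub>R ?w" "(?w \<bullet> ?w) *\<^sub>R z' = (?w \<bullet> z') *\<^sub>R ?w"
      using orthogonal_to_both[of a z b] orthogonal_to_both[of a z' b] K by (simp_all add: inner_commute)
    have gz: "z \<bullet> ?g = \<tau> * (?g \<bullet> ?g)" "z' \<bullet> ?g = \<tau>' * (?g \<bullet> ?g)"
      using K(10) z' by (simp_all add: inner_add_left dot_cross_self)
    define m m' where "m = ?w \<bullet> z" and "m' = ?w \<bullet> z'"
    have "(?w \<bullet> ?w) * (\<tau> * (?g \<bullet> ?g)) = m * (?w \<bullet> ?g)" "(?w \<bullet> ?w) * (\<tau>' * (?g \<bullet> ?g)) = m' * (?w \<bullet> ?g)"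
      using arg_cong[OF zw(1), of "\<lambda>v. v \<bullet> ?g"] arg_cong[OF zw(2), of "\<lambda>v. v \<bullet> ?g"] gz by (simp_all add: m_def m'_def)
    then have "((?w \<bullet> ?w) * (\<tau> * (?g \<bullet> ?g))) * ((?w \<bullet> ?w) * (\<tau>' * (?g \<bullet> ?g))) = (m * (?w \<bullet> ?g)) * (m' * (?w \<bullet> ?g))"
      by (simp only:)
    then have "(?w \<bullet> ?w)\<^sup>2 * (?g \<bullet> ?g)\<^sup>2 * (\<tau> * \<tau>') = (m * m') * (?w \<bullet> ?g)\<^sup>2"
      by (simp only: power2_eq_square mult_ac)
    moreover have "(?w \<bullet> ?w)\<^sup>2 * (?g \<bullet> ?g)\<^sup>2 * (\<tau> * \<tau>') < 0"
      by (rule mult_pos_neg[OF _ opp]) (use w0 g0 in simp)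
    ultimately have "m * m' < 0" by (metis mult_less_0_iff not_less zero_le_power2)
    have "(?w \<bullet> ?w) *\<^sub>R (m' *\<^sub>R z) = m' *\<^sub>R ((?w \<bullet> ?w) *\<^sub>R z)"
      by (simp only: scaleR_scaleR mult.commute)
    also have "\<dots> = m *\<^sub>R ((?w \<bullet> ?w) *\<^sub>R z')"
      unfolding zw by (simp only: m_def m'_def scaleR_scaleR mult.commute)
    also have "\<dots> = (?w \<bullet> ?w) *\<^sub>R (m *\<^sub>R z')"
      by (simp only: scaleR_scaleR mult.commute)
    finally have par: "m' *\<^sub>R z = m *\<^sub>R z'"
      by (rule scaleR_left_imp_eq[rotated]) (use w0 in simp)
    have pmax: "p \<in> maximizers P z" "p \<in> maximizers P z'" using N(1) N'(1) that by auto
    have "z = 0"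
    proof (rule full_P)
      have le: "z \<bullet> x = z \<bullet> p" if "x \<in> P" for x
      proof -
        have "z \<bullet> x \<le> z \<bullet> p" "z' \<bullet> x \<le> z' \<bullet> p" using pmax that by (auto simp: maximizers_def)
        moreover have eq: "m' * (z \<bullet> x - z \<bullet> p) = m * (z' \<bullet> x - z' \<bullet> p)"
          using arg_cong[OF par, of "\<lambda>v. v \<bullet> (x - p)"] by (simp add: inner_diff_right right_diff_distrib)
        moreover from \<open>m * m' < 0\<close> have "(m > 0 \<and> m' < 0) \<or> (m < 0 \<and> m' > 0)"
          by (simp add: mult_less_0_iff)
        ultimately have "m' * (z \<bullet> x - z \<bullet> p) = 0"
          using mult_nonpos_nonpos[of m' "z \<bullet> x - z \<bullet> p"] mult_nonneg_nonpos[of m "z' \<bullet> x - z' \<bullet> p"]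
            mult_nonneg_nonpos[of m' "z \<bullet> x - z \<bullet> p"] mult_nonpos_nonpos[of m "z' \<bullet> x - z' \<bullet> p"]
          by linarith
        then show ?thesis using \<open>m * m' < 0\<close> by auto
      qed
      show "z \<bullet> x = z \<bullet> y" if "x \<in> P" "y \<in> P" for x y using le that by simp
    qed
    then show False using N(3) by simp
  qed
  moreover have "\<not> (q = p + a \<and> a' = - a \<and> t = r \<and> b' = b)"
    using K(5,6) K'(5,6) by (auto simp: zero_less_mult_iff mult_less_0_iff)
  moreover have "\<not> (q = p \<and> a' = a \<and> t = r + b \<and> b' = - b)"
    using K(5,6) K'(5,6) by (auto simp: zero_less_mult_iff mult_less_0_iff)
  ultimately show ?thesis using P R by blast
qed

lemma card_turning_at_crossing:
  "card {(p, r) \<in> vertex_pairs P R. \<exists>A B. turns_at_crossing c p r A B} \<le> card (crossings P R)"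
proof (rule card_le_if_inj_on_rel[where r = "\<lambda>(p, r) (A, B). turns_at_crossing c p r A B"])
  show "finite (crossings P R)" by (rule finite_crossings)
next
  fix x assume "x \<in> {(p, r) \<in> vertex_pairs P R. \<exists>A B. turns_at_crossing c p r A B}"
  then obtain p r A B where x: "x = (p, r)" "(p, r) \<in> vertex_pairs P R" "turns_at_crossing c p r A B" by auto
  obtain a b z s \<tau> where K: "p + a \<in> P" "r + b \<in> R" "A = {p, p + a}" "B = {r, r + b}"
     "\<tau> * (c \<bullet> a) > 0" "\<tau> * (c \<bullet> b) < 0" "z \<bullet> a = 0" "z \<bullet> b = 0"
     "\<And>x. x \<in> directions p r \<Longrightarrow> z \<bullet> x \<le> 0" "z = \<tau> *\<^sub>R cross3 c (level c a b) + s *\<^sub>R c"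
    using x(3) unfolding turns_at_crossing_def by blast
  have "a \<noteq> 0" "b \<noteq> 0" using K by auto
  then have "(A, B) \<in> crossings P R"
    using turns_at_crossing_normal(1,2)[OF vertex_pairsD[OF x(2)] K(1,2,5-10)] K(3,4)
    by (auto simp: crossings_def)
  then show "\<exists>y. y \<in> crossings P R \<and> (\<lambda>(p, r) (A, B). turns_at_crossing c p r A B) x y"
    using x by auto
next
  fix x y ab
  assume "x \<in> {(p, r) \<in> vertex_pairs P R. \<exists>A B. turns_at_crossing c p r A B}"
    "y \<in> {(p, r) \<in> vertex_pairs P R. \<exists>A B. turns_at_crossing c p r A B}"
    "(\<lambda>(p, r) (A, B). turns_at_crossing c p r A B) x ab" "(\<lambda>(p, r) (A, B). turns_at_crossing c p r A B) y ab"
  then show "x = y"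
    by (cases x; cases y; cases ab) (use turns_at_crossing_unique vertex_pairsD in blast)
qed

lemma finite_vertex_pairs: "finite (vertex_pairs P R)"
  by (rule finite_subset[of _ "P \<times> R"]) (use vertex_pairsD finite_P finite_R in auto)

text \<open>
Apart from the two regions that contain the ends of the axis, every region has an easternmost corner,
which is a red vertex, a blue vertex or a crossing. The preceding counts bound the number of
regions of each kind.
\<close>

lemma euler_bound:
  "card (vertex_pairs P R) + 2 \<le> card (crossings P R) + card P + card R"
proof -
  interpret sw: general_position R P by (rule swap)
  let ?Z = "(\<lambda>(p, q). p - q) ` (P \<times> P) \<union> (\<lambda>(p, q). p - q) ` (R \<times> R) - {0}"
  obtain c where c: "\<And>z. z \<in> ?Z \<Longrightarrow> c \<bullet> z \<noteq> 0"
    using generic_vector_exists[of ?Z] finite_P finite_R by auto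
  have genP: "c \<bullet> p \<noteq> c \<bullet> q" if "p \<in> P" "q \<in> P" "p \<noteq> q" for p q
    using c[of "p - q"] that by (auto simp: inner_diff_right)
  have genR: "c \<bullet> p \<noteq> c \<bullet> q" if "p \<in> R" "q \<in> R" "p \<noteq> q" for p q
    using c[of "p - q"] that by (auto simp: inner_diff_right)
  define NP where "NP = {(p, r) \<in> vertex_pairs P R. \<exists>a b z. turning c p r a b z \<and> p + a \<in> P \<and> p + b \<in> P}"
  define NR where "NR = {(r, p) \<in> vertex_pairs R P. \<exists>a b z. sw.turning c r p a b z \<and> r + a \<in> R \<and> r + b \<in> R}"
  define NX where "NX = {(p, r) \<in> vertex_pairs P R. \<exists>A B. turns_at_crossing c p r A B}"
  \<comment> \<open>The regions that contain one of the two ends of the axis.\<close>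
  define poles where "poles = {(p, r) \<in> vertex_pairs P R. (\<forall>x\<in>directions p r. c \<bullet> x > 0) \<or> (\<forall>x\<in>directions p r. c \<bullet> x < 0)}"
  have fin: "finite NP" "finite NX" "finite NR" "finite poles"
    using finite_vertex_pairs sw.finite_vertex_pairs
    by (auto simp: NP_def NX_def NR_def poles_def intro: finite_subset[rotated])
  have "vertex_pairs P R \<subseteq> poles \<union> NX \<union> NP \<union> prod.swap ` NR"
  proof
    fix x assume "x \<in> vertex_pairs P R"
    then obtain p r u where x: "x = (p, r)" "(p, r) \<in> vertex_pairs P R" and u: "maximizers P u = {p}" "maximizers R u = {r}"
      by (auto simp: vertex_pairs_def)
    note pr = vertex_pairsD[OF x(2)]
    interpret pointed_cone "directions p r" u by (rule pointed_cone_directions[OF u])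
    have gen: "c \<bullet> d \<noteq> 0" if "d \<in> directions p r" for d
    proof -
      from that consider q where "d = q - p" "q \<in> P" "q \<noteq> p" | q where "d = q - r" "q \<in> R" "q \<noteq> r"
        by (auto simp: directions_def)
      then show ?thesis
        using genP[OF _ pr(1)] genR[OF _ pr(2)] by cases (simp_all add: inner_diff_right)
    qed
    show "x \<in> poles \<union> NX \<union> NP \<union> prod.swap ` NR"
    proof (cases "x \<in> poles")
      case False
      then have "\<exists>x\<in>directions p r. c \<bullet> x > 0" "\<exists>x\<in>directions p r. c \<bullet> x < 0"
        using gen x by (auto simp: poles_def) (meson not_less_iff_gr_or_eq)+
      from extreme_level_exists[OF finite_D h_neg gen this]
      obtain a b s z where ab: "a \<in> directions p r" "b \<in> directions p r" "c \<bullet> a > 0" "c \<bullet> b < 0"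
         and z: "z = cross3 c (level c a b) + s *\<^sub>R c" "z \<bullet> a = 0" "z \<bullet> b = 0" "\<And>x. x \<in> directions p r \<Longrightarrow> z \<bullet> x \<le> 0"
        by blast
      have cases: "p + d \<in> P \<or> r + d \<in> R" if "d \<in> directions p r" for d using that by (auto simp: directions_def)
      consider "p + a \<in> P" "p + b \<in> P" | "r + a \<in> R" "r + b \<in> R" | "p + a \<in> P" "r + b \<in> R" | "r + a \<in> R" "p + b \<in> P"
        using cases[OF ab(1)] cases[OF ab(2)] by blast
      then show ?thesis
      proof cases
        case 1
        have "turning c p r a b z" using ab z by (auto simp: turning_def)
        then have "x \<in> NP" using 1 x by (auto simp: NP_def)
        then show ?thesis by blast
      next
        case 2
        have "sw.turning c r p a b z" using ab z by (auto simp: sw.turning_def directions_swap)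
        then have "(r, p) \<in> NR" using 2 x by (auto simp: NR_def vertex_pairs_swap[of R P])
        then have "prod.swap (r, p) \<in> prod.swap ` NR" by (rule imageI)
        then show ?thesis using x by simp
      next
        case 3
        have "turns_at_crossing c p r {p, p + a} {r, r + b}"
          unfolding turns_at_crossing_def
          using 3 ab z by (intro exI[of _ a] exI[of _ b] exI[of _ z] exI[of _ s] exI[of _ 1]) auto
        then have "x \<in> NX" using x by (auto simp: NX_def)
        then show ?thesis by blast
      next
        case 4
        have "level c a b = - level c b a" by (simp add: level_def)
        then have "z = (- 1) *\<^sub>R cross3 c (level c b a) + s *\<^sub>R c" using z by simp
        then have "turns_at_crossing c p r {p, p + b} {r, r + a}"
          unfolding turns_at_crossing_def
          using 4 ab z by (intro exI[of _ b] exI[of _ a] exI[of _ z] exI[of _ s] exI[of _ "- 1"]) auto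
        then have "x \<in> NX" using x by (auto simp: NX_def)
        then show ?thesis by blast
      qed
    qed blast
  qed
  then have "card (vertex_pairs P R) \<le> card (poles \<union> NX \<union> NP \<union> prod.swap ` NR)"
    using fin by (intro card_mono) auto
  also have "\<dots> \<le> card poles + card NX + card NP + card NR"
    using card_Un_le[of "poles \<union> NX \<union> NP" "prod.swap ` NR"] card_Un_le[of "poles \<union> NX" NP] card_Un_le[of poles NX]
      card_image_le[OF fin(3), of prod.swap] by linarith
  finally have total: "card (vertex_pairs P R) \<le> card poles + card NX + card NP + card NR" .
  have "card poles \<le> 2"
  proof -
    have top: "maximizers P v = {p} \<and> maximizers R v = {r}"
      if "(p, r) \<in> vertex_pairs P R" "\<forall>x\<in>directions p r. v \<bullet> x < 0" for p r v
    proof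
      note pr = vertex_pairsD[OF that(1)]
      have "v \<bullet> q < v \<bullet> p" if "q \<in> P" "q \<noteq> p" for q
        using that \<open>\<forall>x\<in>directions p r. v \<bullet> x < 0\<close>[rule_format, of "q - p"]
        by (auto simp: directions_def inner_diff_right)
      then show "maximizers P v = {p}" using pr by (intro maximizers_singleton_eqI) auto
      have "v \<bullet> q < v \<bullet> r" if "q \<in> R" "q \<noteq> r" for q
        using that \<open>\<forall>x\<in>directions p r. v \<bullet> x < 0\<close>[rule_format, of "q - r"]
        by (auto simp: directions_def inner_diff_right)
      then show "maximizers R v = {r}" using pr by (intro maximizers_singleton_eqI) auto
    qed
    have "poles \<subseteq> {(the_elem (maximizers P c), the_elem (maximizers R c)), (the_elem (maximizers P (- c)), the_elem (maximizers R (- c)))}"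
      using top[of _ _ c] top[of _ _ "- c"] by (fastforce simp: poles_def)
    then have "card poles \<le> card {(the_elem (maximizers P c), the_elem (maximizers R c)), (the_elem (maximizers P (- c)), the_elem (maximizers R (- c)))}"
      by (intro card_mono) auto
    also have "\<dots> \<le> 2" by (simp add: card_insert_if)
    finally show ?thesis .
  qed
  moreover have "card NP + 2 \<le> card P" unfolding NP_def using genP by (rule card_turning_at_facet)
  moreover have "card NR + 2 \<le> card R" unfolding NR_def using genR by (rule sw.card_turning_at_facet)
  moreover have "card NX \<le> card (crossings P R)" unfolding NX_def by (rule card_turning_at_crossing)
  ultimately show ?thesis using total by linarith
qed

end

section \<open>Regions and crossings along an edge\<close>

text \<open>
On the line \<open>t \<mapsto> u + t *\<^sub>R e\<close> the values at the points of \<open>S\<close> are affine functions of \<open>t\<close>, and their maximum is a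
convex function. The point \<open>p\<close> is maximal until the first time at which a function of larger
slope catches up.
\<close>

lemma envelope_change:
  fixes p u e :: "'a::real_inner"
  assumes fin: "finite S" and u: "\<And>q. q \<in> S \<Longrightarrow> q \<noteq> p \<Longrightarrow> (q - p) \<bullet> u < 0"
    and p': "p' \<in> S" "(p' - p) \<bullet> (u + T *\<^sub>R e) > 0" and T: "T > 0"
  shows "\<exists>t q. 0 < t \<and> t < T \<and> q \<in> S \<and> (q - p) \<bullet> e > 0 \<and> (q - p) \<bullet> (u + t *\<^sub>R e) = 0 \<and>
           (\<forall>s\<in>S. (s - p) \<bullet> (u + t *\<^sub>R e) \<le> 0)"
proof -
  define A where "A = {q \<in> S. (q - p) \<bullet> e > 0}"
  define f where "f = (\<lambda>q. - ((q - p) \<bullet> u) / ((q - p) \<bullet> e))"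
  have pne: "p' \<noteq> p" using p' by auto
  have p'u: "(p' - p) \<bullet> u < 0" using u p' pne by blast
  have p'T: "(p' - p) \<bullet> u + T * ((p' - p) \<bullet> e) > 0" using p' by (simp add: inner_add_right)
  then have "T * ((p' - p) \<bullet> e) > 0" using p'u by linarith
  then have p'e: "(p' - p) \<bullet> e > 0" using T by (simp add: zero_less_mult_iff)
  then have p'A: "p' \<in> A" using p' by (simp add: A_def)
  have fp': "f p' < T" using p'T unfolding f_def pos_divide_less_eq[OF p'e] by linarith
  have fA: "finite A" using fin by (simp add: A_def)
  have "Min (f ` A) \<in> f ` A" using fA p'A by (intro Min_in) auto
  then obtain q where q: "q \<in> A" "f q = Min (f ` A)" by auto
  have min: "f q \<le> f s" if "s \<in> A" for s using q fA that by simp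
  define t where "t = f q"
  have qe: "(q - p) \<bullet> e > 0" "q \<in> S" using q by (auto simp: A_def)
  then have "q \<noteq> p" by auto
  then have "(q - p) \<bullet> u < 0" using u qe by blast
  then have t0: "t > 0" using qe by (simp add: t_def f_def divide_less_0_iff)
  have tT: "t < T" using min[OF p'A] fp' by (simp add: t_def)
  have root: "(s - p) \<bullet> u = - (f s) * ((s - p) \<bullet> e)" if "s \<in> A" for s using that by (simp add: A_def f_def)
  have "(q - p) \<bullet> (u + t *\<^sub>R e) = 0"
    using root[OF q(1)] by (simp add: inner_add_right t_def)
  moreover have "(s - p) \<bullet> (u + t *\<^sub>R e) \<le> 0" if "s \<in> S" for s
  proof (cases "s \<in> A")
    case True
    then have "t * ((s - p) \<bullet> e) \<le> f s * ((s - p) \<bullet> e)"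
      using min[OF True] by (intro mult_right_mono) (auto simp: t_def A_def)
    then show ?thesis using root[OF True] by (simp add: inner_add_right)
  next
    case False
    then have "(s - p) \<bullet> e \<le> 0" using that by (auto simp: A_def)
    then have "t * ((s - p) \<bullet> e) \<le> 0" using t0 by (simp add: mult_nonneg_nonpos)
    moreover have "(s - p) \<bullet> u \<le> 0" using u[OF that] by (cases "s = p") auto
    ultimately show ?thesis by (simp add: inner_add_right)
  qed
  ultimately show ?thesis using t0 tT qe by blast
qed

context general_position begin

definition edges_at :: "real^3 \<Rightarrow> (real^3) set" where
  "edges_at r = {r'. r' \<noteq> r \<and> (\<exists>u. maximizers R u = {r, r'})}"

text \<open>
The red cells that are traversed by the blue arc normal to the edge \<open>r r'\<close>.
\<close>

definition labels :: "real^3 \<Rightarrow> real^3 \<Rightarrow> (real^3) set" where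
  "labels r r' = {p. \<exists>u. maximizers P u = {p} \<and> maximizers R u = {r, r'}}"

definition crossings_on :: "real^3 \<Rightarrow> real^3 \<Rightarrow> (real^3) set set" where
  "crossings_on r r' = {A. card A = 2 \<and> (\<exists>u. maximizers P u = A \<and> maximizers R u = {r, r'})}"

text \<open>
This functional is positive on all nonzero directions in which \<open>r\<close> is maximal. Normalizing it to one
cuts the cone of these directions in a convex polygon and turns the blue arcs at \<open>r\<close> into straight
segments.
\<close>

definition height :: "real^3 \<Rightarrow> real^3" where
  "height r = (\<Sum>t\<in>R. r - t)"

lemma height_pos:
  assumes "r \<in> maximizers R u" "u \<noteq> 0"
  shows "height r \<bullet> u > 0"
proof -
  have nn: "(r - t) \<bullet> u \<ge> 0" if "t \<in> R" for t
    using assms(1) that by (auto simp: maximizers_def inner_diff_left inner_diff_right inner_commute)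
  obtain p q where "p \<in> R" "q \<in> R" "u \<bullet> p \<noteq> u \<bullet> q" using full_R[of u] assms(2) by blast
  then obtain t where "t \<in> R" "u \<bullet> t \<noteq> u \<bullet> r" by metis
  then have "t \<in> R" "(r - t) \<bullet> u > 0" using nn[of t] by (auto simp: inner_diff_left inner_diff_right inner_commute)
  then have "(\<Sum>t\<in>R. (r - t) \<bullet> u) > 0" using finite_R nn by (intro sum_pos2) auto
  then show ?thesis by (simp add: height_def inner_sum_left)
qed

lemma two_points: "\<exists>x\<in>R. \<exists>y\<in>R. x \<noteq> y" "\<exists>x\<in>P. \<exists>y\<in>P. x \<noteq> y"
  using full_R[of "axis 1 1"] full_P[of "axis 1 1"] by (auto simp: axis_eq_0_iff) metis+

text \<open>
All points of \<open>P\<close> are maximal in direction zero, and \<open>P\<close> has more than two points since it lies in no plane.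
\<close>

lemma normal_nonzero:
  assumes "maximizers P u = A" "card A \<le> 2"
  shows "u \<noteq> 0"
proof
  assume "u = 0"
  then have PA: "P = A" using assms by (auto simp: maximizers_def)
  obtain x y where xy: "x \<in> P" "y \<in> P" "x \<noteq> y" using two_points by blast
  have "{x, y} = P" using card_seteq[of P "{x, y}"] finite_P xy assms PA by auto
  obtain v where v: "v \<noteq> 0" "orthogonal v (x - y)"
    using orthogonal_to_vector_exists[of "x - y"] by (auto simp: orthogonal_commute)
  have "v = 0"
    by (rule full_P) (use v \<open>{x, y} = P\<close> in \<open>auto simp: orthogonal_def inner_diff_right\<close>)
  then show False using v by simp
qed

lemma normalised_normal:
  assumes "r \<in> maximizers R u" "u \<noteq> 0"
  obtains u' where "height r \<bullet> u' = 1" "maximizers P u' = maximizers P u" "maximizers R u' = maximizers R u"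
proof
  let ?k = "1 / (height r \<bullet> u)"
  have "?k > 0" using height_pos[OF assms] by simp
  then show "maximizers P (?k *\<^sub>R u) = maximizers P u" "maximizers R (?k *\<^sub>R u) = maximizers R u"
    by (rule maximizers_scaleR)+
  show "height r \<bullet> (?k *\<^sub>R u) = 1" using height_pos[OF assms] by simp
qed

lemma edge_vector_nonzero:
  assumes "maximizers R u = {r, r'}" "r' \<noteq> r" "height r \<bullet> u = 1"
  shows "cross3 (r' - r) (height r) \<noteq> 0"
proof
  assume "cross3 (r' - r) (height r) = 0"
  then have "cross3 (r' - r) (cross3 (r' - r) (height r)) = 0" by simp
  then have "((r' - r) \<bullet> height r) *\<^sub>R (r' - r) = ((r' - r) \<bullet> (r' - r)) *\<^sub>R height r" by (simp add: Lagrange)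
  from arg_cong[OF this, of "\<lambda>v. v \<bullet> u"]
  have "((r' - r) \<bullet> height r) * ((r' - r) \<bullet> u) = (r' - r) \<bullet> (r' - r)" using assms by simp
  moreover have "(r' - r) \<bullet> u = 0"
    using maximizers_value_eq[of r R u r'] assms by (simp add: inner_diff_left inner_diff_right inner_commute)
  ultimately show False using assms by simp
qed

text \<open>
Normalized directions orthogonal to an edge \<open>b\<close> lie on a line with direction \<open>cross3 b h\<close>.
\<close>

lemma edge_line:
  assumes "e = cross3 b h" "e \<noteq> 0" "b \<bullet> u = 0" "b \<bullet> u' = 0" "h \<bullet> u = 1" "h \<bullet> u' = 1"
  shows "\<exists>t. u' = u + t *\<^sub>R e"
proof -
  have "(e \<bullet> e) *\<^sub>R (u' - u) = (e \<bullet> (u' - u)) *\<^sub>R e"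
    unfolding assms(1) using assms by (intro orthogonal_to_both) (auto simp: inner_diff_right)
  then have "(1 / (e \<bullet> e)) *\<^sub>R ((e \<bullet> e) *\<^sub>R (u' - u)) = (1 / (e \<bullet> e)) *\<^sub>R ((e \<bullet> (u' - u)) *\<^sub>R e)" by simp
  then have "u' - u = ((e \<bullet> (u' - u)) / (e \<bullet> e)) *\<^sub>R e" using assms(2) by simp
  then show ?thesis by (metis add.commute diff_add_cancel)
qed

text \<open>
A tie between two points of \<open>P\<close> at a point of the blue arc is broken when one moves along the arc, since
otherwise an edge of \<open>P\<close> would be parallel to the edge of \<open>R\<close>.
\<close>

lemma edge_separates:
  assumes mem: "r \<in> R" "r' \<in> R" "r' \<noteq> r" and e: "e = cross3 (r' - r) (height r)" "e \<noteq> 0"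
    and u: "(r' - r) \<bullet> u = 0" "height r \<bullet> u = 1"
    and pq: "p \<in> P" "q \<in> P" "p \<noteq> q" "u \<bullet> p = u \<bullet> q"
  shows "e \<bullet> p \<noteq> e \<bullet> q"
proof
  assume eq: "e \<bullet> p = e \<bullet> q"
  have ne: "cross3 u e \<noteq> 0"
  proof
    assume "cross3 u e = 0"
    then have "cross3 u (cross3 u e) = 0" by simp
    then have *: "(u \<bullet> e) *\<^sub>R u = (u \<bullet> u) *\<^sub>R e" by (simp add: Lagrange)
    have he: "height r \<bullet> e = 0" by (simp add: e(1) dot_cross_self)
    have "u \<bullet> e = 0" using arg_cong[OF *, of "\<lambda>v. height r \<bullet> v"] he u by simp
    then show False using * e u by auto
  qed
  have "e \<bullet> (r' - r) = 0" by (simp add: e(1) dot_cross_self)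
  then have "cross3 (q - p) (r' - r) = 0"
    using ne u pq eq by (intro orthogonal_to_both_parallel[of u _ e]) (auto simp: inner_diff_left inner_diff_right inner_commute)
  then show False using edges_not_parallel[of p q r r'] mem pq by auto
qed

lemma labelD: "p \<in> labels r r' \<Longrightarrow> p \<in> P"
  using maximizers_subset[of P] by (auto simp: labels_def)

lemma finite_labels: "finite (labels r r')"
  by (rule finite_subset[OF _ finite_P]) (use labelD in blast)

lemma edges_atD: "r' \<in> edges_at r \<Longrightarrow> r' \<in> R \<and> r' \<noteq> r"
  using maximizers_subset[of R] by (auto simp: edges_at_def)

lemma finite_edges_at: "finite (edges_at r)"
  by (rule finite_subset[OF _ finite_R]) (use edges_atD in blast)

text \<open>
Along the blue arc, a crossing is assigned to the red cell that is entered there. This assignment is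
injective by convexity of the cells, and the first cell on the arc is never entered.
\<close>

lemma card_crossings_on_less_labels:
  assumes "r' \<in> edges_at r"
  shows "card (crossings_on r r') < card (labels r r')"
proof -
  obtain u0 where ne: "r' \<noteq> r" and "maximizers R u0 = {r, r'}" using assms by (auto simp: edges_at_def)
  then have mem: "r \<in> R" "r' \<in> R" using maximizers_subset by blast+
  interpret sw: general_position R P by (rule swap)
  have nz: "u \<noteq> 0" if "maximizers R u = {r, r'}" for u
    using sw.normal_nonzero[OF that] ne by simp
  have norm: "\<exists>u'. height r \<bullet> u' = 1 \<and> maximizers P u' = maximizers P u \<and> maximizers R u' = {r, r'}"
    if "maximizers R u = {r, r'}" for u
    using normalised_normal[of r u] that nz[OF that] by (metis insertI1)
  have on_normal: "\<exists>u. maximizers P u = A \<and> maximizers R u = {r, r'} \<and> height r \<bullet> u = 1" if A: "A \<in> crossings_on r r'" for A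
  proof -
    obtain u where "maximizers P u = A" "maximizers R u = {r, r'}" using A by (auto simp: crossings_on_def)
    then show ?thesis using norm[of u] by auto
  qed
  define e where "e = cross3 (r' - r) (height r)"
  obtain u1 where u1: "maximizers R u1 = {r, r'}" "height r \<bullet> u1 = 1" using norm \<open>maximizers R u0 = {r, r'}\<close> by blast
  have e0: "e \<noteq> 0" unfolding e_def using edge_vector_nonzero[OF u1(1) ne u1(2)] .
  have perp: "(r' - r) \<bullet> u = 0" if "maximizers R u = {r, r'}" for u
    using maximizers_value_eq[of r R u r'] that by (simp add: inner_diff_left inner_diff_right inner_commute)
  have er: "e \<bullet> r' = e \<bullet> r"
    using dot_cross_self(3)[of "r' - r" "height r"] dot_cross_self(1)[of "r' - r" "height r"]
    by (simp add: e_def inner_diff_right inner_diff_left inner_diff_right inner_commute)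
  have keep: "maximizers {r, r'} (t *\<^sub>R e) = {r, r'}" for t
    using er by (auto simp: maximizers_def)
  have sep: "e \<bullet> p \<noteq> e \<bullet> q" if "maximizers R u = {r, r'}" "height r \<bullet> u = 1" "p \<in> P" "q \<in> P" "p \<noteq> q" "u \<bullet> p = u \<bullet> q" for u p q
    using edge_separates[OF mem ne e_def e0 perp[OF that(1)] that(2-6)] .
  have move: "\<exists>u'. maximizers P u' = maximizers (maximizers P u) (t *\<^sub>R e) \<and> maximizers R u' = {r, r'}"
    if "maximizers R u = {r, r'}" for u t
    using maximizers_perturb_both[OF finite_P finite_R, of u "t *\<^sub>R e"] that keep by metis
  have ends: "(\<exists>p q. A = {p, q} \<and> p \<in> labels r r' \<and> q \<in> labels r r' \<and> e \<bullet> p < e \<bullet> q)" if "A \<in> crossings_on r r'" for A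
  proof -
    obtain u where u: "maximizers P u = A" "maximizers R u = {r, r'}" "height r \<bullet> u = 1"
      using on_normal[OF \<open>A \<in> crossings_on r r'\<close>] by blast
    have "card A = 2" using \<open>A \<in> crossings_on r r'\<close> by (simp add: crossings_on_def)
    then obtain p q where pq: "A = {p, q}" "p \<noteq> q" by (auto simp: card_2_iff)
    have pqP: "p \<in> P" "q \<in> P" using u(1) pq maximizers_subset[of P u] by auto
    have "u \<bullet> p = u \<bullet> q" using u(1) pq by (intro maximizers_value_eq[of _ P]) auto
    then have "e \<bullet> p \<noteq> e \<bullet> q" using sep u pq pqP by blast
    moreover have *: "q' \<in> labels r r' \<and> p' \<in> labels r r'" if "e \<bullet> p' < e \<bullet> q'" "A = {p', q'}" for p' q'
    proof
      have "maximizers A (1 *\<^sub>R e) = {q'}" "maximizers A ((-1) *\<^sub>R e) = {p'}"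
        using that maximizers_pair[of e p' q'] maximizers_pair[of "- e" q' p'] by (auto simp: insert_commute)
      then show "q' \<in> labels r r'" "p' \<in> labels r r'"
        using move[OF u(2), of 1] move[OF u(2), of "-1"] u(1) by (auto simp: labels_def)
    qed
    ultimately consider "e \<bullet> p < e \<bullet> q" | "e \<bullet> q < e \<bullet> p" by linarith
    then show ?thesis
    proof cases
      case 1 then show ?thesis using *[of p q] pq by blast
    next
      case 2
      have "A = {q, p}" using pq by auto
      then show ?thesis using 2 *[of q p] by blast
    qed
  qed
  have lne: "labels r r' \<noteq> {}"
  proof -
    let ?M = "maximizers (maximizers P u1) (1 *\<^sub>R e)"
    have fin: "finite (maximizers P u1)" using finite_P maximizers_subset finite_subset by blast
    have "P \<noteq> {}" using two_points by auto
    then have "?M \<noteq> {}" using maximizers_nonempty finite_P fin by metis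
    then obtain p where p: "p \<in> ?M" by blast
    have uniq: "q = p" if "q \<in> ?M" for q
    proof (rule ccontr)
      assume "q \<noteq> p"
      have "e \<bullet> q = e \<bullet> p" using maximizers_value_eq[OF that p] by simp
      moreover have "q \<in> maximizers P u1" "p \<in> maximizers P u1" using that p maximizers_subset by blast+
      moreover from this have "u1 \<bullet> q = u1 \<bullet> p" "q \<in> P" "p \<in> P"
        using maximizers_subset by (blast intro: maximizers_value_eq)+
      ultimately show False using sep u1 \<open>q \<noteq> p\<close> by blast
    qed
    have M: "?M = {p}"
      by (rule equalityI) (use p uniq in blast)+
    obtain v where v: "maximizers P v = ?M" "maximizers R v = {r, r'}" using move[OF u1(1), of 1] by blast
    have "maximizers P v = {p}" using v(1) unfolding M .
    then have "p \<in> labels r r'" using v(2) unfolding labels_def by blast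
    then show ?thesis by blast
  qed
  have "\<exists>p0\<in>labels r r'. \<forall>p\<in>labels r r'. e \<bullet> p0 \<le> e \<bullet> p"
  proof -
    have "Min ((\<bullet>) e ` labels r r') \<in> (\<bullet>) e ` labels r r'" using finite_labels lne by (intro Min_in) auto
    then obtain p0 where "p0 \<in> labels r r'" "e \<bullet> p0 = Min ((\<bullet>) e ` labels r r')" by auto
    then show ?thesis using finite_labels by (intro bexI[of _ p0]) auto
  qed
  then obtain p0 where p0: "p0 \<in> labels r r'" "\<And>p. p \<in> labels r r' \<Longrightarrow> e \<bullet> p0 \<le> e \<bullet> p" by blast
  \<comment> \<open>The slope along the arc increases at each crossing, so the cell \<open>p0\<close> of least slope comes first.\<close>
  have "card (crossings_on r r') \<le> card (labels r r' - {p0})"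
  proof (rule card_le_if_inj_on_rel[where r = "\<lambda>A q. q \<in> A \<and> (\<exists>p\<in>A. e \<bullet> p < e \<bullet> q)"])
    show "finite (labels r r' - {p0})" using finite_labels by simp
    show "\<exists>q. q \<in> labels r r' - {p0} \<and> q \<in> A \<and> (\<exists>p\<in>A. e \<bullet> p < e \<bullet> q)" if "A \<in> crossings_on r r'" for A
    proof -
      obtain p q where pq: "A = {p, q}" "p \<in> labels r r'" "q \<in> labels r r'" "e \<bullet> p < e \<bullet> q" using ends \<open>A \<in> crossings_on r r'\<close> by blast
      then have "q \<noteq> p0" using p0(2)[OF pq(2)] by auto
      then show ?thesis using pq by auto
    qed
    fix A B q assume A: "A \<in> crossings_on r r'" and B: "B \<in> crossings_on r r'"
      and qA: "q \<in> A \<and> (\<exists>p\<in>A. e \<bullet> p < e \<bullet> q)" and qB: "q \<in> B \<and> (\<exists>p\<in>B. e \<bullet> p < e \<bullet> q)"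
    obtain u where u: "maximizers P u = A" "maximizers R u = {r, r'}" "height r \<bullet> u = 1"
      using on_normal[OF A] by blast
    obtain v where v: "maximizers P v = B" "maximizers R v = {r, r'}" "height r \<bullet> v = 1"
      using on_normal[OF B] by blast
    obtain t where t: "v = u + t *\<^sub>R e" using edge_line[OF e_def e0 perp[OF u(2)] perp[OF v(2)] u(3) v(3)] by blast
    have later: False if "maximizers P x = X" "maximizers P (x + s *\<^sub>R e) = Y" "q \<in> X" "q \<in> Y" "p \<in> Y" "e \<bullet> p < e \<bullet> q" "s > 0" for x s X Y p
    proof -
      have "(x + s *\<^sub>R e) \<bullet> p = (x + s *\<^sub>R e) \<bullet> q" using that by (intro maximizers_value_eq[of _ P]) auto
      moreover have "p \<in> P" using that maximizers_subset by blast
      then have "x \<bullet> p \<le> x \<bullet> q" using that(1,3) by (auto simp: maximizers_def)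
      moreover have "s * (e \<bullet> p) < s * (e \<bullet> q)" using that by simp
      ultimately show False by (simp add: inner_add_left)
    qed
    show "A = B"
    proof (cases "t = 0")
      case True then show ?thesis using t u v by simp
    next
      case False
      have "u = v + (- t) *\<^sub>R e" using t by simp
      then show ?thesis using later[of u A t B] later[of v B "- t" A] u v t qA qB False by (cases "t > 0") auto
    qed
  qed
  also have "\<dots> < card (labels r r')" using p0 finite_labels by (intro psubset_card_mono) auto
  finally show ?thesis .
qed

text \<open>
The edges at a vertex are the extreme rays of the cone of directions, and a ray has a successor that is
different from it.
\<close>

lemma two_edges_at_vertex: 
  assumes "r \<in> R"
  shows "2 \<le> card (edges_at r)"
proof -
  obtain u where u: "maximizers R u = {r}" using extreme_R assms by blast
  let ?D = "(\<lambda>t. t - r) ` (R - {r})"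
  interpret pointed_cone ?D u
  proof
    show "finite ?D" using finite_R by simp
    show "u \<bullet> x < 0" if x: "x \<in> ?D" for x
    proof -
      obtain t where "x = t - r" "t \<in> R" "t \<noteq> r" using x by auto
      then show ?thesis using maximizers_unique_less[OF u _ _ finite_R] by (simp add: inner_diff_right)
    qed
    show "v = 0" if v: "\<And>x. x \<in> ?D \<Longrightarrow> v \<bullet> x = 0" for v
    proof (rule full_R)
      have *: "v \<bullet> a = v \<bullet> r" if "a \<in> R" for a
        using v[of "a - r"] that by (cases "a = r") (auto simp: inner_diff_right)
      show "v \<bullet> a = v \<bullet> b" if "a \<in> R" "b \<in> R" for a b using * that by simp
    qed
    show "cross3 x y \<noteq> 0" if "x \<in> ?D" "y \<in> ?D" "x \<noteq> y" for x y
      using that no_three_collinear[OF finite_R extreme_R assms] by auto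
  qed
  have sub: "rays \<subseteq> (\<lambda>t. t - r) ` edges_at r"
  proof
    fix x assume "x \<in> rays"
    then obtain v t where t: "x = t - r" "t \<in> R" "t \<noteq> r" "v \<bullet> x = 0" and neg: "\<And>y. y \<in> ?D - {x} \<Longrightarrow> v \<bullet> y < 0"
      by (auto simp: rays_def)
    have "maximizers R v = {r, t}"
      by (rule maximizers_pair_eqI) (use t neg[of "_ - r"] assms in \<open>auto simp: inner_diff_right\<close>)
    then show "x \<in> (\<lambda>t. t - r) ` edges_at r" using t by (auto simp: edges_at_def)
  qed
  obtain x y where "follows x y" using rays_nonempty follower_exists by blast
  then have "{x, y} \<subseteq> (\<lambda>t. t - r) ` edges_at r" "x \<noteq> y" using sub by (auto simp: follows_def)
  moreover note finite_edges_at[of r]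
  ultimately have "2 \<le> card ((\<lambda>t. t - r) ` edges_at r)"
    using card_mono[of "(\<lambda>t. t - r) ` edges_at r" "{x, y}"] by simp
  then show ?thesis using card_image_le[OF finite_edges_at[of r], of "\<lambda>t. t - r"] by linarith
qed

end

section \<open>The sides of the regions in a cell\<close>

context general_position begin

text \<open>
A polygon lies in a plane with normal \<open>h\<close>, on the nonpositive side of \<open>b\<close>, and \<open>e\<close> points east along its
side \<open>b\<close>. At a point of this side the maximum changes from one linear function to another, and \<open>g\<close> is
the difference of the two. If \<open>y\<close> leads east into the piece of the first function and \<open>z\<close> leads west into the piece
of the second, then the two pieces would have to overtake each other inside the polygon. Algebraically, the combination of \<open>d\<close> and \<open>g\<close> that vanishes along the side
is a multiple of \<open>b\<close> there, and \<open>y\<close> and \<open>z\<close> force opposite signs of the multiple.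
\<close>

lemma change_is_extreme:
  assumes e: "e \<noteq> 0" "e = cross3 b h \<or> e = - cross3 b h"
    and d: "d \<bullet> e > 0" and ge: "g \<bullet> e > 0"
    and y: "h \<bullet> y = 0" "b \<bullet> y \<le> 0" "g \<bullet> y \<le> 0" "d \<bullet> y > 0"
    and z: "h \<bullet> z = 0" "b \<bullet> z \<le> 0" "g \<bullet> z \<ge> 0" "d \<bullet> z < 0"
  shows False
proof -
  let ?w = "cross3 b h"
  \<comment> \<open>Orthogonal to \<open>e\<close>, so \<open>k\<close> is a combination of \<open>b\<close> and \<open>h\<close>, and only \<open>b\<close> matters where \<open>h\<close> vanishes.\<close>
  define k where "k = (g \<bullet> e) *\<^sub>R d - (d \<bullet> e) *\<^sub>R g"
  have "k \<bullet> e = 0" by (simp add: k_def inner_diff_left)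
  then have "?w \<bullet> k = 0" using e by (auto simp: inner_commute)
  from in_plane_of_two[OF this]
  have dep: "(?w \<bullet> ?w) *\<^sub>R k = (cross3 k h \<bullet> ?w) *\<^sub>R b + (cross3 b k \<bullet> ?w) *\<^sub>R h" .
  define A where "A = cross3 k h \<bullet> ?w"
  have w: "?w \<bullet> ?w > 0" using e by auto
  have "(?w \<bullet> ?w) * (k \<bullet> y) = A * (b \<bullet> y)" "(?w \<bullet> ?w) * (k \<bullet> z) = A * (b \<bullet> z)"
    using arg_cong[OF dep, of "\<lambda>v. v \<bullet> y"] arg_cong[OF dep, of "\<lambda>v. v \<bullet> z"] y z
    by (simp_all add: inner_add_left A_def)
  moreover have "k \<bullet> y > 0"
  proof -
    have "(g \<bullet> e) * (d \<bullet> y) > 0" "(d \<bullet> e) * (g \<bullet> y) \<le> 0" using d ge y by (simp_all add: mult_nonneg_nonpos)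
    then show ?thesis by (simp add: k_def inner_diff_left)
  qed
  moreover have "k \<bullet> z < 0"
  proof -
    have "(g \<bullet> e) * (d \<bullet> z) < 0" "(d \<bullet> e) * (g \<bullet> z) \<ge> 0" using d ge z by (simp_all add: mult_pos_neg)
    then show ?thesis by (simp add: k_def inner_diff_left)
  qed
  ultimately have "A * (b \<bullet> y) > 0" "A * (b \<bullet> z) < 0"
    using w by (metis mult_pos_pos, metis mult_pos_neg)
  then show False using y(2) z(2) by (auto simp: zero_less_mult_iff mult_less_0_iff)
qed

lemma neighbours_iff_labels: "r' \<in> neighbours P R p r \<longleftrightarrow> r' \<in> edges_at r \<and> p \<in> labels r r'"
  by (auto simp: neighbours_def edges_at_def labels_def)

lemma finite_neighbours: "finite (neighbours P R p r)"
  by (rule finite_subset[OF _ finite_edges_at[of r]]) (auto simp: neighbours_iff_labels)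

lemma normalised_label:
  assumes "r' \<in> neighbours P R p r"
  shows "\<exists>u. height r \<bullet> u = 1 \<and> maximizers P u = {p} \<and> maximizers R u = {r, r'}"
proof -
  obtain u where u: "maximizers P u = {p}" "maximizers R u = {r, r'}"
    using assms by (auto simp: neighbours_def)
  have "u \<noteq> 0" using normal_nonzero[OF u(1)] by simp
  then show ?thesis using normalised_normal[of r u] u by (metis insertI1)
qed

text \<open>
For a subset \<open>S\<close> of \<open>P\<close>, the polygon of the vertex \<open>r\<close> is subdivided into the pieces in which a given
point of \<open>S\<close> is maximal. The piece of a point contains its region in the overlay.
\<close>

definition piece :: "(real^3) set \<Rightarrow> real^3 \<Rightarrow> real^3 \<Rightarrow> (real^3) set" where
  "piece S r p = {y. height r \<bullet> y = 1 \<and> r \<in> maximizers R y \<and> p \<in> maximizers S y}"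

text \<open>
Between two samples \<open>u\<close> and \<open>u'\<close> on a blue arc, the maximizer over \<open>S\<close> changes from \<open>p\<close> to some \<open>q\<close>. At the point
of change, either the piece of \<open>p\<close> reaches its easternmost point or the piece of \<open>q\<close> its westernmost point.
\<close>

lemma label_change:
  assumes SP: "S \<subseteq> P" "p \<in> S" "p' \<in> S" "p' \<noteq> p" and r': "r' \<in> R" "r' \<noteq> r"
    and e: "e \<noteq> 0" "e = cross3 (r' - r) (height r) \<or> e = - cross3 (r' - r) (height r)"
    and d: "d \<bullet> e > 0"
    and u: "height r \<bullet> u = 1" "maximizers P u = {p}" "maximizers R u = {r, r'}"
    and u': "height r \<bullet> u' = 1" "maximizers P u' = {p'}" "maximizers R u' = {r, r'}"
    and less: "d \<bullet> u < d \<bullet> u'"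
  shows "\<exists>x q. height r \<bullet> x = 1 \<and> maximizers R x = {r, r'} \<and> q \<in> S \<and> q \<noteq> p \<and>
     p \<in> maximizers S x \<and> q \<in> maximizers S x \<and> d \<bullet> u < d \<bullet> x \<and> d \<bullet> x < d \<bullet> u' \<and> (\<exists>t>0. x = u + t *\<^sub>R e) \<and>
     ((\<forall>y\<in>piece S r p. d \<bullet> y \<le> d \<bullet> x) \<or> (\<forall>y\<in>piece S r q. d \<bullet> x \<le> d \<bullet> y))"
proof -
  have rR: "r \<in> R" using u maximizers_subset by blast
  have fS: "finite S" using SP finite_P finite_subset by blast
  have perp: "(r' - r) \<bullet> v = 0" if "maximizers R v = {r, r'}" for v
    using maximizers_value_eq[of r R v r'] that by (simp add: inner_diff_flip)
  have he: "height r \<bullet> e = 0" "(r' - r) \<bullet> e = 0" using e(2) by (auto simp: dot_cross_self)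
  have "\<exists>t. u' = u + t *\<^sub>R cross3 (r' - r) (height r)"
    using e by (intro edge_line[OF refl _ perp[OF u(3)] perp[OF u'(3)] u(1) u'(1)]) auto
  then obtain t0 where t0: "u' = u + t0 *\<^sub>R cross3 (r' - r) (height r)" by blast
  obtain T where T: "u' = u + T *\<^sub>R e"
  proof (cases "e = cross3 (r' - r) (height r)")
    case True then show thesis using that[of t0] t0 by simp
  next
    case False
    then have "u' = u + (- t0) *\<^sub>R e" using e t0 by simp
    then show thesis using that by blast
  qed
  have T0: "T > 0" using less d by (simp add: T inner_add_right zero_less_mult_iff)
  have "(q - p) \<bullet> u < 0" if "q \<in> S" "q \<noteq> p" for q
    using maximizers_unique_less[OF u(2) _ that(2) finite_P] that SP by (auto simp: inner_diff_flip)
  moreover have "(p' - p) \<bullet> (u + T *\<^sub>R e) > 0"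
    using maximizers_unique_less[OF u'(2) _ SP(4)[symmetric] finite_P] SP T
    by (auto simp: inner_diff_flip)
  ultimately obtain t q where t: "0 < t" "t < T" and q: "q \<in> S" "(q - p) \<bullet> e > 0" "(q - p) \<bullet> (u + t *\<^sub>R e) = 0"
      and max: "\<forall>s\<in>S. (s - p) \<bullet> (u + t *\<^sub>R e) \<le> 0"
    using envelope_change[OF fS _ SP(3) _ T0, of p u e] by blast
  define x where "x = u + t *\<^sub>R e"
  have hx: "height r \<bullet> x = 1" using u(1) he by (simp add: x_def inner_add_right)
  have qp: "q \<noteq> p" using q by auto
  have val: "(s - p) \<bullet> x \<le> 0" if "s \<in> S" for s using max that by (simp add: x_def)
  have pmax: "p \<in> maximizers S x"
    using val SP by (auto simp: maximizers_def inner_diff_flip)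
  have "x \<bullet> q = x \<bullet> p" using q(3) by (simp add: x_def[symmetric] inner_diff_flip)
  then have qmax: "q \<in> maximizers S x"
    using pmax q(1) by (auto simp: maximizers_def)
  have Rx: "maximizers R x = {r, r'}"
  proof (rule maximizers_pair_eqI)
    have "(r' - r) \<bullet> x = 0" using perp[OF u(3)] he(2) by (simp add: x_def inner_add_right)
    then show "x \<bullet> r' = x \<bullet> r" by (simp add: inner_diff_flip)
    fix s assume s: "s \<in> R" "s \<noteq> r" "s \<noteq> r'"
    have neg: "(s - r) \<bullet> v < 0" if "maximizers R v = {r, r'}" for v
    proof -
      have "s \<notin> maximizers R v" "r \<in> maximizers R v" using that s by auto
      then have "v \<bullet> s < v \<bullet> r" using s(1) by (force simp: maximizers_def)
      then show ?thesis by (simp add: inner_diff_flip)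
    qed
    have 1: "(s - r) \<bullet> u < 0" and 2: "(s - r) \<bullet> u + T * ((s - r) \<bullet> e) < 0"
      using neg[OF u(3)] neg[OF u'(3)] by (simp_all add: T inner_add_right)
    have "(s - r) \<bullet> u + t * ((s - r) \<bullet> e) < 0"
    proof (cases "(s - r) \<bullet> e \<le> 0")
      case True
      then have "t * ((s - r) \<bullet> e) \<le> 0" using t by (simp add: mult_nonneg_nonpos)
      then show ?thesis using 1 by linarith
    next
      case False
      then have "t * ((s - r) \<bullet> e) \<le> T * ((s - r) \<bullet> e)" using t by (intro mult_right_mono) auto
      then show ?thesis using 2 by linarith
    qed
    then have "(s - r) \<bullet> x < 0" by (simp add: x_def inner_add_right)
    then show "x \<bullet> s < x \<bullet> r" by (simp add: inner_diff_flip)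
  qed (use rR r' in auto)
  have "t * (d \<bullet> e) < T * (d \<bullet> e)" "t * (d \<bullet> e) > 0" using t d by simp_all
  then have order: "d \<bullet> u < d \<bullet> x" "d \<bullet> x < d \<bullet> u'" by (simp_all add: x_def T inner_add_right)
  have bx: "(r' - r) \<bullet> x = 0" by (rule perp[OF Rx])
  have "(\<forall>y\<in>piece S r p. d \<bullet> y \<le> d \<bullet> x) \<or> (\<forall>y\<in>piece S r q. d \<bullet> x \<le> d \<bullet> y)"
  proof (rule ccontr)
    assume "\<not> ?thesis"
    then obtain y z where y: "y \<in> piece S r p" "d \<bullet> y > d \<bullet> x" and z: "z \<in> piece S r q" "d \<bullet> z < d \<bullet> x"
      by (auto simp: not_le)
    have R: "(r' - r) \<bullet> (v - x) \<le> 0" if "v \<in> piece S r s" for v s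
    proof -
      have "v \<bullet> r' \<le> v \<bullet> r" using that r' by (auto simp: piece_def maximizers_def)
      then have "(r' - r) \<bullet> v \<le> 0" by (simp add: inner_diff_flip)
      then show ?thesis using bx by (simp add: inner_diff_right)
    qed
    have yp: "(q - p) \<bullet> y \<le> 0" using y(1) q(1) by (auto simp: piece_def maximizers_def inner_diff_flip)
    have zq: "(q - p) \<bullet> z \<ge> 0" using z(1) SP(2) by (auto simp: piece_def maximizers_def inner_diff_flip)
    have qx: "(q - p) \<bullet> x = 0" using q(3) by (simp add: x_def)
    show False
    proof (rule change_is_extreme[OF e d q(2)])
      show "height r \<bullet> (y - x) = 0" "height r \<bullet> (z - x) = 0"
        using y z hx by (auto simp: piece_def inner_diff_right)
      show "(r' - r) \<bullet> (y - x) \<le> 0" "(r' - r) \<bullet> (z - x) \<le> 0" using R y z by blast+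
      show "(q - p) \<bullet> (y - x) \<le> 0" using yp qx
        by (simp add: inner_diff_right[of _ y x])
      show "0 \<le> (q - p) \<bullet> (z - x)" using zq qx
        by (simp add: inner_diff_right[of _ z x])
      show "0 < d \<bullet> (y - x)" "d \<bullet> (z - x) < 0" using y z by (simp_all add: inner_diff_right)
    qed
  qed
  then show ?thesis using hx Rx q(1) qp pmax qmax order t(1) x_def by blast
qed

text \<open>
On each blue arc at \<open>r\<close>, the points of \<open>S\<close> whose regions touch the arc are met one after the other. Each
of them except the last gives a change of the maximizer over \<open>S\<close>, and by \<open>label_change\<close> the change can be
charged to the easternmost point of a piece or to the westernmost point of a piece. No end of a
piece is charged twice, because \<open>d\<close> in the proof separates the points of change. The easternmost piece of all cannot be charged for its eastern
end, nor the westernmost one for its western end. So there are at most \<open>2 * card S - 2\<close> changes.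

The set \<open>S\<close> will consist of the points whose regions have at least two blue sides. Dropping the other regions from the
subdivision keeps the estimate valid and is what makes it strong enough.
\<close>

lemma sum_neighbours_bound:
  assumes SP: "S \<subseteq> P" "S \<noteq> {}" and r: "r \<in> R"
  shows "(\<Sum>p\<in>S. card (neighbours P R p r)) + 2 \<le> 2 * card S + card (edges_at r)"
proof -
  have fS: "finite S" using SP finite_P finite_subset by blast
  define I where "I = (SIGMA p:S. neighbours P R p r)"
  have fI: "finite I" using fS finite_neighbours by (simp add: I_def)
  have cardI: "card I = (\<Sum>p\<in>S. card (neighbours P R p r))"
    using fS finite_neighbours by (simp add: I_def)
  have "\<forall>i\<in>I. \<exists>u. height r \<bullet> u = 1 \<and> maximizers P u = {fst i} \<and> maximizers R u = {r, snd i}"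
    using normalised_label by (auto simp: I_def)
  then obtain u where u: "\<And>i. i \<in> I \<Longrightarrow> height r \<bullet> u i = 1 \<and> maximizers P (u i) = {fst i} \<and> maximizers R (u i) = {r, snd i}"
    by metis
  have u1: "height r \<bullet> u i = 1" and u2: "maximizers P (u i) = {fst i}" and u3: "maximizers R (u i) = {r, snd i}"
    if "i \<in> I" for i using u[OF that] by blast+
  have nb: "snd i \<in> R" "snd i \<noteq> r" "fst i \<in> S" if "i \<in> I" for i
    using that by (auto simp: I_def dest: neighboursD)
  \<comment> \<open>All candidates for points of change. The functional \<open>d\<close>, which measures the position from west
    to east, is chosen to separate them.\<close>
  define tie where "tie = (\<lambda>(r', p, q). let v = cross3 (r' - r) (q - p) in (1 / (height r \<bullet> v)) *\<^sub>R v)"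
  define T where "T = tie ` (R \<times> P \<times> P)"
  have fT: "finite T" using finite_P finite_R by (simp add: T_def)
  have inT: "x \<in> T" if x: "height r \<bullet> x = 1" "maximizers R x = {r, r'}" "r' \<noteq> r" "p \<in> S" "q \<in> S" "q \<noteq> p"
      "p \<in> maximizers S x" "q \<in> maximizers S x" for x r' p q
  proof -
    let ?v = "cross3 (r' - r) (q - p)"
    have r'R: "r' \<in> R" using x(2) maximizers_subset by blast
    have "(r' - r) \<bullet> x = 0"
      using maximizers_value_eq[of r R x r'] x(2) by (simp add: inner_diff_flip)
    moreover have "(q - p) \<bullet> x = 0"
      using maximizers_value_eq[OF x(7,8)] by (simp add: inner_diff_flip)
    ultimately have *: "(?v \<bullet> ?v) *\<^sub>R x = (?v \<bullet> x) *\<^sub>R ?v" by (rule orthogonal_to_both)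
    have "?v \<noteq> 0"
      using edges_not_parallel[of p q r r'] x SP r r'R cross_skew[of "r' - r" "q - p"] by auto
    then have v0: "?v \<bullet> ?v \<noteq> 0" by simp
    have **: "?v \<bullet> ?v = (?v \<bullet> x) * (height r \<bullet> ?v)"
      using arg_cong[OF *, of "\<lambda>w. height r \<bullet> w"] x(1) by simp
    then have h0: "height r \<bullet> ?v \<noteq> 0" using v0 by auto
    have "x = (1 / (?v \<bullet> ?v)) *\<^sub>R ((?v \<bullet> ?v) *\<^sub>R x)" using v0 by simp
    also have "\<dots> = ((?v \<bullet> x) / (?v \<bullet> ?v)) *\<^sub>R ?v" unfolding * by simp
    also have "(?v \<bullet> x) / (?v \<bullet> ?v) = 1 / (height r \<bullet> ?v)"
      using ** v0 h0 by (simp add: field_simps)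
    finally have "x = tie (r', p, q)" by (simp add: tie_def Let_def)
    then show ?thesis using r'R x SP by (auto simp: T_def)
  qed
  define Z where "Z = ((\<lambda>(x, y). x - y) ` (T \<times> T) \<union> (\<lambda>r'. cross3 (r' - r) (height r)) ` R) - {0}"
  have "finite Z" using fT finite_R by (simp add: Z_def)
  then have "\<exists>d. \<forall>z\<in>Z. d \<bullet> z \<noteq> 0" by (rule generic_vector_exists) (simp add: Z_def)
  then obtain d where d: "\<forall>z\<in>Z. d \<bullet> z \<noteq> 0" ..
  have dT: "x = y" if "x \<in> T" "y \<in> T" "d \<bullet> x = d \<bullet> y" for x y
  proof (rule ccontr)
    assume "x \<noteq> y"
    then have "x - y \<in> Z" using that by (auto simp: Z_def)
    then have "d \<bullet> (x - y) \<noteq> 0" using d by blast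
    then show False using that by (simp add: inner_diff_right)
  qed
  \<comment> \<open>The direction along the arc of \<open>r'\<close>, oriented eastwards.\<close>
  define e where "e = (\<lambda>r'. if d \<bullet> cross3 (r' - r) (height r) > 0 then cross3 (r' - r) (height r) else - cross3 (r' - r) (height r))"
  have e: "e (snd i) \<noteq> 0" "e (snd i) = cross3 (snd i - r) (height r) \<or> e (snd i) = - cross3 (snd i - r) (height r)"
      "d \<bullet> e (snd i) > 0" if i: "i \<in> I" for i
  proof -
    have "cross3 (snd i - r) (height r) \<noteq> 0"
      using edge_vector_nonzero[of "u i" r "snd i"] u[OF i] nb[OF i] by auto
    moreover from this have "cross3 (snd i - r) (height r) \<in> Z" using nb[OF i] by (auto simp: Z_def)
    ultimately have "d \<bullet> cross3 (snd i - r) (height r) \<noteq> 0" using d by blast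
    then show "e (snd i) = cross3 (snd i - r) (height r) \<or> e (snd i) = - cross3 (snd i - r) (height r)"
      "d \<bullet> e (snd i) > 0" by (auto simp: e_def)
    then show "e (snd i) \<noteq> 0" by auto
  qed
  define later where "later = (\<lambda>i j. j \<in> I \<and> snd j = snd i \<and> d \<bullet> u i < d \<bullet> u j)"
  define N where "N = {i \<in> I. \<exists>j. later i j}"
  have last: "card (I - N) \<le> card (edges_at r)"
  proof (rule card_inj_on_le[of snd])
    show "finite (edges_at r)" by (rule finite_edges_at)
    show "snd ` (I - N) \<subseteq> edges_at r" by (auto simp: I_def neighbours_iff_labels)
    show "inj_on snd (I - N)"
    proof (rule inj_onI)
      fix i j assume i: "i \<in> I - N" and j: "j \<in> I - N" and eq: "snd i = snd j"
      have "\<not> later i j" "\<not> later j i" using i j unfolding N_def by blast+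
      then have same: "d \<bullet> u i = d \<bullet> u j" using i j eq by (simp add: later_def)
      have iI: "i \<in> I" and jI: "j \<in> I" using i j by auto
      have perp: "(snd k - r) \<bullet> u k = 0" if "k \<in> I" for k
        using maximizers_value_eq[of r R "u k" "snd k"] u[OF that]
        by (simp add: inner_diff_flip)
      have nz: "cross3 (snd i - r) (height r) \<noteq> 0"
        using e(1,2)[OF iI] by auto
      obtain t where t: "u j = u i + t *\<^sub>R cross3 (snd i - r) (height r)"
        using edge_line[OF refl nz, of "u i" "u j"] perp[OF iI] perp[OF jI] u[OF iI] u[OF jI] eq by auto
      have "d \<bullet> cross3 (snd i - r) (height r) \<noteq> 0" using e(2,3)[OF iI] by auto
      then have "t = 0" using same t by (simp add: inner_add_right)
      then have "u i = u j" using t by simp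
      then have "fst i = fst j" using u[OF iI] u[OF jI] by auto
      then show "i = j" using eq by (simp add: prod_eq_iff)
    qed
  qed
  define change where "change = (\<lambda>i x q. height r \<bullet> x = 1 \<and> maximizers R x = {r, snd i} \<and> q \<in> S \<and> q \<noteq> fst i \<and>
     fst i \<in> maximizers S x \<and> q \<in> maximizers S x \<and> d \<bullet> u i < d \<bullet> x \<and>
     (\<exists>j. later i j \<and> d \<bullet> x < d \<bullet> u j) \<and> (\<exists>t>0. x = u i + t *\<^sub>R e (snd i)) \<and>
     ((\<forall>y\<in>piece S r (fst i). d \<bullet> y \<le> d \<bullet> x) \<or> (\<forall>y\<in>piece S r q. d \<bullet> x \<le> d \<bullet> y)))"
  have "\<exists>x q. change i x q" if "i \<in> N" for i
  proof -
    obtain j where i: "i \<in> I" and j: "later i j" using \<open>i \<in> N\<close> unfolding N_def by blast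
    then have jI: "j \<in> I" and sj: "snd j = snd i" and less: "d \<bullet> u i < d \<bullet> u j" by (auto simp: later_def)
    have "fst j \<noteq> fst i" using sj less by (metis less_irrefl prod_eqI)
    from label_change[OF SP(1) nb(3)[OF i] nb(3)[OF jI] this nb(1,2)[OF i] e[OF i]
        u1[OF i] u2[OF i] u3[OF i] u1[OF jI] u2[OF jI] u3[OF jI, unfolded sj] less]
    show ?thesis unfolding change_def using j by blast
  qed
  then obtain x q where "\<And>i. i \<in> N \<Longrightarrow> change i (x i) (q i)" by metis
  then have x: "height r \<bullet> x i = 1" "maximizers R (x i) = {r, snd i}" "q i \<in> S" "q i \<noteq> fst i"
     "fst i \<in> maximizers S (x i)" "q i \<in> maximizers S (x i)" "d \<bullet> u i < d \<bullet> x i"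
     "\<exists>j. later i j \<and> d \<bullet> x i < d \<bullet> u j" "\<exists>t>0. x i = u i + t *\<^sub>R e (snd i)"
     "(\<forall>y\<in>piece S r (fst i). d \<bullet> y \<le> d \<bullet> x i) \<or> (\<forall>y\<in>piece S r (q i). d \<bullet> x i \<le> d \<bullet> y)" if "i \<in> N" for i
    using that unfolding change_def by blast+
  have NI: "N \<subseteq> I" unfolding N_def by blast
  have xT: "x i \<in> T" if "i \<in> N" for i
  proof -
    have i: "i \<in> I" using that by (simp add: N_def)
    show ?thesis by (rule inT[OF x(1,2)[OF that] nb(2,3)[OF i] x(3,4,5,6)[OF that]])
  qed
  have xreg: "x i \<in> piece S r (fst i)" "x i \<in> piece S r (q i)" if "i \<in> N" for i
    using x(1,2,5,6)[OF that] by (auto simp: piece_def)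
  have ureg: "u i \<in> piece S r (fst i)" if "i \<in> I" for i
  proof -
    have "fst i \<in> maximizers P (u i)" using u[OF that] by simp
    then have "fst i \<in> maximizers S (u i)" using nb(3)[OF that] SP by (auto simp: maximizers_def)
    then show ?thesis using u[OF that] by (simp add: piece_def)
  qed
  \<comment> \<open>A change is charged to the eastern end of its old piece if possible (marked with \<open>True\<close>), and to
    the western end of its new piece otherwise.\<close>
  define east where "east = (\<lambda>i. \<forall>y\<in>piece S r (fst i). d \<bullet> y \<le> d \<bullet> x i)"
  have west: "\<forall>y\<in>piece S r (q i). d \<bullet> x i \<le> d \<bullet> y" if "i \<in> N" "\<not> east i" for i
    using x(10)[OF that(1)] that(2) by (auto simp: east_def)
  define g where "g = (\<lambda>i. if east i then (fst i, True) else (q i, False))"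
  have same_x: "snd i = snd j" if "i \<in> N" "j \<in> N" "x i = x j" for i j
  proof -
    have "{r, snd i} = {r, snd j}" using x(2)[OF that(1)] x(2)[OF that(2)] that(3) by simp
    then show ?thesis using nb(2) NI that by (auto simp: doubleton_eq_iff)
  qed
  have inj: "inj_on g N"
  proof (rule inj_onI)
    fix i j assume i: "i \<in> N" and j: "j \<in> N" and eq: "g i = g j"
    show "i = j"
    proof (cases "east i")
      case True
      then have "east j" "fst i = fst j" using eq by (auto simp: g_def split: if_splits)
      then have "d \<bullet> x i \<le> d \<bullet> x j" "d \<bullet> x j \<le> d \<bullet> x i"
        using True xreg(1)[OF i] xreg(1)[OF j] by (auto simp: east_def)
      then have "x i = x j" using dT[OF xT[OF i] xT[OF j]] by simp
      then show ?thesis using same_x[OF i j] \<open>fst i = fst j\<close> by (simp add: prod_eq_iff)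
    next
      case False
      then have ej: "\<not> east j" and qq: "q i = q j" using eq by (auto simp: g_def split: if_splits)
      have "d \<bullet> x i \<le> d \<bullet> x j" "d \<bullet> x j \<le> d \<bullet> x i"
        using west[OF i False] west[OF j ej] qq xreg(2)[OF i] xreg(2)[OF j] by auto
      then have xx: "x i = x j" using dT[OF xT[OF i] xT[OF j]] by simp
      then have ss: "snd i = snd j" by (rule same_x[OF i j])
      have "fst i = fst j"
      proof (rule ccontr)
        assume ne: "fst i \<noteq> fst j"
        have step: "(fst b - fst a) \<bullet> e (snd i) > 0"
          if a: "a \<in> N" and b: "b \<in> N" and ab: "fst a \<noteq> fst b" "x a = x b" "snd a = snd i" for a b
        proof -
          obtain t where t: "t > 0" "x a = u a + t *\<^sub>R e (snd i)" using x(9)[OF a] ab by auto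
          have aI: "a \<in> I" "b \<in> I" using a b NI by auto
          have "u a \<bullet> fst b < u a \<bullet> fst a"
            using maximizers_unique_less[of P "u a" "fst a" "fst b"] u[OF aI(1)] nb(3)[OF aI(2)] SP ab finite_P by auto
          then have 1: "(fst b - fst a) \<bullet> u a < 0" by (simp add: inner_diff_flip)
          have "x a \<bullet> fst b = x a \<bullet> fst a"
            using maximizers_value_eq[of "fst b" S "x a" "fst a"] x(5)[OF a] x(5)[OF b] ab by simp
          then have "(fst b - fst a) \<bullet> x a = 0" by (simp add: inner_diff_flip)
          then have "(fst b - fst a) \<bullet> u a + t * ((fst b - fst a) \<bullet> e (snd i)) = 0" unfolding t(2) by (simp add: inner_add_right)
          then have "t * ((fst b - fst a) \<bullet> e (snd i)) > 0" using 1 by linarith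
          then show ?thesis using t(1) by (simp add: zero_less_mult_iff)
        qed
        have "(fst j - fst i) \<bullet> e (snd i) > 0" using step[OF i j ne xx] by simp
        moreover have "(fst i - fst j) \<bullet> e (snd i) > 0" using step[OF j i] ne xx ss by simp
        ultimately show False by (simp add: inner_diff_left)
      qed
      then show ?thesis using ss by (simp add: prod_eq_iff)
    qed
  qed
  have "\<exists>s\<in>S. (s, True) \<notin> g ` N"
  proof (rule ccontr)
    assume "\<not> ?thesis"
    then have "\<forall>s\<in>S. \<exists>i. i \<in> N \<and> east i \<and> fst i = s" by (fastforce simp: g_def split: if_splits)
    then obtain f where f: "\<And>s. s \<in> S \<Longrightarrow> f s \<in> N \<and> east (f s) \<and> fst (f s) = s" by metis
    have "Max ((\<lambda>s. d \<bullet> x (f s)) ` S) \<in> (\<lambda>s. d \<bullet> x (f s)) ` S" using fS SP by (intro Max_in) auto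
    then obtain s where s: "s \<in> S" "d \<bullet> x (f s) = Max ((\<lambda>s. d \<bullet> x (f s)) ` S)" by auto
    have max: "d \<bullet> x (f s') \<le> d \<bullet> x (f s)" if "s' \<in> S" for s' using that s fS by simp
    obtain j where j: "later (f s) j" "d \<bullet> x (f s) < d \<bullet> u j" using x(8) f s by blast
    then have jI: "j \<in> I" by (simp add: later_def)
    have "d \<bullet> u j \<le> d \<bullet> x (f (fst j))"
      using f[OF nb(3)[OF jI]] ureg[OF jI] by (auto simp: east_def)
    then show False using max[OF nb(3)[OF jI]] j by simp
  qed
  then obtain s1 where s1: "s1 \<in> S" "(s1, True) \<notin> g ` N" by blast
  have "\<exists>s\<in>S. (s, False) \<notin> g ` N"
  proof (rule ccontr)
    assume "\<not> ?thesis"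
    then have "\<forall>s\<in>S. \<exists>i. i \<in> N \<and> \<not> east i \<and> q i = s" by (fastforce simp: g_def split: if_splits)
    then obtain f where f: "\<And>s. s \<in> S \<Longrightarrow> f s \<in> N \<and> \<not> east (f s) \<and> q (f s) = s" by metis
    have "Min ((\<lambda>s. d \<bullet> x (f s)) ` S) \<in> (\<lambda>s. d \<bullet> x (f s)) ` S" using fS SP by (intro Min_in) auto
    then obtain s where s: "s \<in> S" "d \<bullet> x (f s) = Min ((\<lambda>s. d \<bullet> x (f s)) ` S)" by auto
    have min: "d \<bullet> x (f s) \<le> d \<bullet> x (f s')" if "s' \<in> S" for s' using that s fS by simp
    define i where "i = f s"
    have iN: "i \<in> N" using f s by (simp add: i_def)
    then have iI: "i \<in> I" using NI by auto
    have "d \<bullet> x (f (fst i)) \<le> d \<bullet> u i"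
      using west[of "f (fst i)"] f[OF nb(3)[OF iI]] ureg[OF iI] by auto
    then show False using min[OF nb(3)[OF iI]] x(7)[OF iN] by (simp add: i_def)
  qed
  then obtain s2 where s2: "s2 \<in> S" "(s2, False) \<notin> g ` N" by blast
  have "g ` N \<subseteq> S \<times> UNIV - {(s1, True), (s2, False)}"
  proof
    fix y assume "y \<in> g ` N"
    then obtain i where i: "i \<in> N" "y = g i" by auto
    have "fst i \<in> S" using i(1) NI by (intro nb(3)) blast
    then have "fst y \<in> S" using i x(3)[OF i(1)] by (simp add: g_def)
    then show "y \<in> S \<times> UNIV - {(s1, True), (s2, False)}"
      using \<open>y \<in> g ` N\<close> s1 s2 by (cases y) auto
  qed
  then have "card N \<le> card (S \<times> (UNIV :: bool set) - {(s1, True), (s2, False)})"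
    using fS by (intro card_inj_on_le[OF inj]) auto
  also have "\<dots> = 2 * card S - 2"
    using s1 s2 by (subst card_Diff_subset) (auto simp: card_cartesian_product)
  finally have "card N \<le> 2 * card S - 2" .
  moreover have "card S \<ge> 1" using fS SP by (simp add: Suc_leI card_gt_0_iff)
  moreover have "card I = card N + card (I - N)"
    using card_Diff_subset[OF _ NI] card_mono[OF fI NI] finite_subset[OF NI fI] by simp
  ultimately show ?thesis using last cardI by linarith
qed

end

section \<open>A short path in general position\<close>

context general_position begin

lemma label_in_vertex_pairs:
  assumes "p \<in> labels r r'" "r' \<noteq> r"
  shows "(p, r) \<in> vertex_pairs P R"
proof -
  obtain u where u: "maximizers P u = {p}" "maximizers R u = {r, r'}" using assms(1) by (auto simp: labels_def)
  obtain v where "maximizers P v = maximizers {p} (r - r')" "maximizers R v = maximizers {r, r'} (r - r')"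
    using maximizers_perturb_both[OF finite_P finite_R, of u "r - r'"] u by metis
  moreover have "(r - r') \<bullet> r' < (r - r') \<bullet> r"
  proof -
    have "(r - r') \<bullet> (r - r') > 0" using assms(2) by simp
    then show ?thesis by (simp only: inner_diff_right)
  qed
  ultimately show ?thesis by (auto simp: vertex_pairs_def maximizers_pair)
qed

text \<open>
The regions into which the blue cell of \<open>r\<close> is divided, named by their points of \<open>P\<close>.
\<close>

definition cell :: "real^3 \<Rightarrow> (real^3) set" where
  "cell r = {p. (p, r) \<in> vertex_pairs P R}"

lemma cell_subset: "cell r \<subseteq> P"
  using vertex_pairsD by (auto simp: cell_def)

lemma finite_cell: "finite (cell r)"
  using cell_subset finite_P finite_subset by blast

lemma vertex_pairs_sum: "(\<Sum>(p, r)\<in>vertex_pairs P R. f p r) = (\<Sum>r\<in>R. \<Sum>p\<in>cell r. f p r)"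
proof -
  have "(\<Sum>r\<in>R. \<Sum>p\<in>cell r. f p r) = (\<Sum>(r, p)\<in>(SIGMA r:R. cell r). f p r)"
    using finite_R finite_cell by (simp add: sum.Sigma)
  also have "\<dots> = (\<Sum>(p, r)\<in>vertex_pairs P R. f p r)"
    by (rule sum.reindex_bij_witness[of _ prod.swap prod.swap])
      (use vertex_pairsD in \<open>auto simp: cell_def\<close>)
  finally show ?thesis by simp
qed

lemma card_vertex_pairs: "card (vertex_pairs P R) = (\<Sum>r\<in>R. card (cell r))"
  using vertex_pairs_sum[of "\<lambda>p r. 1 :: nat"] by (simp add: case_prod_unfold)

lemma sum_neighbours_lower:
  "card (edges_at r) + (\<Sum>r'\<in>edges_at r. card (crossings_on r r')) \<le> (\<Sum>p\<in>cell r. card (neighbours P R p r))"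
proof -
  have "card (edges_at r) + (\<Sum>r'\<in>edges_at r. card (crossings_on r r')) = (\<Sum>r'\<in>edges_at r. Suc (card (crossings_on r r')))"
    by (simp add: sum.distrib[symmetric] sum_Suc)
  also have "\<dots> \<le> (\<Sum>r'\<in>edges_at r. card (labels r r'))"
    using card_crossings_on_less_labels by (intro sum_mono) (simp add: Suc_leI)
  also have "\<dots> = card (SIGMA r':edges_at r. labels r r')"
    using finite_edges_at finite_labels by simp
  also have "\<dots> = card (SIGMA p:cell r. neighbours P R p r)"
  proof (rule bij_betw_same_card[of prod.swap], rule bij_betw_byWitness[of _ prod.swap])
    show "prod.swap ` (SIGMA r':edges_at r. labels r r') \<subseteq> (SIGMA p:cell r. neighbours P R p r)"
      using label_in_vertex_pairs edges_atD by (auto simp: neighbours_iff_labels cell_def)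
    show "prod.swap ` (SIGMA p:cell r. neighbours P R p r) \<subseteq> (SIGMA r':edges_at r. labels r r')"
      by (auto simp: neighbours_iff_labels)
  qed auto
  also have "\<dots> = (\<Sum>p\<in>cell r. card (neighbours P R p r))"
    using finite_cell finite_neighbours by simp
  finally show ?thesis .
qed

text \<open>
Only regions with at most one blue side contribute to the first sum. The sides of the other regions
are bounded from above by \<open>sum_neighbours_bound\<close> and the sides of all regions from below by
\<open>sum_neighbours_lower\<close>; the number of edges at \<open>r\<close> cancels.
\<close>

lemma deficiency_of_cell:
  assumes r: "r \<in> R"
  shows "(\<Sum>p\<in>cell r. 2 - card (neighbours P R p r)) + (\<Sum>r'\<in>edges_at r. card (crossings_on r r')) + 2 \<le> 2 * card (cell r)"
proof -
  let ?n = "\<lambda>p. card (neighbours P R p r)"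
  define S where "S = {p \<in> cell r. 2 \<le> ?n p}"
  have S: "S \<subseteq> cell r" "finite S" using finite_cell by (auto simp: S_def)
  have upper: "(\<Sum>p\<in>S. ?n p) + 2 \<le> 2 * card S + card (edges_at r)"
  proof (cases "S = {}")
    case True then show ?thesis using two_edges_at_vertex[OF r] by simp
  next
    case False then show ?thesis using sum_neighbours_bound[OF _ False r] S cell_subset by auto
  qed
  have split: "sum f (cell r) = sum f (cell r - S) + sum f S" for f :: "_ \<Rightarrow> nat"
    using sum.subset_diff[OF S(1) finite_cell] .
  have "(\<Sum>p\<in>cell r. 2 - ?n p) = (\<Sum>p\<in>cell r - S. 2 - ?n p)"
    unfolding split by (simp add: S_def)
  moreover have "(\<Sum>p\<in>cell r - S. 2 - ?n p) + (\<Sum>p\<in>cell r - S. ?n p) = 2 * card (cell r - S)"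
  proof -
    have "(\<Sum>p\<in>cell r - S. 2 - ?n p) + (\<Sum>p\<in>cell r - S. ?n p) = (\<Sum>p\<in>cell r - S. 2)"
      unfolding sum.distrib[symmetric] by (rule sum.cong) (auto simp: S_def)
    then show ?thesis by simp
  qed
  moreover have "card (cell r) = card (cell r - S) + card S"
    using split[of "\<lambda>_. 1"] by simp
  ultimately show ?thesis
    using upper sum_neighbours_lower[of r] split[of ?n] by simp
qed

text \<open>
A crossing lies on one blue arc, which is counted from both ends of its edge.
\<close>

lemma sum_crossings_on:
  "2 * card (crossings P R) \<le> (\<Sum>r\<in>R. \<Sum>r'\<in>edges_at r. card (crossings_on r r'))"
proof -
  define E where "E = (SIGMA r:R. SIGMA r':edges_at r. crossings_on r r')"
  have fin: "finite (crossings_on r r')" for r r'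
  proof (rule finite_subset[of _ "Pow P"])
    show "crossings_on r r' \<subseteq> Pow P" using maximizers_subset by (fastforce simp: crossings_on_def)
  qed (use finite_P in simp)
  have fE: "finite E" unfolding E_def using finite_R finite_edges_at fin by (intro finite_SigmaI) auto
  have cE: "card E = (\<Sum>r\<in>R. \<Sum>r'\<in>edges_at r. card (crossings_on r r'))"
    unfolding E_def using finite_R finite_edges_at fin by (simp add: card_SigmaI finite_SigmaI)
  have "\<forall>B. \<exists>rs. card B = 2 \<longrightarrow> B = {fst rs, snd rs} \<and> fst rs \<noteq> snd rs" for B :: "(real^3) set"
    by (auto simp: card_2_iff)
  then obtain h :: "(real^3) set \<Rightarrow> (real^3) \<times> (real^3)" where h: "\<And>B. card B = 2 \<Longrightarrow> B = {fst (h B), snd (h B)} \<and> fst (h B) \<noteq> snd (h B)"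
    by metis
  define g where "g = (\<lambda>((A, B), t). if t then (fst (h B), snd (h B), A) else (snd (h B), fst (h B), A :: (real^3) set))"
  have "card (crossings P R \<times> (UNIV :: bool set)) \<le> card E"
  proof (rule card_inj_on_le[OF _ _ fE, of g])
    show "g ` (crossings P R \<times> UNIV) \<subseteq> E"
    proof
      fix y assume "y \<in> g ` (crossings P R \<times> UNIV)"
      then obtain A B t where AB: "(A, B) \<in> crossings P R" and y: "y = g ((A, B), t)" by auto
      then obtain u where u: "maximizers P u = A" "maximizers R u = B" "card A = 2" "card B = 2"
        by (auto simp: crossings_def)
      define a b where "a = fst (h B)" and "b = snd (h B)"
      have B: "B = {a, b}" "a \<noteq> b" using h[OF u(4)] by (simp_all add: a_def b_def)
      have "maximizers R u \<subseteq> R" by (rule maximizers_subset)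
      then have ab: "a \<in> R" "b \<in> R" using u(2) B(1) by auto
      have "b \<in> edges_at a" "a \<in> edges_at b" using u(2) B by (auto simp: edges_at_def insert_commute)
      moreover have "A \<in> crossings_on a b" "A \<in> crossings_on b a"
        using u B by (auto simp: crossings_on_def insert_commute)
      ultimately show "y \<in> E" using ab y by (simp add: g_def E_def a_def[symmetric] b_def[symmetric])
    qed
    show "inj_on g (crossings P R \<times> UNIV)"
    proof (rule inj_onI)
      fix x y assume x: "x \<in> crossings P R \<times> UNIV" and y: "y \<in> crossings P R \<times> UNIV" and eq: "g x = g y"
      obtain A B t A' B' t' where xy: "x = ((A, B), t)" "y = ((A', B'), t')"
        by (metis surj_pair)
      have c: "card B = 2" "card B' = 2" using x y xy by (auto simp: crossings_def)
      have AA: "A = A'" using eq xy by (auto simp: g_def split: if_splits)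
      have same: "{fst (h B), snd (h B)} = {fst (h B'), snd (h B')}"
        using eq xy by (auto simp: g_def split: if_splits)
      have BB: "B = B'" using h[OF c(1)] h[OF c(2)] same by simp
      have "t = t'" using eq xy BB h[OF c(1)] by (auto simp: g_def split: if_splits)
      then show "x = y" using xy AA BB by simp
    qed
  qed
  then show ?thesis using cE by (simp add: card_cartesian_product)
qed

lemma deficiency_bound:
  "(\<Sum>(p, r)\<in>vertex_pairs P R. 2 - card (neighbours P R p r)) + 2 * card (crossings P R) + 2 * card R
     \<le> 2 * card (vertex_pairs P R)"
proof -
  have "(\<Sum>r\<in>R. (\<Sum>p\<in>cell r. 2 - card (neighbours P R p r)) + (\<Sum>r'\<in>edges_at r. card (crossings_on r r')) + 2)
      \<le> (\<Sum>r\<in>R. 2 * card (cell r))"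
    by (intro sum_mono deficiency_of_cell)
  then have "(\<Sum>r\<in>R. \<Sum>p\<in>cell r. 2 - card (neighbours P R p r)) + (\<Sum>r\<in>R. \<Sum>r'\<in>edges_at r. card (crossings_on r r')) + 2 * card R
      \<le> 2 * (\<Sum>r\<in>R. card (cell r))"
    unfolding sum.distrib sum_distrib_left by (simp add: mult.commute)
  then show ?thesis
    using sum_crossings_on unfolding vertex_pairs_sum card_vertex_pairs by linarith
qed

lemma sum_crossings_at:
  "(\<Sum>(p, r)\<in>vertex_pairs P R. card (crossings_at P R p r)) \<le> 4 * card (crossings P R)"
proof -
  have fin: "finite (fst y \<times> snd y)" if "y \<in> crossings P R" for y
  proof -
    obtain u where "fst y = maximizers P u" "snd y = maximizers R u" using \<open>y \<in> crossings P R\<close> by (auto simp: crossings_def)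
    then show ?thesis
      using finite_subset[OF maximizers_subset finite_P] finite_subset[OF maximizers_subset finite_R] by simp
  qed
  have "(\<Sum>(p, r)\<in>vertex_pairs P R. card (crossings_at P R p r)) = card (SIGMA x:vertex_pairs P R. crossings_at P R (fst x) (snd x))"
    using finite_vertex_pairs finite_crossings_at by (simp add: case_prod_unfold)
  also have "\<dots> \<le> card (SIGMA y:crossings P R. fst y \<times> snd y)"
  proof (rule card_inj_on_le[of prod.swap])
    show "finite (SIGMA y:crossings P R. fst y \<times> snd y)"
      by (intro finite_SigmaI finite_crossings fin)
    show "prod.swap ` (SIGMA x:vertex_pairs P R. crossings_at P R (fst x) (snd x)) \<subseteq> (SIGMA y:crossings P R. fst y \<times> snd y)"
      by (auto simp: crossings_at_def)
  qed (auto simp: inj_on_def)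
  also have "\<dots> = (\<Sum>y\<in>crossings P R. card (fst y \<times> snd y))"
    by (intro card_SigmaI finite_crossings ballI fin)
  also have "\<dots> = (\<Sum>y\<in>crossings P R. 4)"
    by (rule sum.cong) (auto simp: crossings_def card_cartesian_product)
  finally show ?thesis by simp
qed

text \<open>
The four estimates are added up. Without a short path they imply \<open>N \<ge> X + card P + card R\<close>, which
exceeds the bound of \<open>euler_bound\<close> by two.
\<close>

proposition short_path_in_general_position: "short_path P R"
proof (rule ccontr)
  assume no: "\<not> short_path P R"
  interpret sw: general_position R P by (rule swap)
  let ?N = "vertex_pairs P R"
  let ?m = "\<lambda>p r. 2 - card (neighbours P R p r)" and ?q = "\<lambda>p r. 2 - card (neighbours R P r p)"
  let ?c = "\<lambda>p r. card (crossings_at P R p r)"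
  have "(\<Sum>(p, r)\<in>?N. 4) \<le> (\<Sum>(p, r)\<in>?N. 2 * (?m p r + ?q p r) + ?c p r)"
  proof (intro sum_mono, clarify)
    fix p r assume "(p, r) \<in> ?N"
    then obtain u where u: "maximizers P u = {p}" "maximizers R u = {r}" by (auto simp: vertex_pairs_def)
    show "4 \<le> 2 * (?m p r + ?q p r) + ?c p r" by (rule crossings_at_lower_bound[OF u no])
  qed
  then have 1: "4 * card ?N \<le> 2 * ((\<Sum>(p, r)\<in>?N. ?m p r) + (\<Sum>(p, r)\<in>?N. ?q p r)) + (\<Sum>(p, r)\<in>?N. ?c p r)"
    by (simp add: case_prod_unfold sum.distrib sum_distrib_left)
  have swN: "card (vertex_pairs R P) = card ?N"
    unfolding vertex_pairs_swap[of R P] by (simp add: card_image)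
  have swX: "card (crossings R P) = card (crossings P R)"
  proof -
    have "crossings R P = prod.swap ` crossings P R" by (auto simp: crossings_def image_iff; blast)
    then show ?thesis by (simp add: card_image)
  qed
  have "(\<Sum>(r, p)\<in>vertex_pairs R P. ?q p r) = (\<Sum>(p, r)\<in>?N. ?q p r)"
    unfolding vertex_pairs_swap[of R P] by (subst sum.reindex) (auto simp: case_prod_unfold)
  then have 2: "(\<Sum>(p, r)\<in>?N. ?q p r) + 2 * card (crossings P R) + 2 * card P \<le> 2 * card ?N"
    using sw.deficiency_bound swN swX by simp
  have arith: False if "4 * n \<le> 2 * (a + b) + c" "b + 2 * x + 2 * f \<le> 2 * n" "a + 2 * x + 2 * g \<le> 2 * n"
      "c \<le> 4 * x" "n + 2 \<le> x + f + g" for n a b c x f g :: nat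
    using that by simp
  show False by (rule arith[OF 1 2 deficiency_bound sum_crossings_at euler_bound])
qed

end

section \<open>Perturbation into general position\<close>

lemma affine_eventually_nonzero:
  fixes a b :: real
  assumes "a \<noteq> 0 \<or> b \<noteq> 0"
  shows "\<forall>\<^sub>F t in at_right 0. a + t * b \<noteq> 0"
proof (cases "a = 0")
  case True
  have "\<forall>\<^sub>F t in at_right (0::real). 0 < t" by (rule eventually_at_right_less)
  then show ?thesis using True assms by (auto elim: eventually_mono)
next
  case False
  have "((\<lambda>t. a + t * b) \<longlongrightarrow> a + 0 * b) (at_right 0)" by (intro tendsto_intros)
  then show ?thesis using False by (intro tendsto_imp_eventually_ne[of _ "a + 0 * b"]) auto
qed

text \<open>
A rank one perturbation of the identity. It is chosen because the determinants that express general
position are affine functions of \<open>t\<close>, so that a nonzero one has no zeros for small positive \<open>t\<close>.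
\<close>

definition shear :: "'a::real_inner \<Rightarrow> 'a \<Rightarrow> real \<Rightarrow> 'a \<Rightarrow> 'a" where
  "shear x y t r = r + (t * (y \<bullet> r)) *\<^sub>R x"

lemma shear_diff: "shear x y t r - shear x y t r' = shear x y t (r - r')"
  by (simp add: shear_def inner_diff_right algebra_simps)

lemma inner_shear: "u \<bullet> shear x y t r = (u + (t * (u \<bullet> x)) *\<^sub>R y) \<bullet> r"
  by (simp add: shear_def inner_add_left inner_add_right)

lemma maximizers_shear: "maximizers (shear x y t ` R) u = shear x y t ` maximizers R (u + (t * (u \<bullet> x)) *\<^sub>R y)"
  by (auto simp: maximizers_def inner_shear)

lemma shear_adjoint_surj:
  assumes "1 + t * (x \<bullet> y) \<noteq> 0"
  shows "\<exists>u. u + (t * (u \<bullet> x)) *\<^sub>R y = v"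
proof
  let ?s = "t / (1 + t * (x \<bullet> y))"
  let ?u = "v - (?s * (x \<bullet> v)) *\<^sub>R y"
  have "?u \<bullet> x = (x \<bullet> v) * (1 - ?s * (x \<bullet> y))"
    by (simp add: inner_diff_left inner_commute algebra_simps)
  also have "1 - ?s * (x \<bullet> y) = 1 / (1 + t * (x \<bullet> y))"
    using assms by (simp add: field_simps)
  finally have "t * (?u \<bullet> x) = ?s * (x \<bullet> v)" by simp
  then show "?u + (t * (?u \<bullet> x)) *\<^sub>R y = v" by simp
qed

lemma shear_adjoint_inj:
  assumes "1 + t * (x \<bullet> y) \<noteq> 0" "u + (t * (u \<bullet> x)) *\<^sub>R y = 0"
  shows "u = 0"
proof -
  have "(u \<bullet> x) * (1 + t * (x \<bullet> y)) = 0"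
    using arg_cong[OF assms(2), of "\<lambda>v. v \<bullet> x"] by (simp add: inner_add_left inner_commute algebra_simps)
  then have "u \<bullet> x = 0" using assms(1) by simp
  then show ?thesis using assms(2) by simp
qed

text \<open>
If the determinant vanishes for \<open>t = 0\<close>, then the coefficient of \<open>t\<close> is, up to sign, a product of two numbers that are
nonzero for generic \<open>x\<close> and \<open>y\<close>.
\<close>

lemma det_shear:
  "cross3 (shear x y t a) (shear x y t b) \<bullet> c =
     cross3 a b \<bullet> c + t * ((cross3 a b \<bullet> c) * (x \<bullet> y) - (cross3 a b \<bullet> x) * (y \<bullet> c))"
proof -
  have "cross3 (shear x y t a) (shear x y t b) \<bullet> c
      = cross3 a b \<bullet> c + t * ((y \<bullet> a) * (cross3 x b \<bullet> c) + (y \<bullet> b) * (cross3 a x \<bullet> c))"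
    by (simp add: shear_def cross_add_left cross_add_right cross_mult_left cross_mult_right inner_add_left algebra_simps)
  moreover have "(y \<bullet> a) * (cross3 x b \<bullet> c) + (y \<bullet> b) * (cross3 a x \<bullet> c) = (cross3 a b \<bullet> c) * (x \<bullet> y) - (cross3 a b \<bullet> x) * (y \<bullet> c)"
    by (simp add: cross3_simps)
  ultimately show ?thesis by simp
qed

text \<open>
Transversality says that the normal of a facet of one polytope is not orthogonal to an edge of the other.
For the finitely many triples of points of one set and pairs of the other, this is a determinant that is
affine in \<open>t\<close>, and generic \<open>x\<close> and \<open>y\<close> prevent it from vanishing identically.
\<close>

lemma eventually_general_position:
  fixes P R :: "(real^3) set"
  assumes fin: "finite P" "finite R"
    and extP: "\<And>p. p \<in> P \<Longrightarrow> \<exists>u. maximizers P u = {p}" and extR: "\<And>r. r \<in> R \<Longrightarrow> \<exists>u. maximizers R u = {r}"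
    and fullP: "\<And>v. (\<And>p q. p \<in> P \<Longrightarrow> q \<in> P \<Longrightarrow> v \<bullet> p = v \<bullet> q) \<Longrightarrow> v = 0"
    and fullR: "\<And>v. (\<And>p q. p \<in> R \<Longrightarrow> q \<in> R \<Longrightarrow> v \<bullet> p = v \<bullet> q) \<Longrightarrow> v = 0"
  shows "\<exists>x y. \<forall>\<^sub>F t in at_right 0. general_position P (shear x y t ` R)"
proof -
  define triples where "triples = (\<lambda>S :: (real^3) set. {(a, b, c) \<in> S \<times> S \<times> S. distinct [a, b, c]})"
  define pairs where "pairs = (\<lambda>S :: (real^3) set. {(a, b) \<in> S \<times> S. a \<noteq> b})"
  have ft: "finite (triples S)" if "finite S" for S
    by (rule finite_subset[of _ "S \<times> S \<times> S"]) (use that in \<open>auto simp: triples_def\<close>)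
  have fp: "finite (pairs S)" if "finite S" for S
    by (rule finite_subset[of _ "S \<times> S"]) (use that in \<open>auto simp: pairs_def\<close>)
  define nrm where "nrm = (\<lambda>(a, b, c). cross3 (b - a) (c - a :: real^3))"
  have "\<exists>x. \<forall>z\<in>nrm ` (triples P \<union> triples R). x \<bullet> z \<noteq> 0"
  proof (rule generic_vector_exists)
    show "finite (nrm ` (triples P \<union> triples R))" using ft fin by simp
    have "nrm a \<noteq> 0" if "a \<in> triples P \<union> triples R" for a
      using that no_three_collinear[OF fin(1) extP] no_three_collinear[OF fin(2) extR]
      by (auto simp: triples_def nrm_def)
    then show "0 \<notin> nrm ` (triples P \<union> triples R)" by (metis imageE)
  qed
  then obtain x where x: "\<forall>z\<in>nrm ` (triples P \<union> triples R). x \<bullet> z \<noteq> 0" ..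
  have "\<exists>y. \<forall>z\<in>(\<lambda>(a, b). b - a) ` (pairs P \<union> pairs R). y \<bullet> z \<noteq> 0"
    by (rule generic_vector_exists) (use fp fin in \<open>auto simp: pairs_def\<close>)
  then obtain y where y: "\<forall>z\<in>(\<lambda>(a, b). b - a) ` (pairs P \<union> pairs R). y \<bullet> z \<noteq> 0" ..
  have xn: "x \<bullet> cross3 (b - a) (c - a) \<noteq> 0" if "(a, b, c) \<in> triples P \<union> triples R" for a b c
    using x that by (force simp: nrm_def)
  have yn: "y \<bullet> (b - a) \<noteq> 0" if "(a, b) \<in> pairs P \<union> pairs R" for a b
    using y that by force
  \<comment> \<open>\<open>C1\<close> excludes a red vertex on a blue arc, and \<open>C2\<close> a blue vertex on a red arc.\<close>
  define C1 where "C1 = (\<lambda>((a, b, c), (r, s)) t. cross3 (b - a) (c - a) \<bullet> shear x y t (s - r) \<noteq> 0)"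
  define C2 where "C2 = (\<lambda>((a, b, c), (r, s)) t. cross3 (shear x y t (b - a)) (shear x y t (c - a)) \<bullet> (s - r) \<noteq> 0)"
  have ev0: "\<forall>\<^sub>F t in at_right 0. 1 + t * (x \<bullet> y) \<noteq> 0"
    by (rule affine_eventually_nonzero) simp
  have ev1: "\<forall>\<^sub>F t in at_right 0. \<forall>i\<in>triples P \<times> pairs R. C1 i t"
  proof (intro eventually_ball_finite ballI)
    show "finite (triples P \<times> pairs R)" using ft fp fin by simp
    fix i assume "i \<in> triples P \<times> pairs R"
    then obtain a b c r s where i: "i = ((a, b, c), (r, s))" "(a, b, c) \<in> triples P" "(r, s) \<in> pairs R" by auto
    let ?n = "cross3 (b - a) (c - a)"
    have "\<forall>\<^sub>F t in at_right 0. ?n \<bullet> (s - r) + t * ((y \<bullet> (s - r)) * (?n \<bullet> x)) \<noteq> 0"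
      using xn[of a b c] yn[of r s] i by (intro affine_eventually_nonzero) (auto simp: inner_commute)
    then show "\<forall>\<^sub>F t in at_right 0. C1 i t"
      by (rule eventually_mono) (auto simp: C1_def i shear_def inner_add_right algebra_simps)
  qed
  have ev2: "\<forall>\<^sub>F t in at_right 0. \<forall>i\<in>triples R \<times> pairs P. C2 i t"
  proof (intro eventually_ball_finite ballI)
    show "finite (triples R \<times> pairs P)" using ft fp fin by simp
    fix i assume "i \<in> triples R \<times> pairs P"
    then obtain a b c r s where i: "i = ((a, b, c), (r, s))" "(a, b, c) \<in> triples R" "(r, s) \<in> pairs P" by auto
    let ?n = "cross3 (b - a) (c - a)"
    have "\<forall>\<^sub>F t in at_right 0. ?n \<bullet> (s - r) + t * ((?n \<bullet> (s - r)) * (x \<bullet> y) - (?n \<bullet> x) * (y \<bullet> (s - r))) \<noteq> 0"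
      using xn[of a b c] yn[of r s] i by (intro affine_eventually_nonzero) (auto simp: inner_commute)
    then show "\<forall>\<^sub>F t in at_right 0. C2 i t"
      unfolding C2_def i det_shear by (rule eventually_mono) simp
  qed
  have two: "\<exists>a b. a \<in> P \<and> b \<in> P \<and> a \<noteq> b"
    using fullP[of "axis 1 1"] by (auto simp: axis_eq_0_iff)
  have third: "\<exists>c\<in>P. c \<noteq> a \<and> c \<noteq> b" if "a \<in> P" "b \<in> P" for a b
  proof (rule ccontr)
    assume "\<not> ?thesis"
    then have Pab: "P \<subseteq> {a, b}" by auto
    obtain v where v: "v \<noteq> 0" "orthogonal v (b - a)"
      using orthogonal_to_vector_exists[of "b - a"] by (auto simp: orthogonal_commute)
    have "v \<bullet> p = v \<bullet> a" if "p \<in> P" for p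
      using that Pab v by (auto simp: orthogonal_def inner_diff_right)
    then have "v = 0" by (intro fullP) simp
    then show False using v by simp
  qed
  have "\<forall>\<^sub>F t in at_right 0. general_position P (shear x y t ` R)"
    using ev0 ev1 ev2
  proof eventually_elim
    case (elim t)
    let ?T = "shear x y t"
    have c1: "cross3 (b - a) (c - a) \<bullet> ?T (s - r) \<noteq> 0"
      if "a \<in> P" "b \<in> P" "c \<in> P" "distinct [a, b, c]" "r \<in> R" "s \<in> R" "r \<noteq> s" for a b c r s
      using bspec[OF elim(2), of "((a, b, c), (r, s))"] that by (auto simp: C1_def triples_def pairs_def)
    have c2: "cross3 (?T (b - a)) (?T (c - a)) \<bullet> (s - r) \<noteq> 0"
      if "a \<in> R" "b \<in> R" "c \<in> R" "distinct [a, b, c]" "r \<in> P" "s \<in> P" "r \<noteq> s" for a b c r s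
      using bspec[OF elim(3), of "((a, b, c), (r, s))"] that by (auto simp: C2_def triples_def pairs_def)
    show ?case
    proof
      show "finite P" "finite (?T ` R)" using fin by auto
      show "\<exists>u. maximizers P u = {p}" if "p \<in> P" for p using extP that .
      show "\<exists>u. maximizers (?T ` R) u = {r}" if "r \<in> ?T ` R" for r
      proof -
        obtain s where s: "s \<in> R" "r = ?T s" using \<open>r \<in> ?T ` R\<close> by auto
        obtain v where "maximizers R v = {s}" using extR s by blast
        moreover obtain u where "u + (t * (u \<bullet> x)) *\<^sub>R y = v" using shear_adjoint_surj[OF elim(1)] by blast
        ultimately show ?thesis using s by (intro exI[of _ u]) (simp add: maximizers_shear)
      qed
      show "v = 0" if "\<And>p q. p \<in> P \<Longrightarrow> q \<in> P \<Longrightarrow> v \<bullet> p = v \<bullet> q" for v using fullP that by blast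
      show "v = 0" if v: "\<And>p q. p \<in> ?T ` R \<Longrightarrow> q \<in> ?T ` R \<Longrightarrow> v \<bullet> p = v \<bullet> q" for v
      proof (rule shear_adjoint_inj[OF elim(1)], rule fullR)
        fix p q assume "p \<in> R" "q \<in> R"
        then show "(v + (t * (v \<bullet> x)) *\<^sub>R y) \<bullet> p = (v + (t * (v \<bullet> x)) *\<^sub>R y) \<bullet> q"
          using v[of "?T p" "?T q"] by (simp add: inner_shear)
      qed
    next
      fix u p p' p'' r r'
      assume u: "u \<noteq> 0" and p: "{p, p', p''} \<subseteq> maximizers P u" "distinct [p, p', p'']"
        and r: "r \<in> maximizers (?T ` R) u" "r' \<in> maximizers (?T ` R) u"
      have pP: "p \<in> P" "p' \<in> P" "p'' \<in> P" using p maximizers_subset by blast+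
      obtain s s' where s: "r = ?T s" "r' = ?T s'" "s \<in> R" "s' \<in> R" using r maximizers_subset by blast
      let ?n = "cross3 (p' - p) (p'' - p)"
      have "u \<bullet> p' = u \<bullet> p" "u \<bullet> p'' = u \<bullet> p" using p by (auto intro!: maximizers_value_eq[of _ P])
      then have n: "(?n \<bullet> ?n) *\<^sub>R u = (?n \<bullet> u) *\<^sub>R ?n"
        by (intro orthogonal_to_both) (simp_all add: inner_diff_flip)
      have "?n \<noteq> 0" using no_three_collinear[OF fin(1) extP pP p(2)] .
      then have nu: "?n \<bullet> u \<noteq> 0" using n u by auto
      have "u \<bullet> (r' - r) = 0" using maximizers_value_eq[OF r(2,1)] by (simp add: inner_diff_right)
      then have "(?n \<bullet> u) * (?n \<bullet> (r' - r)) = 0"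
        using arg_cong[OF n, of "\<lambda>v. v \<bullet> (r' - r)"] by simp
      then have "?n \<bullet> ?T (s' - s) = 0" using nu s by (simp add: shear_diff)
      then have "s = s'" using c1[OF pP p(2) s(3,4)] by blast
      then show "r = r'" using s by simp
    next
      fix u r r' r'' p p'
      assume u: "u \<noteq> 0" and r: "{r, r', r''} \<subseteq> maximizers (?T ` R) u" "distinct [r, r', r'']"
        and p: "p \<in> maximizers P u" "p' \<in> maximizers P u"
      have pP: "p \<in> P" "p' \<in> P" using p maximizers_subset by blast+
      have sub: "{r, r', r''} \<subseteq> ?T ` R" using r(1) maximizers_subset by (rule order_trans)
      obtain s where s1: "r = ?T s" "s \<in> R" using sub by blast
      obtain s' where s2: "r' = ?T s'" "s' \<in> R" using sub by blast
      obtain s'' where s3: "r'' = ?T s''" "s'' \<in> R" using sub by blast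
      note s = s1(1) s2(1) s3(1) s1(2) s2(2) s3(2)
      have ds: "distinct [s, s', s'']" using r(2) s by auto
      let ?n = "cross3 (r' - r) (r'' - r)"
      have "u \<bullet> r' = u \<bullet> r" "u \<bullet> r'' = u \<bullet> r" using r by (auto intro!: maximizers_value_eq[of _ "?T ` R"])
      then have n: "(?n \<bullet> ?n) *\<^sub>R u = (?n \<bullet> u) *\<^sub>R ?n"
        by (intro orthogonal_to_both) (simp_all add: inner_diff_flip)
      have c: "?n \<bullet> (q - q') \<noteq> 0" if "q \<in> P" "q' \<in> P" "q' \<noteq> q" for q q'
        using c2[OF s(4-6) ds that(2,1,3)] s by (simp add: shear_diff)
      then have "?n \<noteq> 0" using two by fastforce
      then have nu: "?n \<bullet> u \<noteq> 0" using n u by auto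
      have "u \<bullet> (p' - p) = 0" using maximizers_value_eq[OF p(2,1)] by (simp add: inner_diff_right)
      then have "(?n \<bullet> u) * (?n \<bullet> (p' - p)) = 0"
        using arg_cong[OF n, of "\<lambda>v. v \<bullet> (p' - p)"] by simp
      then show "p = p'" using c[of p' p] nu pP by auto
    next
      fix p p' r r' assume p: "p \<in> P" "p' \<in> P" "p \<noteq> p'" and r: "r \<in> ?T ` R" "r' \<in> ?T ` R" "r \<noteq> r'"
      obtain s s' where s: "r = ?T s" "r' = ?T s'" "s \<in> R" "s' \<in> R" "s \<noteq> s'" using r by blast
      obtain p'' where p'': "p'' \<in> P" "p'' \<noteq> p" "p'' \<noteq> p'" using third p by blast
      have "cross3 (p' - p) (p'' - p) \<bullet> (r' - r) \<noteq> 0"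
        using c1[of p p' p'' s s'] p p'' s by (simp add: shear_diff)
      then show "cross3 (p' - p) (r' - r) \<noteq> 0"
        using cross3_dot_swap(2)[of "p' - p" "p'' - p" "r' - r"] by auto
    qed
  qed
  then show ?thesis by blast
qed

lemma closed_Collect_ball_le:
  assumes "\<And>q. q \<in> S \<Longrightarrow> continuous_on UNIV (f q)" "continuous_on UNIV g"
  shows "closed {w. \<forall>q\<in>S. f q w \<le> (g w :: real)}"
proof -
  have "{w. \<forall>q\<in>S. f q w \<le> g w} = (\<Inter>q\<in>S. {w. f q w \<le> g w})" by auto
  then show ?thesis using assms by (auto intro!: closed_INT closed_Collect_le)
qed

text \<open>
The set of parameters \<open>t\<close> for which the sheared sets admit a short path with given points and normals of
length one is the projection of a compact set, hence closed. There are finitely many choices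
of the points, and together the closed sets contain all small positive \<open>t\<close>, so they contain zero.
\<close>

proposition short_path_exists:
  fixes P R :: "(real^3) set"
  assumes fin: "finite P" "finite R"
    and extP: "\<And>p. p \<in> P \<Longrightarrow> \<exists>u. maximizers P u = {p}" and extR: "\<And>r. r \<in> R \<Longrightarrow> \<exists>u. maximizers R u = {r}"
    and fullP: "\<And>v. (\<And>p q. p \<in> P \<Longrightarrow> q \<in> P \<Longrightarrow> v \<bullet> p = v \<bullet> q) \<Longrightarrow> v = 0"
    and fullR: "\<And>v. (\<And>p q. p \<in> R \<Longrightarrow> q \<in> R \<Longrightarrow> v \<bullet> p = v \<bullet> q) \<Longrightarrow> v = 0"
  shows "short_path P R"
proof -
  obtain x y where gp: "\<forall>\<^sub>F t in at_right 0. general_position P (shear x y t ` R)"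
    using eventually_general_position[OF fin extP extR fullP fullR] by blast
  let ?T = "shear x y"
  define mP where "mP = (\<lambda>(a :: real^3) p. \<forall>q\<in>P. a \<bullet> q \<le> a \<bullet> p)"
  define mR where "mR = (\<lambda>t (a :: real^3) r. \<forall>q\<in>R. a \<bullet> ?T t q \<le> a \<bullet> ?T t r)"
  define W where "W = {0..1 :: real} \<times> sphere (0 :: real^3) 1 \<times> sphere (0 :: real^3) 1 \<times> sphere (0 :: real^3) 1"
  define F where "F = (\<lambda>(p, p', p'', r, r', r''). W \<inter>
     {(t, a, b, c). mP a p \<and> mP a p' \<and> mP a p'' \<and> mR t a r \<and> mP b p \<and> mP b p' \<and> mR t b r \<and> mR t b r' \<and>
        mP c p \<and> mR t c r \<and> mR t c r' \<and> mR t c r''})"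
  define D where "D = {(p, p', p'', r, r', r''). {p, p', p''} \<subseteq> P \<and> {r, r', r''} \<subseteq> R \<and> distinct [p, p', p''] \<and> distinct [r, r', r'']}"
  have fD: "finite D"
    by (rule finite_subset[of _ "P \<times> P \<times> P \<times> R \<times> R \<times> R"]) (use fin in \<open>auto simp: D_def\<close>)
  have compF: "compact (F i)" for i
  proof -
    obtain p p' p'' r r' r'' where i: "i = (p, p', p'', r, r', r'')" by (metis surj_pair)
    have cW: "compact W" unfolding W_def by (intro compact_Times compact_sphere) auto
    have cl: "closed {w :: real \<times> (real^3) \<times> (real^3) \<times> (real^3). mP (g w) p}" if "continuous_on UNIV g" for g p
      unfolding mP_def by (intro closed_Collect_ball_le continuous_intros that)
    have cl': "closed {w :: real \<times> (real^3) \<times> (real^3) \<times> (real^3). mR (fst w) (g w) p}" if "continuous_on UNIV g" for g p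
      unfolding mR_def shear_def by (intro closed_Collect_ball_le continuous_intros that)
    have ca: "continuous_on UNIV (\<lambda>w :: real \<times> (real^3) \<times> (real^3) \<times> (real^3). fst (snd w))"
      "continuous_on UNIV (\<lambda>w :: real \<times> (real^3) \<times> (real^3) \<times> (real^3). fst (snd (snd w)))"
      "continuous_on UNIV (\<lambda>w :: real \<times> (real^3) \<times> (real^3) \<times> (real^3). snd (snd (snd w)))"
      by (intro continuous_intros)+
    note A = cl[OF ca(1)] and B = cl[OF ca(2)] and C = cl[OF ca(3)]
    note A' = cl'[OF ca(1)] and B' = cl'[OF ca(2)] and C' = cl'[OF ca(3)]
    have "F i = W \<inter> ({w. mP (fst (snd w)) p} \<inter> {w. mP (fst (snd w)) p'} \<inter> {w. mP (fst (snd w)) p''} \<inter> {w. mR (fst w) (fst (snd w)) r}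
       \<inter> {w. mP (fst (snd (snd w))) p} \<inter> {w. mP (fst (snd (snd w))) p'} \<inter> {w. mR (fst w) (fst (snd (snd w))) r} \<inter> {w. mR (fst w) (fst (snd (snd w))) r'}
       \<inter> {w. mP (snd (snd (snd w))) p} \<inter> {w. mR (fst w) (snd (snd (snd w))) r} \<inter> {w. mR (fst w) (snd (snd (snd w))) r'} \<inter> {w. mR (fst w) (snd (snd (snd w))) r''})"
      unfolding F_def i by (auto simp: case_prod_unfold)
    then show ?thesis
      by (simp only:) (intro compact_Int_closed cW closed_Int A B C A' B' C')
  qed
  have "compact (\<Union>i\<in>D. fst ` F i)"
    by (intro compact_UN fD compact_continuous_image compF continuous_intros)
  then have closed: "closed (\<Union>i\<in>D. fst ` F i)" by (rule compact_imp_closed)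
  have pert: "t \<in> (\<Union>i\<in>D. fst ` F i)" if t: "0 < t" "t < 1" and gpt: "general_position P (?T t ` R)" for t
  proof -
    interpret general_position P "?T t ` R" by (rule gpt)
    obtain z w v p p' p'' q q' q'' where nz: "z \<noteq> 0" "w \<noteq> 0" "v \<noteq> 0"
      and d: "distinct [p, p', p'']" "distinct [q, q', q'']"
      and m: "{p, p', p''} \<subseteq> maximizers P z" "q \<in> maximizers (?T t ` R) z"
       "{p, p'} \<subseteq> maximizers P w" "{q, q'} \<subseteq> maximizers (?T t ` R) w"
       "p \<in> maximizers P v" "{q, q', q''} \<subseteq> maximizers (?T t ` R) v"
      using short_path_in_general_position unfolding short_path_def by (elim exE conjE) (rule that)
    have sub: "{q, q', q''} \<subseteq> ?T t ` R" using m(6) maximizers_subset by (rule order_trans)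
    obtain r where r1: "q = ?T t r" "r \<in> R" using sub by blast
    obtain r' where r2: "q' = ?T t r'" "r' \<in> R" using sub by blast
    obtain r'' where r3: "q'' = ?T t r''" "r'' \<in> R" using sub by blast
    have r: "q = ?T t r" "q' = ?T t r'" "q'' = ?T t r''" "{r, r', r''} \<subseteq> R" using r1 r2 r3 by auto
    have dr: "distinct [r, r', r'']" using d(2) r by auto
    have pP: "{p, p', p''} \<subseteq> P" using m(1) maximizers_subset by (rule order_trans)
    have MP: "mP (sgn a) s" if "s \<in> maximizers P a" for s a
      using that by (auto simp: mP_def maximizers_def sgn_div_norm intro!: mult_left_mono)
    have MR: "mR t (sgn a) s" if "?T t s \<in> maximizers (?T t ` R) a" for s a
      using that by (auto simp: mR_def maximizers_def sgn_div_norm intro!: mult_left_mono)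
    have "(t, sgn z, sgn w, sgn v) \<in> F (p, p', p'', r, r', r'')"
      using m r nz t MP MR by (auto simp: F_def W_def norm_sgn)
    moreover have "(p, p', p'', r, r', r'') \<in> D" using d dr pP r by (simp add: D_def)
    ultimately show ?thesis by force
  qed
  have "\<forall>\<^sub>F t in at_right (0 :: real). t \<in> (\<Union>i\<in>D. fst ` F i)"
    using gp eventually_at_right_less[of 0] eventually_at_right_real[of 0 1, simplified]
    by eventually_elim (use pert in auto)
  then have "0 \<in> (\<Union>i\<in>D. fst ` F i)"
    by (rule Lim_in_closed_set[OF closed _ trivial_limit_at_right_real]) (rule tendsto_ident_at)
  then obtain i f where i: "i \<in> D" "f \<in> F i" "fst f = 0" by auto
  obtain p p' p'' r r' r'' where ip: "i = (p, p', p'', r, r', r'')" by (metis surj_pair)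
  obtain a b c where f: "f = (0, a, b, c)" using i(3) by (metis prod.collapse)
  have nz: "a \<noteq> 0" "b \<noteq> 0" "c \<noteq> 0" using i(2) f ip by (auto simp: F_def W_def)
  have mP: "s \<in> maximizers P v" if "mP v s" "s \<in> P" for s v using that by (auto simp: mP_def maximizers_def)
  have mR: "s \<in> maximizers R v" if "mR 0 v s" "s \<in> R" for s v using that by (auto simp: mR_def maximizers_def shear_def)
  have m: "{p, p', p''} \<subseteq> maximizers P a" "r \<in> maximizers R a" "{p, p'} \<subseteq> maximizers P b" "{r, r'} \<subseteq> maximizers R b"
     "p \<in> maximizers P c" "{r, r', r''} \<subseteq> maximizers R c"
    using i f ip mP mR by (auto simp: F_def D_def)
  have d: "distinct [p, p', p'']" "distinct [r, r', r'']" using i ip by (auto simp: D_def)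
  show ?thesis by (rule short_pathI[OF nz d m])
qed

section \<open>From the overlay to the dual graph\<close>

lemma not_collinear_extreme_points:
  fixes S :: "'a::euclidean_space set"
  assumes "p extreme_point_of S" "q extreme_point_of S" "r extreme_point_of S" "distinct [p, q, r]"
  shows "2 \<le> aff_dim {p, q, r}"
proof -
  have mem: "p \<in> S" "q \<in> S" "r \<in> S" using assms by (auto simp: extreme_point_of_def)
  have "\<not> between (b, c) a" if "a extreme_point_of S" "b \<in> S" "c \<in> S" "a \<noteq> b" "a \<noteq> c" for a b c
    using that by (auto simp: between_mem_segment extreme_point_of_def open_segment_def)
  then have "\<not> collinear {p, q, r}"
    using assms mem unfolding collinear_between_cases by auto
  then show ?thesis by (simp add: collinear_aff_dim)
qed

locale four_polytope =
  fixes Q :: "(real^4) set"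
  assumes polytope_Q: "polytope Q" and dim_Q: "aff_dim Q = 4"
begin

lemma convex_Q: "convex Q"
  by (rule polytope_imp_convex[OF polytope_Q])

text \<open>
The intersection of two different facets has dimension at most two, since it is a proper face of one of them.
\<close>

lemma adjacent_or_equal:
  assumes F: "F facet_of Q" and G: "G facet_of Q" and d: "2 \<le> aff_dim (F \<inter> G)"
  shows "F = G \<or> (F, G) \<in> dual_graph Q"
proof (cases "F = G")
  case False
  have face: "F face_of Q" "G face_of Q" and dF: "aff_dim F = 3" "aff_dim G = 3"
    using F G dim_Q by (auto simp: facet_of_def)
  have FG: "(F \<inter> G) face_of Q" using face by (rule face_of_Int)
  have "(F \<inter> G) face_of F" by (rule face_of_subset[OF FG]) (use face_of_imp_subset[OF face(1)] in auto)
  moreover have "(F \<inter> G) face_of G" by (rule face_of_subset[OF FG]) (use face_of_imp_subset[OF face(2)] in auto)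
  moreover have "aff_dim (F \<inter> G) < 3"
  proof -
    have "F \<inter> G \<noteq> F \<or> F \<inter> G \<noteq> G" using False by auto
    then show ?thesis
      using face_of_aff_dim_lt[OF face_of_imp_convex[OF face(1)] calculation(1)]
        face_of_aff_dim_lt[OF face_of_imp_convex[OF face(2)] calculation(2)] dF by auto
  qed
  ultimately show ?thesis using F G False d dim_Q
    by (auto simp: dual_graph_def adjacent_facets_def intro!: exI[of _ "F \<inter> G"])
qed simp

lemma facet_if_dim_3:
  assumes "F face_of Q" "aff_dim F = 3"
  shows "F facet_of Q"
  using assms dim_Q by (auto simp: facet_of_def)

lemma proper_face_dim:
  assumes "F face_of Q" "F \<noteq> Q"
  shows "aff_dim F \<le> 3"
  using face_of_aff_dim_lt[OF convex_Q assms] dim_Q by simp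

end

lemma walk_extend:
  assumes "\<exists>n\<le>k. (a, b) \<in> E ^^ n" "b = c \<or> (b, c) \<in> E"
  shows "\<exists>n\<le>Suc k. (a, c) \<in> E ^^ n"
proof -
  obtain n where n: "n \<le> k" "(a, b) \<in> E ^^ n" using assms(1) by blast
  show ?thesis
  proof (cases "b = c")
    case True then show ?thesis using n by (intro exI[of _ n]) auto
  next
    case False
    then have "(a, c) \<in> E ^^ Suc n" using n assms(2) by auto
    then show ?thesis using n by (intro exI[of _ "Suc n"]) auto
  qed
qed

text \<open>
A prismatoid in coordinates: \<open>a\<close> is the common normal of the bases \<open>A\<close> and \<open>B\<close>, and \<open>g\<close> identifies \<open>\<real>\<^sup>3\<close> with
the linear hyperplane orthogonal to \<open>a\<close>, that is, with the functionals modulo multiples of \<open>a\<close>.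
\<close>

locale spread_polytope = four_polytope +
  fixes A B :: "(real^4) set" and a :: "real^4" and \<alpha> \<beta> :: real
    and g :: "real^3 \<Rightarrow> real^4"
  assumes facets: "A facet_of Q" "B facet_of Q"
    and extreme_points: "{v. v extreme_point_of Q} \<subseteq> A \<union> B"
    and levels: "A \<subseteq> {x. a \<bullet> x = \<alpha>}" "B \<subseteq> {x. a \<bullet> x = \<beta>}" "\<beta> \<noteq> \<alpha>"
    and a_nz: "a \<noteq> 0"
    and g: "linear g" "inj g" "range g = {x. a \<bullet> x = 0}"
begin

lemma swap: "spread_polytope Q B A a \<beta> \<alpha> g"
  by (intro spread_polytope.intro four_polytope_axioms spread_polytope_axioms.intro)
    (use facets extreme_points levels a_nz g in auto)

text \<open>
The projection along \<open>a\<close>, defined as the adjoint of \<open>g\<close> so that functionals on the shadow pull back along \<open>g\<close>.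
\<close>

definition shadow :: "real^4 \<Rightarrow> real^3" where
  "shadow = adjoint g"

lemma inner_shadow: "u \<bullet> shadow x = g u \<bullet> x"
  unfolding shadow_def by (rule adjoint_works[OF g(1)])

definition corners :: "(real^4) set \<Rightarrow> (real^4) set" where
  "corners F = {v. v extreme_point_of F}"

lemma facet_dim: "aff_dim A = 3" "aff_dim B = 3"
  using facets dim_Q by (auto simp: facet_of_def)

lemma facet_faces: "A face_of Q" "B face_of Q"
  using facets by (auto simp: facet_of_def)

lemma polytope_facets: "polytope A" "polytope B"
  using face_of_polytope_polytope[OF polytope_Q] facet_faces by auto

lemma finite_corners: "finite (corners A)" "finite (corners B)"
  unfolding corners_def using polytope_facets by (auto intro: finite_polyhedron_extreme_points polytope_imp_polyhedron)

lemma corners_subset: "corners A \<subseteq> A"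
  by (auto simp: corners_def extreme_point_of_def)

lemma hull_corners: "A = convex hull (corners A)"
  unfolding corners_def
  by (rule Krein_Milman_Minkowski) (use polytope_facets polytope_imp_compact polytope_imp_convex in auto)

lemma corners_nonempty: "corners A \<noteq> {}"
  using hull_corners facet_dim by auto

lemma Q_hull: "Q = convex hull (corners A \<union> corners B)"
proof -
  have "{v. v extreme_point_of Q} \<subseteq> corners A \<union> corners B"
    using extreme_points extreme_point_of_face[OF facet_faces(1)] extreme_point_of_face[OF facet_faces(2)]
    by (auto simp: corners_def)
  then have "convex hull {v. v extreme_point_of Q} \<subseteq> convex hull (corners A \<union> corners B)"
    by (rule hull_mono)
  moreover have "Q = convex hull {v. v extreme_point_of Q}"
    by (rule Krein_Milman_Minkowski) (use polytope_Q polytope_imp_compact polytope_imp_convex in auto)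
  moreover have "convex hull (corners A \<union> corners B) \<subseteq> Q"
  proof (rule hull_minimal)
    show "corners A \<union> corners B \<subseteq> Q"
      using facet_faces face_of_imp_subset by (fastforce simp: corners_def extreme_point_of_def)
  qed (rule convex_Q)
  ultimately show ?thesis by blast
qed

lemma affine_hull_A: "affine hull A = {x. a \<bullet> x = \<alpha>}"
proof (rule affine_dim_equal)
  show "affine hull A \<subseteq> {x. a \<bullet> x = \<alpha>}"
    using levels by (intro hull_minimal) (auto simp: affine_hyperplane)
  show "aff_dim (affine hull A) = aff_dim {x. a \<bullet> x = \<alpha>}"
    using facet_dim a_nz by simp
  show "affine hull A \<noteq> {}" using corners_nonempty corners_subset by auto
qed (auto simp: affine_hyperplane)

lemma shadow_full:
  assumes "\<And>p q. p \<in> shadow ` corners A \<Longrightarrow> q \<in> shadow ` corners A \<Longrightarrow> v \<bullet> p = v \<bullet> q"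
  shows "v = 0"
proof -
  obtain p where p: "p \<in> corners A" using corners_nonempty by blast
  have "g v \<bullet> x = g v \<bullet> p" if "x \<in> corners A" for x
    using assms[of "shadow x" "shadow p"] that p by (simp add: inner_shadow)
  then have "corners A \<subseteq> {x. g v \<bullet> x = g v \<bullet> p}" by blast
  then have "convex hull (corners A) \<subseteq> {x. g v \<bullet> x = g v \<bullet> p}"
    by (intro hull_minimal) (auto simp: convex_hyperplane)
  then have "A \<subseteq> {x. g v \<bullet> x = g v \<bullet> p}" using hull_corners by simp
  then have "affine hull A \<subseteq> {x. g v \<bullet> x = g v \<bullet> p}"
    by (intro hull_minimal) (auto simp: affine_hyperplane)
  then have H: "{x. a \<bullet> x = \<alpha>} \<subseteq> {x. g v \<bullet> x = g v \<bullet> p}" by (simp add: affine_hull_A)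
  have "a \<bullet> p = \<alpha>" using p corners_subset levels by auto
  moreover have "a \<bullet> g v = 0" using g(3) by auto
  ultimately have "p + g v \<in> {x. a \<bullet> x = \<alpha>}" by (simp add: inner_add_right)
  then have "g v \<bullet> (p + g v) = g v \<bullet> p" using H by blast
  then have "g v = 0" by (simp add: inner_add_right)
  then show "v = 0" using g by (metis injD linear_0)
qed

lemma shadow_extreme:
  assumes "p \<in> shadow ` corners A"
  shows "\<exists>u. maximizers (shadow ` corners A) u = {p}"
proof -
  obtain q where q: "q \<in> corners A" "p = shadow q" using assms by auto
  have "{q} face_of A" using q(1) by (simp add: corners_def face_of_singleton)
  then have "{q} exposed_face_of A"
    using exposed_face_of_polyhedron[OF polytope_imp_polyhedron[OF polytope_facets(1)]] by blast
  then obtain v b where v: "A \<subseteq> {x. v \<bullet> x \<le> b}" "{q} = A \<inter> {x. v \<bullet> x = b}"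
    by (auto simp: exposed_face_of_def)
  define k where "k = (a \<bullet> v) / (a \<bullet> a)"
  have "a \<bullet> (v - k *\<^sub>R a) = 0" using a_nz by (simp add: k_def inner_diff_right)
  then have "v - k *\<^sub>R a \<in> range g" using g(3) by simp
  then obtain u where u: "g u = v - k *\<^sub>R a" by auto
  have val: "u \<bullet> shadow x = v \<bullet> x - k * \<alpha>" if "x \<in> A" for x
    using that levels by (auto simp: inner_shadow u inner_diff_left)
  have "maximizers (shadow ` corners A) u = {p}"
  proof (rule maximizers_singleton_eqI[OF assms])
    fix y assume y: "y \<in> shadow ` corners A" "y \<noteq> p"
    then obtain x where x: "x \<in> corners A" "y = shadow x" "x \<noteq> q" using q by auto
    have xA: "x \<in> A" "q \<in> A" using x q corners_subset by auto
    have "v \<bullet> x \<noteq> b" "v \<bullet> q = b" "v \<bullet> x \<le> b" using v xA x(3) by auto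
    then show "u \<bullet> y < u \<bullet> p" using val[OF xA(1)] val[OF xA(2)] x(2) q(2) by simp
  qed
  then show ?thesis by blast
qed

text \<open>
Adding a multiple of \<open>a\<close> to the functional \<open>g u\<close> changes its values on the two bases by different
constants. With the right multiple, the maxima over \<open>A\<close> and \<open>B\<close> agree.
\<close>

lemma face_of_normal:
  assumes "u \<noteq> 0"
  shows "\<exists>F. F face_of Q \<and> F \<noteq> Q \<and> (\<forall>p\<in>corners A. shadow p \<in> maximizers (shadow ` corners A) u \<longrightarrow> p \<in> F) \<and>
     (\<forall>r\<in>corners B. shadow r \<in> maximizers (shadow ` corners B) u \<longrightarrow> r \<in> F)"
proof -
  interpret sw: spread_polytope Q B A a \<beta> \<alpha> g by (rule swap)
  obtain p where p: "p \<in> maximizers (shadow ` corners A) u"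
    using maximizers_nonempty[of "shadow ` corners A" u] finite_corners corners_nonempty by auto
  obtain r where r: "r \<in> maximizers (shadow ` corners B) u"
    using maximizers_nonempty[of "shadow ` corners B" u] finite_corners sw.corners_nonempty
    by auto
  define c where "c = (u \<bullet> r - u \<bullet> p) / (\<alpha> - \<beta>)"
  define n where "n = g u + c *\<^sub>R a"
  define m where "m = u \<bullet> p + c * \<alpha>"
  have m: "m = u \<bullet> r + c * \<beta>"
  proof -
    have "c * (\<alpha> - \<beta>) = u \<bullet> r - u \<bullet> p" using levels(3) by (simp add: c_def)
    then show ?thesis by (simp add: m_def algebra_simps)
  qed
  have nA: "n \<bullet> x = u \<bullet> shadow x + c * \<alpha>" if "x \<in> corners A" for x
    using that corners_subset levels by (auto simp: n_def inner_add_left inner_shadow)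
  have nB: "n \<bullet> x = u \<bullet> shadow x + c * \<beta>" if "x \<in> corners B" for x
    using that sw.corners_subset levels by (auto simp: n_def inner_add_left inner_shadow)
  have "corners A \<union> corners B \<subseteq> {x. n \<bullet> x \<le> m}"
  proof -
    have "n \<bullet> x \<le> m" if "x \<in> corners A" for x
      using nA[OF that] p that by (auto simp: maximizers_def m_def)
    moreover have "n \<bullet> x \<le> m" if "x \<in> corners B" for x
      using nB[OF that] r that m by (auto simp: maximizers_def)
    ultimately show ?thesis by auto
  qed
  then have "convex hull (corners A \<union> corners B) \<subseteq> {x. n \<bullet> x \<le> m}"
    by (intro hull_minimal) (auto simp: convex_halfspace_le)
  then have Q: "Q \<subseteq> {x. n \<bullet> x \<le> m}" using Q_hull by simp
  let ?F = "Q \<inter> {x. n \<bullet> x = m}"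
  have n0: "n \<noteq> 0"
  proof
    assume "n = 0"
    then have "g u = (- c) *\<^sub>R a" by (simp add: n_def eq_neg_iff_add_eq_0)
    moreover have "a \<bullet> g u = 0" using g(3) by auto
    ultimately have "g u \<bullet> g u = 0" by (metis inner_commute inner_scaleR_right mult_zero_right)
    then have "g u = 0" by simp
    then show False using assms g by (metis injD linear_0)
  qed
  have "?F face_of Q" using Q by (intro face_of_Int_supporting_hyperplane_le convex_Q) auto
  moreover have "?F \<noteq> Q"
  proof
    assume "?F = Q"
    then have "aff_dim Q \<le> aff_dim {x. n \<bullet> x = m}" by (intro aff_dim_subset) auto
    then show False using dim_Q n0 by simp
  qed
  moreover have "corners A \<union> corners B \<subseteq> Q" using Q_hull hull_subset by metis
  moreover have "n \<bullet> x = m" if "x \<in> corners A" "shadow x \<in> maximizers (shadow ` corners A) u" for x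
    using nA[OF that(1)] maximizers_value_eq[OF that(2) p] by (simp add: m_def)
  moreover have "n \<bullet> x = m" if "x \<in> corners B" "shadow x \<in> maximizers (shadow ` corners B) u" for x
    using nB[OF that(1)] maximizers_value_eq[OF that(2) r] m by simp
  ultimately show ?thesis by (intro exI[of _ ?F]) auto
qed

text \<open>
The face meets \<open>A\<close> in dimension at least two, and it is larger than this intersection because it contains a point
of \<open>B\<close>.
\<close>

lemma facet_of_normal:
  assumes F: "F face_of Q" "F \<noteq> Q" and p: "{p, p', p''} \<subseteq> corners A" "distinct [p, p', p'']" "{p, p', p''} \<subseteq> F"
    and r: "r \<in> corners B" "r \<in> F"
  shows "F facet_of Q" "2 \<le> aff_dim (A \<inter> F)"
proof -
  interpret sw: spread_polytope Q B A a \<beta> \<alpha> g by (rule swap)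
  have "2 \<le> aff_dim {p, p', p''}"
    using p by (intro not_collinear_extreme_points[of _ A]) (auto simp: corners_def)
  also have "\<dots> \<le> aff_dim (A \<inter> F)" using p corners_subset by (intro aff_dim_subset) auto
  finally show d: "2 \<le> aff_dim (A \<inter> F)" .
  have AF: "(A \<inter> F) face_of Q" using facet_faces(1) F(1) by (rule face_of_Int)
  have "(A \<inter> F) face_of F" by (rule face_of_subset[OF AF]) (use face_of_imp_subset[OF F(1)] in auto)
  moreover have "r \<notin> A"
    using r levels sw.corners_subset by auto
  then have "A \<inter> F \<noteq> F" using r by auto
  ultimately have "aff_dim (A \<inter> F) < aff_dim F"
    by (rule face_of_aff_dim_lt[OF face_of_imp_convex[OF F(1)]])
  then have "aff_dim F = 3" using d proper_face_dim[OF F] by simp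
  then show "F facet_of Q" by (rule facet_if_dim_3[OF F(1)])
qed

lemma edge_and_point_dim:
  assumes "p \<in> corners A" "p' \<in> corners A" "p \<noteq> p'" "r \<in> corners B" "{p, p', r} \<subseteq> S"
  shows "2 \<le> aff_dim S"
proof -
  interpret sw: spread_polytope Q B A a \<beta> \<alpha> g by (rule swap)
  have "affine hull {p, p'} \<subseteq> {x. a \<bullet> x = \<alpha>}"
    using assms corners_subset levels by (intro hull_minimal) (auto simp: affine_hyperplane)
  moreover have "a \<bullet> r = \<beta>" using assms(4) levels sw.corners_subset by auto
  ultimately have "r \<notin> affine hull {p, p'}" using levels(3) by auto
  then have "aff_dim (insert r {p, p'}) = 2" using assms(3) by (simp add: aff_dim_insert)
  moreover have "aff_dim (insert r {p, p'}) \<le> aff_dim S" using assms(5) by (intro aff_dim_subset) auto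
  ultimately show ?thesis by simp
qed

text \<open>
The faces \<open>Z\<close>, \<open>X\<close> and \<open>W\<close> of a red vertex, a crossing and a blue vertex form the walk from \<open>A\<close> to \<open>B\<close>. The
two edges at the crossing may be parallel in the limit of the perturbation. Then \<open>X\<close> can be a ridge, but in
this case it lies in both \<open>Z\<close> and \<open>W\<close>, which are adjacent or equal.
\<close>

lemma walk_exists: "\<exists>n\<le>4. (A, B) \<in> dual_graph Q ^^ n"
proof -
  interpret sw: spread_polytope Q B A a \<beta> \<alpha> g by (rule swap)
  have "short_path (shadow ` corners A) (shadow ` corners B)"
  proof (rule short_path_exists)
    show "finite (shadow ` corners A)" "finite (shadow ` corners B)" using finite_corners by auto
  qed (fact shadow_extreme sw.shadow_extreme shadow_full sw.shadow_full)+
  then obtain z x w p p' p'' r r' r'' where nz: "z \<noteq> 0" "x \<noteq> 0" "w \<noteq> 0"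
    and d: "distinct [p, p', p'']" "distinct [r, r', r'']"
    and m: "{p, p', p''} \<subseteq> maximizers (shadow ` corners A) z" "r \<in> maximizers (shadow ` corners B) z"
     "{p, p'} \<subseteq> maximizers (shadow ` corners A) x" "{r, r'} \<subseteq> maximizers (shadow ` corners B) x"
     "p \<in> maximizers (shadow ` corners A) w" "{r, r', r''} \<subseteq> maximizers (shadow ` corners B) w"
    unfolding short_path_def by (elim exE conjE) (rule that)
  have sub: "{p, p', p''} \<subseteq> shadow ` corners A" "{r, r', r''} \<subseteq> shadow ` corners B"
    by (rule order_trans[OF m(1) maximizers_subset], rule order_trans[OF m(6) maximizers_subset])
  obtain q where q: "p = shadow q" "q \<in> corners A" using sub by blast
  obtain q' where q': "p' = shadow q'" "q' \<in> corners A" using sub by blast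
  obtain q'' where q'': "p'' = shadow q''" "q'' \<in> corners A" using sub by blast
  obtain s where s: "r = shadow s" "s \<in> corners B" using sub by blast
  obtain s' where s': "r' = shadow s'" "s' \<in> corners B" using sub by blast
  obtain s'' where s'': "r'' = shadow s''" "s'' \<in> corners B" using sub by blast
  have dq: "distinct [q, q', q'']" "distinct [s, s', s'']" using d q q' q'' s s' s'' by auto
  obtain Z where Z: "Z face_of Q" "Z \<noteq> Q" "{q, q', q''} \<subseteq> Z" "s \<in> Z"
    using face_of_normal[OF nz(1)] m(1,2) q q' q'' s by auto
  obtain X where X: "X face_of Q" "X \<noteq> Q" "{q, q'} \<subseteq> X" "{s, s'} \<subseteq> X"
    using face_of_normal[OF nz(2)] m(3,4) q q' s s' by auto
  obtain W where W: "W face_of Q" "W \<noteq> Q" "q \<in> W" "{s, s', s''} \<subseteq> W"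
    using face_of_normal[OF nz(3)] m(5,6) q s s' s'' by auto
  have ZA: "Z facet_of Q" "2 \<le> aff_dim (A \<inter> Z)"
    using facet_of_normal[OF Z(1,2) _ dq(1) Z(3) s(2) Z(4)] q q' q'' by auto
  have WB: "W facet_of Q" "2 \<le> aff_dim (B \<inter> W)"
    using sw.facet_of_normal[OF W(1,2) _ dq(2) W(4) _ W(3)] q s s' s'' by auto
  have XZ: "2 \<le> aff_dim (Z \<inter> X)"
    using q q' s dq X Z by (intro edge_and_point_dim[of q q' s]) auto
  have XW: "2 \<le> aff_dim (X \<inter> W)"
    using q s s' dq X W by (intro sw.edge_and_point_dim[of s s' q]) auto
  have 0: "\<exists>n\<le>0. (A, A) \<in> dual_graph Q ^^ n" by auto
  have 1: "A = Z \<or> (A, Z) \<in> dual_graph Q" using adjacent_or_equal[OF facets(1) ZA] .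
  have 4: "W = B \<or> (W, B) \<in> dual_graph Q"
    using adjacent_or_equal[OF WB(1) facets(2)] WB(2) by (simp add: Int_commute)
  show ?thesis
  proof (cases "aff_dim X = 3")
    case True
    then have Xf: "X facet_of Q" by (rule facet_if_dim_3[OF X(1)])
    have 2: "Z = X \<or> (Z, X) \<in> dual_graph Q" using adjacent_or_equal[OF ZA(1) Xf XZ] .
    have 3: "X = W \<or> (X, W) \<in> dual_graph Q" using adjacent_or_equal[OF Xf WB(1) XW] .
    show ?thesis
      using walk_extend[OF walk_extend[OF walk_extend[OF walk_extend[OF 0 1] 2] 3] 4] by (simp add: numeral_eq_Suc)
  next
    case False
    then have dX: "aff_dim X \<le> 2" using proper_face_dim[OF X(1,2)] by simp
    \<comment> \<open>A face that meets the ridge \<open>X\<close> in dimension two contains it.\<close>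
    have inside: "X \<subseteq> F" if F: "F face_of Q" "2 \<le> aff_dim (X \<inter> F)" for F
    proof (rule ccontr)
      assume "\<not> X \<subseteq> F"
      then have "X \<inter> F \<noteq> X" by auto
      moreover have "(X \<inter> F) face_of X"
        by (rule face_of_subset[OF face_of_Int[OF X(1) F(1)]]) (use face_of_imp_subset[OF X(1)] in auto)
      ultimately have "aff_dim (X \<inter> F) < aff_dim X"
        using face_of_aff_dim_lt[OF face_of_imp_convex[OF X(1)]] by blast
      then show False using F(2) dX by simp
    qed
    have "X \<subseteq> Z \<inter> W" using inside[OF Z(1)] inside[OF W(1)] XZ XW by (simp add: Int_commute)
    then have "aff_dim X \<le> aff_dim (Z \<inter> W)" by (rule aff_dim_subset)
    moreover have "aff_dim (Z \<inter> X) \<le> aff_dim X" by (intro aff_dim_subset) auto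
    ultimately have "2 \<le> aff_dim (Z \<inter> W)" using XZ by simp
    then have 2: "Z = W \<or> (Z, W) \<in> dual_graph Q" by (rule adjacent_or_equal[OF ZA(1) WB(1)])
    then have "\<exists>n\<le>Suc (Suc (Suc 0)). (A, B) \<in> dual_graph Q ^^ n"
      by (rule walk_extend[OF walk_extend[OF walk_extend[OF 0 1]] 4])
    then obtain n where "n \<le> Suc (Suc (Suc 0))" "(A, B) \<in> dual_graph Q ^^ n" by blast
    then show ?thesis by (intro exI[of _ n]) simp
  qed
qed

end

theorem theorem1p1:
  fixes Q Qp Qm :: "(real ^ 4) set"
  assumes "prismatoid Q Qp Qm"
    and "aff_dim Q = 4"
  shows "width Q Qp Qm \<le> 4"
proof -
  have Q: "polytope Q" "Qp facet_of Q" "Qm facet_of Q" "Qp \<noteq> Qm"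
    "affine_parallel (affine hull Qp) (affine hull Qm)" "{v. v extreme_point_of Q} \<subseteq> Qp \<union> Qm"
    using assms(1) by (auto simp: prismatoid_def)
  obtain a \<alpha> where a: "a \<noteq> 0" "Q \<subseteq> {x. a \<bullet> x \<le> \<alpha>}" "Qp = Q \<inter> {x. a \<bullet> x = \<alpha>}"
    using facet_of_polyhedron[OF polytope_imp_polyhedron[OF Q(1)] Q(2)] by blast
  obtain d where d: "affine hull Qm = (\<lambda>x. d + x) ` (affine hull Qp)"
    using Q(5) by (auto simp: affine_parallel_def)
  define \<beta> where "\<beta> = \<alpha> + a \<bullet> d"
  have "affine hull Qp \<subseteq> {x. a \<bullet> x = \<alpha>}" using a by (intro hull_minimal) (auto simp: affine_hyperplane)
  then have "affine hull Qm \<subseteq> {x. a \<bullet> x = \<beta>}" using d by (auto simp: \<beta>_def inner_add_right)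
  then have Qm: "Qm \<subseteq> {x. a \<bullet> x = \<beta>}" using hull_subset[of Qm affine] by blast
  have faces: "Qp face_of Q" "Qm face_of Q" and dims: "aff_dim Qp = aff_dim Q - 1" "aff_dim Qm = aff_dim Q - 1"
    using Q by (auto simp: facet_of_def)
  have "\<beta> \<noteq> \<alpha>"
  proof
    assume "\<beta> = \<alpha>"
    then have sub: "Qm \<subseteq> Qp" using Qm a(3) face_of_imp_subset[OF faces(2)] by auto
    have "Qm face_of Qp" by (rule face_of_subset[OF faces(2) sub face_of_imp_subset[OF faces(1)]])
    then show False
      using face_of_aff_dim_lt[OF face_of_imp_convex[OF faces(1)], of Qm] Q(4) dims by auto
  qed
  have same_dim: "dim (UNIV :: (real^3) set) = dim {x. a \<bullet> x = 0}"
    using dim_hyperplane[OF a(1)] by simp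
  obtain g :: "real^3 \<Rightarrow> real^4" and g' where g: "linear g" "range g = {x. a \<bullet> x = 0}" "\<And>x. g' (g x) = x"
  proof (rule isometries_subspaces[OF subspace_UNIV subspace_hyperplane same_dim])
    fix f :: "real^3 \<Rightarrow> real^4" and h
    assume "linear f" "range f = {x. a \<bullet> x = 0}" "\<And>x. x \<in> UNIV \<Longrightarrow> h (f x) = x"
    then show thesis by (intro that[of f h]) auto
  qed
  have "inj g" by (rule inj_on_inverseI[of _ g']) (rule g(3))
  interpret spread_polytope Q Qp Qm a \<alpha> \<beta> g
    by (intro spread_polytope.intro four_polytope.intro spread_polytope_axioms.intro)
      (use Q assms(2) a Qm \<open>\<beta> \<noteq> \<alpha>\<close> g \<open>inj g\<close> in auto)
  obtain n where n: "n \<le> 4" "(Qp, Qm) \<in> dual_graph Q ^^ n" using walk_exists by blast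
  have "width Q Qp Qm \<le> enat n" unfolding width_def using n(2) by (intro INF_lower) simp
  also have "\<dots> \<le> 4" using n(1) by (simp add: numeral_eq_enat)
  finally show ?thesis .
qed

end
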